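(* Let $n\ge2$, let $G$ be a finite group acting on a finite set $S$ with $|S|\ge1$, and let $T\subseteq S$ be $G$-invariant. Suppose every $G$-orbit contained in $S\setminus T$ either consists of a single element or has trivial stabilizer. Then the order complex of $\mathcal{P}_n(G,S,T)\setminus\{\hat 0\}$ is homotopy equivalent to a wedge of $d$-dimensional spheres, where $d=n-1$ if $T\neq\varnothing$ or at least one $G$-orbit in $S\setminus T$ is a single element, and $d=n-2$ otherwise.
   Context: Let $[n]=\{1,\dots,n\}$. A partial $G$-partition of $[n]$ is a set $\tilde\beta=\{\tilde B_1,\dots,\tilde B_\ell\}$ where $\{B_1,\dots,B_\ell\}$ is a partition of a subset $\bigcup B_i\subseteq[n]$ into nonempty blocks, each $\tilde B_i$ consisting of $B_i$ with a function $b_i\colon B_i\to G$ up to $b_i\sim b_ig$ ($g\in G$). The zero block is $Z=[n]\setminus\bigcup B_i$. The $S$-Dowling poset $\mathcal{D}_n(G,S)$ is the set of pairs $(\tilde\beta,z)$, $z\colon Z\to S$, ordered by the relation generated by: (merge) $(\tilde\beta\cup\{\tilde A,\tilde B\},z)\prec(\tilde\beta\cup\{\tilde C\},z)$ with $C=A\cup B$, $c|_A=a$, $c|_B=b\cdot g$ for some $g\in G$; (color) $(\tilde\beta\cup\{\tilde B\},z)\prec(\tilde\beta,z')$ with $z'$ extending $z$ to $Z\cup B$, $z'(i)=b(i)\cdot s$ for all $i\in B$, some $s\in S$. For $G$-invariant $T\subseteq S$, $\mathcal{P}_n(G,S,T)=\{(\tilde\beta,z)\in\mathcal{D}_n(G,S):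 |z^{-1}(O)|\neq1\text{ for every }G\text{-orbit }O\subseteq S\setminus T\}$ with induced order; its bottom element $\hat 0$ is the partition into singletons with empty zero block. *)

theory Defs
  imports "HOL-Algebra.Group_Action" "HOL-Analysis.Analysis"
begin

section \<open>Partial $G$-partitions and the $S$-Dowling poset\<close>

text \<open>
  Functions on subsets of $[n]$ are represented by partial maps on \<^typ>\<open>nat\<close>, so that the subset is
  the domain of the map. A block $\tilde B$ is the set of all representatives $b : B \to G$ of
  its class under $b \sim b g$.
\<close>

definition rtranslate :: "('g, 'm) monoid_scheme \<Rightarrow> (nat \<rightharpoonup> 'g) \<Rightarrow> 'g \<Rightarrow> (nat \<rightharpoonup> 'g)" where
  "rtranslate G b g = (\<lambda>i. map_option (\<lambda>h. h \<otimes>\<^bsub>G\<^esub> g) (b i))"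

definition gclass :: "('g, 'm) monoid_scheme \<Rightarrow> (nat \<rightharpoonup> 'g) \<Rightarrow> (nat \<rightharpoonup> 'g) set" where
  "gclass G b = {rtranslate G b g | g. g \<in> carrier G}"

definition gblocks :: "nat \<Rightarrow> ('g, 'm) monoid_scheme \<Rightarrow> (nat \<rightharpoonup> 'g) set set" where
  "gblocks n G = {gclass G b | b. dom b \<noteq> {} \<and> dom b \<subseteq> {1..n} \<and> ran b \<subseteq> carrier G}"

text \<open>All representatives of a block have the same domain $B$.\<close>

definition underlying :: "(nat \<rightharpoonup> 'g) set \<Rightarrow> nat set" where
  "underlying B = (\<Union>b\<in>B. dom b)"

definition partial_G_partitions ::
    "nat \<Rightarrow> ('g, 'm) monoid_scheme \<Rightarrow> (nat \<rightharpoonup> 'g) set set set" where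
  "partial_G_partitions n G =
     {\<beta>. \<beta> \<subseteq> gblocks n G \<and>
         (\<forall>A\<in>\<beta>. \<forall>B\<in>\<beta>. A \<noteq> B \<longrightarrow> underlying A \<inter> underlying B = {})}"

definition zero_block :: "nat \<Rightarrow> (nat \<rightharpoonup> 'g) set set \<Rightarrow> nat set" where
  "zero_block n \<beta> = {1..n} - (\<Union>B\<in>\<beta>. underlying B)"

definition dowling ::
    "nat \<Rightarrow> ('g, 'm) monoid_scheme \<Rightarrow> 's set \<Rightarrow> ((nat \<rightharpoonup> 'g) set set \<times> (nat \<rightharpoonup> 's)) set" where
  "dowling n G S =
     {(\<beta>, z). \<beta> \<in> partial_G_partitions n G \<and> dom z = zero_block n \<beta> \<and> ran z \<subseteq> S}"

text \<open>
  The generating relation of the order. In \<open>merge\<close>, the maps \<^term>\<open>a\<close> and \<^term>\<open>b\<close> have disjoint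
  domains, so \<open>a ++ rtranslate G b g\<close> is the function $c$ on $A \cup B$ with $c|_A = a$ and
  $c|_B = b g$; likewise the map union in \<open>color\<close> extends $z$ to $Z \cup B$.
\<close>

inductive dowling_step ::
    "nat \<Rightarrow> ('g, 'm) monoid_scheme \<Rightarrow> 's set \<Rightarrow> ('g \<Rightarrow> 's \<Rightarrow> 's) \<Rightarrow>
     (nat \<rightharpoonup> 'g) set set \<times> (nat \<rightharpoonup> 's) \<Rightarrow> (nat \<rightharpoonup> 'g) set set \<times> (nat \<rightharpoonup> 's) \<Rightarrow> bool"
  for n G S \<phi> where
  merge: "\<lbrakk>(\<beta>, z) \<in> dowling n G S; A \<in> \<beta>; B \<in> \<beta>; A \<noteq> B; a \<in> A; b \<in> B; g \<in> carrier G\<rbrakk> \<Longrightarrow>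
    dowling_step n G S \<phi> (\<beta>, z) (insert (gclass G (a ++ rtranslate G b g)) (\<beta> - {A, B}), z)"
| color: "\<lbrakk>(\<beta>, z) \<in> dowling n G S; B \<in> \<beta>; b \<in> B; s \<in> S\<rbrakk> \<Longrightarrow>
    dowling_step n G S \<phi> (\<beta>, z) (\<beta> - {B}, z ++ (\<lambda>i. map_option (\<lambda>h. \<phi> h s) (b i)))"

definition dowling_le ::
    "nat \<Rightarrow> ('g, 'm) monoid_scheme \<Rightarrow> 's set \<Rightarrow> ('g \<Rightarrow> 's \<Rightarrow> 's) \<Rightarrow>
     (nat \<rightharpoonup> 'g) set set \<times> (nat \<rightharpoonup> 's) \<Rightarrow> (nat \<rightharpoonup> 'g) set set \<times> (nat \<rightharpoonup> 's) \<Rightarrow> bool" where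
  "dowling_le n G S \<phi> = (dowling_step n G S \<phi>)\<^sup>*\<^sup>*"

definition dowling_sub ::
    "nat \<Rightarrow> ('g, 'm) monoid_scheme \<Rightarrow> 's set \<Rightarrow> ('g \<Rightarrow> 's \<Rightarrow> 's) \<Rightarrow> 's set \<Rightarrow>
     ((nat \<rightharpoonup> 'g) set set \<times> (nat \<rightharpoonup> 's)) set" where
  "dowling_sub n G S \<phi> T =
     {(\<beta>, z) \<in> dowling n G S.
        \<forall>Q\<in>orbits G S \<phi>. Q \<subseteq> S - T \<longrightarrow> card {i. \<exists>s\<in>Q. z i = Some s} \<noteq> 1}"

definition dowling_bot ::
    "nat \<Rightarrow> ('g, 'm) monoid_scheme \<Rightarrow> (nat \<rightharpoonup> 'g) set set \<times> (nat \<rightharpoonup> 's)" where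
  "dowling_bot n G = ((\<lambda>i. gclass G [i \<mapsto> \<one>\<^bsub>G\<^esub>]) ` {1..n}, Map.empty)"


section \<open>Order complexes and geometric realizations\<close>

definition order_complex :: "'a set \<Rightarrow> ('a \<Rightarrow> 'a \<Rightarrow> bool) \<Rightarrow> 'a set set" where
  "order_complex P r =
     {C. C \<subseteq> P \<and> finite C \<and> C \<noteq> {} \<and> (\<forall>x\<in>C. \<forall>y\<in>C. r x y \<or> r y x)}"

text \<open>
  The realization of an abstract simplicial complex by barycentric coordinates. The topology is
  that of pointwise convergence, which is the usual (weak) topology when the complex is finite.
\<close>

definition geometric_realization :: "'a set set \<Rightarrow> ('a \<Rightarrow> real) topology" where
  "geometric_realization K =
     subtopology (powertop_real UNIV)
       {x. (\<forall>v. 0 \<le> x v) \<and> {v. x v \<noteq> 0} \<in> K \<and> sum x {v. x v \<noteq> 0} = 1}"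


section \<open>Wedge sums\<close>

text \<open>
  The wedge sum is the quotient of the disjoint union of the spaces \<open>X i\<close> by the identification of
  all the base points \<open>p i\<close>. The class of the base points is \<^const>\<open>None\<close>; it is present also for
  \<open>I = {}\<close>, so that the empty wedge sum is a point.
\<close>

definition wedge_proj :: "('i \<Rightarrow> 'a) \<Rightarrow> 'i \<times> 'a \<Rightarrow> ('i \<times> 'a) option" where
  "wedge_proj p = (\<lambda>(i, x). if x = p i then None else Some (i, x))"

definition wedge_sum ::
    "('i \<Rightarrow> 'a topology) \<Rightarrow> ('i \<Rightarrow> 'a) \<Rightarrow> 'i set \<Rightarrow> ('i \<times> 'a) option topology" where
  "wedge_sum X p I =
     topology (\<lambda>U. U \<subseteq> insert None (wedge_proj p ` topspace (sum_topology X I)) \<and>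
       openin (sum_topology X I) {y \<in> topspace (sum_topology X I). wedge_proj p y \<in> U})"

lemma openin_wedge_sum:
  "openin (wedge_sum X p I) U \<longleftrightarrow>
     U \<subseteq> insert None (wedge_proj p ` topspace (sum_topology X I)) \<and>
     openin (sum_topology X I) {y \<in> topspace (sum_topology X I). wedge_proj p y \<in> U}"
proof -
  let ?Y = "sum_topology X I" and ?q = "wedge_proj p"
  let ?L = "\<lambda>U. U \<subseteq> insert None (?q ` topspace ?Y) \<and> openin ?Y {y \<in> topspace ?Y. ?q y \<in> U}"
  have "istopology ?L"
    unfolding istopology_def
  proof (intro conjI allI impI)
    fix U V assume U: "?L U" and V: "?L V"
    have "{y \<in> topspace ?Y. ?q y \<in> U \<inter> V} =
          {y \<in> topspace ?Y. ?q y \<in> U} \<inter> {y \<in> topspace ?Y. ?q y \<in> V}" by blast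
    moreover have "openin ?Y ({y \<in> topspace ?Y. ?q y \<in> U} \<inter> {y \<in> topspace ?Y. ?q y \<in> V})"
      using U V by (intro openin_Int) (rule conjunct2, assumption)+
    ultimately show "openin ?Y {y \<in> topspace ?Y. ?q y \<in> U \<inter> V}" by (simp only:)
    show "U \<inter> V \<subseteq> insert None (?q ` topspace ?Y)" using U by blast
  next
    fix \<K> assume K: "\<forall>U\<in>\<K>. ?L U"
    have "{y \<in> topspace ?Y. ?q y \<in> \<Union>\<K>} = \<Union>((\<lambda>U. {y \<in> topspace ?Y. ?q y \<in> U}) ` \<K>)" by blast
    moreover have "openin ?Y (\<Union>((\<lambda>U. {y \<in> topspace ?Y. ?q y \<in> U}) ` \<K>))"
      by (rule openin_Union) (use K in \<open>auto simp del: topspace_sum_topology\<close>)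
    ultimately show "openin ?Y {y \<in> topspace ?Y. ?q y \<in> \<Union>\<K>}" by (simp only:)
    show "\<Union>\<K> \<subseteq> insert None (?q ` topspace ?Y)" using K by blast
  qed
  then show ?thesis by (simp add: wedge_sum_def topology_inverse')
qed

lemma topspace_wedge_sum:
  "topspace (wedge_sum X p I) = insert None (wedge_proj p ` topspace (sum_topology X I))"
proof (rule antisym)
  show "topspace (wedge_sum X p I) \<subseteq> insert None (wedge_proj p ` topspace (sum_topology X I))"
    using openin_topspace [of "wedge_sum X p I"] unfolding openin_wedge_sum by blast
  let ?W = "insert None (wedge_proj p ` topspace (sum_topology X I))"
  have "{y \<in> topspace (sum_topology X I). wedge_proj p y \<in> ?W} = topspace (sum_topology X I)"
    by blast
  then have "openin (wedge_sum X p I) ?W"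
    unfolding openin_wedge_sum by (simp only: openin_topspace order_refl simp_thms)
  then show "?W \<subseteq> topspace (wedge_sum X p I)" by (rule openin_subset)
qed

lemma quotient_map_wedge_proj:
  assumes "I \<noteq> {}" and "\<And>i. i \<in> I \<Longrightarrow> p i \<in> topspace (X i)"
  shows "quotient_map (sum_topology X I) (wedge_sum X p I) (wedge_proj p)"
proof -
  obtain i where "i \<in> I" using assms(1) by blast
  then have "(i, p i) \<in> topspace (sum_topology X I)" using assms(2) by simp
  then have "None \<in> wedge_proj p ` topspace (sum_topology X I)"
    by (rule rev_image_eqI) (simp add: wedge_proj_def)
  then have "insert None (wedge_proj p ` topspace (sum_topology X I)) =
             wedge_proj p ` topspace (sum_topology X I)" by (rule insert_absorb)
  then show ?thesis
    unfolding quotient_map_def topspace_wedge_sum openin_wedge_sum by simp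
qed

definition nsphere_base :: "nat \<Rightarrow> real" where
  "nsphere_base = (\<lambda>i. if i = 0 then 1 else 0)"

lemma nsphere_base_in_topspace: "nsphere_base \<in> topspace (nsphere d)"
proof -
  have "(\<Sum>i\<le>d. nsphere_base i ^ 2) = (\<Sum>i\<le>d. if i = 0 then 1 else 0)"
    by (rule sum.cong) (auto simp: nsphere_base_def)
  then have "(\<Sum>i\<le>d. nsphere_base i ^ 2) = 1" by simp
  then show ?thesis by (simp add: nsphere nsphere_base_def)
qed

definition sphere_wedge :: "nat \<Rightarrow> nat \<Rightarrow> (nat \<times> (nat \<Rightarrow> real)) option topology" where
  "sphere_wedge d k = wedge_sum (\<lambda>_. nsphere d) (\<lambda>_. nsphere_base) {..<k}"

end

theory Submission
  imports Defs
begin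

text \<open>
  Encode an element of the Dowling poset as a state: the relation \<open>i = g \<cdot> j\<close> on \<open>[n]\<close> together with
  the colours of the zero block. The order becomes inclusion. Forgetting the colours in the free
  orbits of \<open>S - T\<close> (which turns each of these colour classes into a block) is a coreflection, so
  the order complex collapses to the one of the poset in which every orbit outside \<open>T\<close> is a fixed point.

  For the latter poset one argues by induction on the number of points. Fix a point \<open>n\<close>. Sending a
  state to the greatest state below it in which \<open>n\<close> is a singleton, and joining with the atom \<open>a\<close>
  that merges \<open>n\<close> with another point, contracts the states whose image is not the bottom to \<open>a\<close>.
  The remaining states are added vertex by vertex. Their links are cones or, up to isomorphism, posets
  of the same kind on one point less. Hence, after removing some top-dimensional faces, the order complex
  collapses to a vertex; collapsing a contractible subcomplex to a point leaves a wedge of spheres.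
\<close>

section \<open>Topology\<close>

text \<open>Deleting a family of top-dimensional faces and collapsing the rest to a vertex is a
  combinatorial form of sphericity. It is checked one vertex at a time through links and covers
  every dimension alike, without homology or simple connectivity; topology enters only in realizing
  a collapse and in the final quotient. The obstacle is that links are not quite posets of the given
  kind. Above an atom joining \<open>n\<close> to \<open>i\<close> the pair acts as one point, but a
  fixed colour outside \<open>T\<close> used by that block alone is now legitimate. Moreover, states
  colouring just this pair may still be absent when the link of the atom is taken. The induction
  therefore runs over a larger family, in which only some points are subject to the restriction and
  certain atoms are deleted. The dimension is decided by the colours that survive the removal of the
  free orbits. Along a chain the number of uncoloured blocks strictly decreases from at most
  \<open>n - 1\<close>; it can reach 0 only if a colour is left, and otherwise it stops at 1, which
  costs one dimension.\<close>

lemma homotopy_equivalent_space_quotient: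
  assumes q: "quotient_map X W q"
    and H: "continuous_map (prod_topology (top_of_set {0..1::real}) X) X H"
    and H0: "\<And>x. x \<in> topspace X \<Longrightarrow> H (0, x) = x"
    and Hq: "\<And>t x y. \<lbrakk>t \<in> {0..1}; x \<in> topspace X; y \<in> topspace X; q x = q y\<rbrakk> \<Longrightarrow> q (H (t, x)) = q (H (t, y))"
    and H1: "\<And>x y. \<lbrakk>x \<in> topspace X; y \<in> topspace X; q x = q y\<rbrakk> \<Longrightarrow> H (1, x) = H (1, y)"
  shows "X homotopy_equivalent_space W"
proof -
  let ?I = "top_of_set {0..1::real}"
  have qc: "continuous_map X W q" by (rule quotient_imp_continuous_map [OF q])
  have H1c: "continuous_map X X (H \<circ> Pair 1)"
    by (rule continuous_map_o_Pair [OF H]) simp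
  \<comment> \<open>The homotopy inverse of \<open>q\<close>: the end map of \<open>H\<close> is
    constant on the fibres of \<open>q\<close>, hence factors through \<open>W\<close>. The two
    homotopies needed are \<open>H\<close> itself and the one it induces on
    \<open>W\<close>.\<close>
  obtain g where g: "continuous_map W X g" "\<And>x. x \<in> topspace X \<Longrightarrow> g (q x) = (H \<circ> Pair 1) x"
    using quotient_map_lift_exists [OF q H1c] H1 by (metis comp_apply)
  \<comment> \<open>The product of a quotient map with an identity need not be a quotient map; it is
    one here because the unit interval is compact and Hausdorff. This is what lets \<open>H\<close>
    descend to \<open>W\<close>.\<close>
  have qI: "quotient_map (prod_topology ?I X) (prod_topology ?I W) (\<lambda>(t, x). (t, q x))"
    by (rule quotient_map_prod_right)
       (auto simp: q Hausdorff_space_subtopology intro!: compact_imp_locally_compact_space compact_space_subtopology)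
  have qH: "continuous_map (prod_topology ?I X) W (q \<circ> H)"
    by (rule continuous_map_compose [OF H qc])
  obtain k where k: "continuous_map (prod_topology ?I W) W k"
    "\<And>z. z \<in> topspace (prod_topology ?I X) \<Longrightarrow> k ((\<lambda>(t, x). (t, q x)) z) = (q \<circ> H) z"
  proof (rule quotient_map_lift_exists [OF qI qH])
    fix a b assume "a \<in> topspace (prod_topology ?I X)" "b \<in> topspace (prod_topology ?I X)"
      "(case a of (t, x) \<Rightarrow> (t, q x)) = (case b of (t, x) \<Rightarrow> (t, q x))"
    then show "(q \<circ> H) a = (q \<circ> H) b"
      using Hq [of "fst a" "snd a" "snd b"] by (cases a; cases b) auto
  qed auto
  have kq: "k (t, q x) = q (H (t, x))" if "t \<in> {0..1}" "x \<in> topspace X" for t x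
    using k(2) [of "(t, x)"] that by simp
  have qsurj: "\<exists>x\<in>topspace X. q x = w" if "w \<in> topspace W" for w
    using quotient_imp_surjective_map [OF q] that by (metis imageE)
  have 1: "homotopic_with (\<lambda>x. True) X X id (g \<circ> q)"
    by (subst homotopic_with, simp) (rule exI [of _ H], use H H0 g in auto)
  have 2: "homotopic_with (\<lambda>x. True) W W id (q \<circ> g)"
  proof (subst homotopic_with, simp, intro exI [of _ k] conjI ballI)
    fix w assume "w \<in> topspace W"
    then obtain x where x: "x \<in> topspace X" "q x = w" using qsurj by blast
    show "k (0, w) = id w" using kq [of 0 x] x H0 by simp
    show "k (1, w) = (q \<circ> g) w" using kq [of 1 x] x g by auto
  qed (use k in auto)
  show ?thesis
    unfolding homotopy_equivalent_space_def
    using qc g(1) homotopic_with_symD [OF 1] homotopic_with_symD [OF 2] by blast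
qed

lemma continuous_map_Min:
  assumes "finite A" "A \<noteq> {}" "\<And>a. a \<in> A \<Longrightarrow> continuous_map X euclideanreal (\<lambda>x. f x a)"
  shows "continuous_map X euclideanreal (\<lambda>x. Min (f x ` A))"
  using assms
proof (induction A rule: finite_ne_induct)
  case (insert a A)
  have "continuous_map X euclideanreal (\<lambda>x. min (f x a) (Min (f x ` A)))"
    using insert by (intro continuous_map_real_min) auto
  then show ?case using insert by simp
qed simp

subsection \<open>Simplicial complexes and their realizations\<close>

definition simplicial_complex :: "'a set set \<Rightarrow> bool" where
  "simplicial_complex K \<longleftrightarrow>
     (\<forall>\<sigma>\<in>K. finite \<sigma> \<and> \<sigma> \<noteq> {} \<and> (\<forall>\<rho>. \<rho> \<noteq> {} \<and> \<rho> \<subseteq> \<sigma> \<longrightarrow> \<rho> \<in> K))"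

lemma simplicial_complexD:
  assumes "simplicial_complex K" "\<sigma> \<in> K"
  shows "finite \<sigma>" "\<sigma> \<noteq> {}" "\<And>\<rho>. \<lbrakk>\<rho> \<noteq> {}; \<rho> \<subseteq> \<sigma>\<rbrakk> \<Longrightarrow> \<rho> \<in> K"
  using assms unfolding simplicial_complex_def by blast+

lemma in_realization:
  "x \<in> topspace (geometric_realization K) \<longleftrightarrow>
     (\<forall>v. 0 \<le> x v) \<and> {v. x v \<noteq> 0} \<in> K \<and> sum x {v. x v \<noteq> 0} = 1"
  by (simp add: geometric_realization_def)

lemma in_realizationI:
  assumes "simplicial_complex K" "\<tau> \<in> K" "\<And>v. 0 \<le> x v" "\<And>v. v \<notin> \<tau> \<Longrightarrow> x v = 0" "sum x \<tau> = 1"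
  shows "x \<in> topspace (geometric_realization K)"
proof -
  have fin: "finite \<tau>" using assms simplicial_complexD by blast
  have sub: "{v. x v \<noteq> 0} \<subseteq> \<tau>" using assms(4) by blast
  have s: "sum x {v. x v \<noteq> 0} = sum x \<tau>"
    by (rule sum.mono_neutral_left [OF fin sub]) auto
  have "{v. x v \<noteq> 0} \<noteq> {}"
  proof
    assume e: "{v. x v \<noteq> 0} = {}"
    show False using s assms(5) unfolding e by simp
  qed
  then have "{v. x v \<noteq> 0} \<in> K" by (rule simplicial_complexD(3) [OF assms(1,2) _ sub])
  then show ?thesis using s assms(3,5) by (simp only: in_realization) simp
qed

lemma sum_realization:
  assumes "x \<in> topspace (geometric_realization K)" "finite \<tau>" "{v. x v \<noteq> 0} \<subseteq> \<tau>"
  shows "sum x \<tau> = 1"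
proof -
  have "sum x {v. x v \<noteq> 0} = sum x \<tau>"
    by (rule sum.mono_neutral_left) (use assms in auto)
  then show ?thesis using assms(1) by (simp add: in_realization)
qed

lemma continuous_map_into_realization:
  "continuous_map X (geometric_realization K) f \<longleftrightarrow>
     (\<forall>v. continuous_map X euclideanreal (\<lambda>x. f x v)) \<and>
     f \<in> topspace X \<rightarrow> topspace (geometric_realization K)"
  by (simp add: geometric_realization_def continuous_map_in_subtopology continuous_map_componentwise_UNIV)

lemma continuous_map_realization_proj [continuous_intros]:
  "continuous_map (geometric_realization K) euclideanreal (\<lambda>x. x v)"
  unfolding geometric_realization_def
  by (intro continuous_map_from_subtopology continuous_map_product_projection) auto

lemma elementary_collapse_realization:
  assumes K: "simplicial_complex K" and \<sigma>: "\<sigma> \<in> K" and \<tau>: "insert w \<sigma> \<in> K" and w: "w \<notin> \<sigma>"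
    and free: "\<And>\<rho>. \<lbrakk>\<rho> \<in> K; \<sigma> \<subseteq> \<rho>\<rbrakk> \<Longrightarrow> \<rho> = \<sigma> \<or> \<rho> = insert w \<sigma>"
  shows "geometric_realization K homotopy_equivalent_space
         geometric_realization (K - {\<sigma>, insert w \<sigma>})"
proof -
  let ?X = "geometric_realization K" and ?K' = "K - {\<sigma>, insert w \<sigma>}"
  define m where "m x = Min (x ` \<sigma>)" for x :: "'a \<Rightarrow> real"
  \<comment> \<open>Each of the \<open>card \<sigma>\<close> coordinates gives up
    \<open>s * m x\<close> and \<open>w\<close> receives all of it, so the sum stays 1; at
    \<open>s = 1\<close> the least coordinate in \<open>\<sigma>\<close> is 0.\<close>
  define D where "D s x = (\<lambda>v. if v = w then x v + s * (real (card \<sigma>) * m x)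
      else if v \<in> \<sigma> then x v - s * m x else x v)" for s x
  have fin: "finite \<sigma>" "\<sigma> \<noteq> {}" using simplicial_complexD [OF K \<sigma>] by auto
  have m_le: "m x \<le> x v" if "v \<in> \<sigma>" for x v using fin that by (simp add: m_def)
  have m_ex: "\<exists>v\<in>\<sigma>. x v = m x" for x
    using Min_in [of "x ` \<sigma>"] fin by (fastforce simp: m_def)
  have m0: "0 \<le> m x" if "x \<in> topspace ?X" for x
    using m_ex [of x] that unfolding in_realization by metis
  have mpos: "{v. x v \<noteq> 0} \<subseteq> insert w \<sigma>" if x: "x \<in> topspace ?X" and "m x > 0" for x
  proof -
    have "\<sigma> \<subseteq> {v. x v \<noteq> 0}" using m_le [of _ x] \<open>m x > 0\<close> by force
    then show ?thesis using free [of "{v. x v \<noteq> 0}"] x by (auto simp: in_realization)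
  qed
  have D0: "D s x = x" if "m x = 0" for s x using that by (auto simp: D_def)
  have Dfacts: "(\<forall>v. 0 \<le> D s x v) \<and> (\<forall>v. v \<notin> insert w \<sigma> \<longrightarrow> D s x v = 0) \<and> sum (D s x) (insert w \<sigma>) = 1"
    if x: "x \<in> topspace ?X" and "m x > 0" and s: "s \<in> {0..1}" for s x
  proof (intro conjI allI impI)
    have x0: "0 \<le> x v" for v using x by (simp add: in_realization)
    fix v
    have "s * m x \<le> 1 * m x" by (rule mult_right_mono) (use s \<open>m x > 0\<close> in auto)
    then have "s * m x \<le> x v" if "v \<in> \<sigma>" using m_le [OF that, of x] by linarith
    then show "0 \<le> D s x v" using x0 [of v] s \<open>m x > 0\<close> by (auto simp: D_def)
    show "D s x v = 0" if "v \<notin> insert w \<sigma>"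
      using that mpos [OF x \<open>m x > 0\<close>] by (auto simp: D_def)
    have "sum (D s x) \<sigma> = sum (\<lambda>v. x v - s * m x) \<sigma>"
      by (rule sum.cong) (use w in \<open>auto simp: D_def\<close>)
    then have "sum (D s x) (insert w \<sigma>) = sum x (insert w \<sigma>)"
      using fin w by (simp add: D_def sum_subtractf)
    then show "sum (D s x) (insert w \<sigma>) = 1"
      using sum_realization [OF x _ mpos [OF x \<open>m x > 0\<close>]] fin by simp
  qed
  have DX: "D s x \<in> topspace ?X" if x: "x \<in> topspace ?X" and s: "s \<in> {0..1}" for s x
  proof (cases "m x = 0")
    case False
    then have "m x > 0" using m0 [OF x] by simp
    show ?thesis by (rule in_realizationI [OF K \<tau>]) (use Dfacts [OF x \<open>m x > 0\<close> s] in auto)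
  qed (simp add: D0 x)
  have D1: "D 1 x \<in> topspace (geometric_realization ?K')" if x: "x \<in> topspace ?X" for x
  proof -
    have "{v. D 1 x v \<noteq> 0} \<noteq> \<sigma> \<and> {v. D 1 x v \<noteq> 0} \<noteq> insert w \<sigma>"
    proof -
      obtain v where "v \<in> \<sigma>" "x v = m x" using m_ex by blast
      then have "D 1 x v = 0" using w by (auto simp: D_def)
      then show ?thesis using \<open>v \<in> \<sigma>\<close> by blast
    qed
    then show ?thesis using DX [OF x, of 1] by (simp add: in_realization)
  qed
  have fixed: "D 1 x = x" if "x \<in> topspace (geometric_realization ?K')" for x
  proof -
    have x: "x \<in> topspace ?X" using that by (auto simp: in_realization)
    have "\<not> m x > 0"
    proof
      assume "m x > 0"
      then have "\<sigma> \<subseteq> {v. x v \<noteq> 0}" using m_le [of _ x] by force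
      then show False using free [of "{v. x v \<noteq> 0}"] that by (auto simp: in_realization)
    qed
    then show ?thesis using m0 [OF x] by (simp add: D0)
  qed
  have mc: "continuous_map ?X euclideanreal m" unfolding m_def
    by (rule continuous_map_Min [where f = "\<lambda>x. x"]) (use fin in \<open>auto intro: continuous_intros\<close>)
  have Dc: "continuous_map (prod_topology (top_of_set {0..1}) ?X) ?X (\<lambda>(s, x). D s x)"
    unfolding continuous_map_into_realization
  proof (intro conjI allI)
    fix v
    have a: "continuous_map (prod_topology (top_of_set {0..1}) ?X) euclideanreal (\<lambda>z. m (snd z))"
      by (rule continuous_map_compose [OF continuous_map_snd mc, unfolded comp_def])
    have b: "continuous_map (prod_topology (top_of_set {0..1}) ?X) euclideanreal (\<lambda>z. (snd z) v)" for v
      by (rule continuous_map_compose [OF continuous_map_snd continuous_map_realization_proj, unfolded comp_def])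
    have c: "continuous_map (prod_topology (top_of_set {0..1}) ?X) euclideanreal fst"
      using continuous_map_fst continuous_map_into_fulltopology by blast
    show "continuous_map (prod_topology (top_of_set {0..1}) ?X) euclideanreal (\<lambda>z. (case z of (s, x) \<Rightarrow> D s x) v)"
      unfolding D_def case_prod_unfold
      by (cases "v = w"; cases "v \<in> \<sigma>") (auto intro!: continuous_intros a b c)
  qed (use DX in auto)
  have "homotopic_with (\<lambda>x. True) ?X ?X id (D 1)"
    by (subst homotopic_with, simp) (rule exI [of _ "\<lambda>(s, x). D s x"], use Dc in \<open>auto simp: D_def\<close>)
  moreover have "retraction_maps ?X (geometric_realization ?K') (D 1) id"
    unfolding retraction_maps_def
  proof (intro conjI ballI)
    have "continuous_map ?X ?X (D 1)"
      using continuous_map_o_Pair [OF Dc, of 1] by (simp add: comp_def)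
    then show "continuous_map ?X (geometric_realization ?K') (D 1)"
      using D1 by (auto simp: continuous_map_into_realization)
    show "continuous_map (geometric_realization ?K') ?X id"
      by (auto simp: continuous_map_into_realization in_realization intro: continuous_intros)
  qed (use fixed in auto)
  ultimately show ?thesis
    by (rule deformation_retract_imp_homotopy_equivalent_space [OF homotopic_with_symD])
qed

section \<open>Collapses\<close>

text \<open>The relation makes sense for any family of sets; closure under faces is required only
  for realizations. So faces can be deleted beforehand without side conditions.\<close>

inductive collapses :: "'a set set \<Rightarrow> 'a set set \<Rightarrow> bool" where
  stop: "collapses K K"
| elementary: "\<lbrakk>\<sigma> \<in> K; insert w \<sigma> \<in> K; w \<notin> \<sigma>; \<sigma> \<noteq> {};
          \<And>\<rho>. \<lbrakk>\<rho> \<in> K; \<sigma> \<subseteq> \<rho>\<rbrakk> \<Longrightarrow> \<rho> = \<sigma> \<or> \<rho> = insert w \<sigma>;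
          collapses (K - {\<sigma>, insert w \<sigma>}) L\<rbrakk> \<Longrightarrow> collapses K L"

lemma collapses_subset: "collapses K L \<Longrightarrow> L \<subseteq> K"
  by (induction rule: collapses.induct) auto

lemma collapses_trans: "collapses K L \<Longrightarrow> collapses L M \<Longrightarrow> collapses K M"
proof (induction rule: collapses.induct)
  case (elementary \<sigma> K w L)
  show ?case by (rule collapses.elementary [OF elementary.hyps(1-5) elementary.IH [OF elementary.prems]])
qed

lemma simplicial_complex_Diff_upward:
  assumes "simplicial_complex K" "\<And>\<rho> \<tau>. \<lbrakk>\<rho> \<in> M; \<tau> \<in> K; \<rho> \<subseteq> \<tau>\<rbrakk> \<Longrightarrow> \<tau> \<in> M"
  shows "simplicial_complex (K - M)"
  using assms unfolding simplicial_complex_def by (metis DiffD1 DiffD2 DiffI)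

lemma collapses_simplicial_complex:
  "collapses K L \<Longrightarrow> simplicial_complex K \<Longrightarrow> simplicial_complex L"
proof (induction rule: collapses.induct)
  case (elementary \<sigma> K w L)
  have "simplicial_complex (K - {\<sigma>, insert w \<sigma>})"
    by (rule simplicial_complex_Diff_upward [OF elementary.prems]) (use elementary.hyps in blast)
  then show ?case by (rule elementary.IH)
qed simp

lemma collapses_realization:
  "collapses K L \<Longrightarrow> simplicial_complex K \<Longrightarrow>
     geometric_realization K homotopy_equivalent_space geometric_realization L"
proof (induction rule: collapses.induct)
  case (elementary \<sigma> K w L)
  have "simplicial_complex (K - {\<sigma>, insert w \<sigma>})"
    by (rule simplicial_complex_Diff_upward [OF elementary.prems]) (use elementary.hyps in blast)
  then have "geometric_realization (K - {\<sigma>, insert w \<sigma>}) homotopy_equivalent_space geometric_realization L"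
    by (rule elementary.IH)
  moreover have "geometric_realization K homotopy_equivalent_space geometric_realization (K - {\<sigma>, insert w \<sigma>})"
    by (rule elementary_collapse_realization [OF elementary.prems]) (use elementary.hyps in blast)+
  ultimately show ?case by (rule homotopy_eqv_trans [rotated])
qed (simp add: homotopy_equivalent_space_refl)

lemma contractible_realization_vertex: "contractible_space (geometric_realization {{v}})"
proof (rule contractible_space_subset_singleton)
  show "topspace (geometric_realization {{v}}) \<subseteq> {\<lambda>u. if u = v then 1 else 0}"
  proof
    fix x assume x: "x \<in> topspace (geometric_realization {{v}})"
    then have v: "{u. x u \<noteq> 0} = {v}" by (simp add: in_realization)
    then have "x v = 1" using x by (simp add: in_realization)
    then have "x = (\<lambda>u. if u = v then 1 else 0)" using v by fastforce
    then show "x \<in> {\<lambda>u. if u = v then 1 else 0}" by simp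
  qed
qed

lemma collapses_image:
  "collapses K L \<Longrightarrow> inj_on h (\<Union>K) \<Longrightarrow> collapses ((`) h ` K) ((`) h ` L)"
proof (induction rule: collapses.induct)
  case (elementary \<sigma> K w L)
  have inj: "inj_on ((`) h) K"
    by (rule inj_onI) (metis Sup_upper inj_on_image_eq_iff elementary.prems)
  have "collapses ((`) h ` (K - {\<sigma>, insert w \<sigma>})) ((`) h ` L)"
    by (rule elementary.IH) (use elementary.prems in \<open>auto intro: inj_on_subset\<close>)
  moreover have "(`) h ` (K - {\<sigma>, insert w \<sigma>}) = (`) h ` K - {h ` \<sigma>, insert (h w) (h ` \<sigma>)}"
    using inj_on_image_set_diff [OF inj, of K "{\<sigma>, insert w \<sigma>}"] elementary.hyps by simp
  ultimately have c: "collapses ((`) h ` K - {h ` \<sigma>, insert (h w) (h ` \<sigma>)}) ((`) h ` L)" by simp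
  show ?case
  proof (rule collapses.elementary [OF _ _ _ _ _ c])
    show "h ` \<sigma> \<in> (`) h ` K" using elementary.hyps by blast
    show "insert (h w) (h ` \<sigma>) \<in> (`) h ` K" using elementary.hyps by (metis image_eqI image_insert)
    show "h w \<notin> h ` \<sigma>"
      using elementary.hyps elementary.prems by (metis Sup_upper UnionI inj_on_image_mem_iff insertI1)
    fix \<rho> assume "\<rho> \<in> (`) h ` K" and sub: "h ` \<sigma> \<subseteq> \<rho>"
    then obtain \<rho>' where \<rho>': "\<rho>' \<in> K" "\<rho> = h ` \<rho>'" by blast
    have "\<sigma> \<subseteq> \<rho>'"
      using sub \<rho>' elementary.hyps(1) elementary.prems by (meson Sup_upper inj_on_image_subset_iff)
    then show "\<rho> = h ` \<sigma> \<or> \<rho> = insert (h w) (h ` \<sigma>)"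
      using elementary.hyps(5) [OF \<rho>'(1)] \<rho>'(2) by auto
  qed (use elementary.hyps in auto)
qed (rule collapses.stop)

subsection \<open>Adding a vertex\<close>

text \<open>The open star: only the faces that contain the apex. Thus
  \<open>K \<union> vertex_cone v L\<close> is \<open>K\<close> with a new vertex \<open>v\<close>
  whose link is \<open>L\<close>.\<close>

definition vertex_cone :: "'a \<Rightarrow> 'a set set \<Rightarrow> 'a set set" where
  "vertex_cone v L = insert {v} (insert v ` L)"

text \<open>Faces containing \<open>v\<close> correspond to faces of the link, so a free face
  \<open>\<sigma>\<close> of the link yields the free face \<open>insert v \<sigma>\<close>; the
  faces of \<open>K\<close> do not interfere since they avoid \<open>v\<close>.\<close>

lemma collapses_Un_cone:
  "collapses L L' \<Longrightarrow> v \<notin> \<Union>K \<Longrightarrow> L \<subseteq> K \<Longrightarrow> collapses (K \<union> vertex_cone v L) (K \<union> vertex_cone v L')"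
proof (induction rule: collapses.induct)
  case (elementary \<sigma> L w L')
  have "v \<notin> \<Union>L" using elementary.prems by blast
  moreover have "v \<notin> \<sigma>" "v \<notin> insert w \<sigma>" using elementary.hyps(1,2) calculation by blast+
  ultimately have v: "v \<notin> \<sigma>" "v \<noteq> w" "v \<notin> \<Union>L" by auto
  have "K \<union> vertex_cone v (L - {\<sigma>, insert w \<sigma>}) = (K \<union> vertex_cone v L) - {insert v \<sigma>, insert w (insert v \<sigma>)}"
  proof -
    have "inj_on (insert v) L"
      by (rule inj_onI) (metis UnionI insert_ident v(3))
    then have "insert v ` (L - {\<sigma>, insert w \<sigma>}) = insert v ` L - insert v ` {\<sigma>, insert w \<sigma>}"
      by (rule inj_on_image_set_diff) (use elementary.hyps in auto)
    moreover have "insert v ` {\<sigma>, insert w \<sigma>} = {insert v \<sigma>, insert w (insert v \<sigma>)}" by auto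
    ultimately have 1: "insert v ` (L - {\<sigma>, insert w \<sigma>}) = insert v ` L - {insert v \<sigma>, insert w (insert v \<sigma>)}"
      by simp
    have 2: "{v} \<noteq> insert v \<sigma>" "{v} \<noteq> insert w (insert v \<sigma>)" using elementary.hyps(4) v by auto
    have 3: "insert v \<sigma> \<notin> K" "insert w (insert v \<sigma>) \<notin> K" using elementary.prems by auto
    show ?thesis unfolding vertex_cone_def 1 using 2 3 by (simp add: Un_Diff insert_Diff_if)
  qed
  then have c: "collapses ((K \<union> vertex_cone v L) - {insert v \<sigma>, insert w (insert v \<sigma>)}) (K \<union> vertex_cone v L')"
    using elementary.IH elementary.prems by (metis Diff_subset subset_trans)
  show ?case
  proof (rule collapses.elementary [OF _ _ _ _ _ c])
    show "insert v \<sigma> \<in> K \<union> vertex_cone v L" using elementary.hyps by (auto simp: vertex_cone_def)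
    show "insert w (insert v \<sigma>) \<in> K \<union> vertex_cone v L"
      using elementary.hyps(2) by (auto simp: vertex_cone_def insert_commute)
    fix \<rho> assume \<rho>: "\<rho> \<in> K \<union> vertex_cone v L" "insert v \<sigma> \<subseteq> \<rho>"
    then have "v \<in> \<rho>" by blast
    then have "\<rho> \<notin> K" using elementary.prems by blast
    moreover have "\<rho> \<noteq> {v}" using \<rho>(2) elementary.hyps v by blast
    ultimately obtain \<rho>' where \<rho>': "\<rho>' \<in> L" "\<rho> = insert v \<rho>'" using \<rho> by (auto simp: vertex_cone_def)
    then have "\<sigma> \<subseteq> \<rho>'" using \<rho> v by blast
    then have "\<rho>' = \<sigma> \<or> \<rho>' = insert w \<sigma>" using elementary.hyps \<rho>' by blast
    then show "\<rho> = insert v \<sigma> \<or> \<rho> = insert w (insert v \<sigma>)" using \<rho>' by auto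
  qed (use elementary.hyps v in auto)
qed (rule collapses.stop)

text \<open>Once the link is reduced to a vertex \<open>w\<close>, the new vertex hangs on the
  single edge \<open>{w, v}\<close> and is a free face of it.\<close>

lemma collapses_add_vertex:
  assumes "collapses L {{w}}" "L \<subseteq> K" "v \<notin> \<Union>K"
  shows "collapses (K \<union> vertex_cone v L) K"
proof -
  have "{w} \<in> K" using collapses_subset [OF assms(1)] assms(2) by blast
  then have "w \<noteq> v" using assms(3) by blast
  have notin: "{v} \<notin> K" "insert w {v} \<notin> K" using assms(3) by auto
  have "collapses (K \<union> vertex_cone v {{w}}) K"
  proof (rule collapses.elementary [where \<sigma> = "{v}" and w = w])
    show "\<rho> = {v} \<or> \<rho> = {w, v}" if "\<rho> \<in> K \<union> vertex_cone v {{w}}" "{v} \<subseteq> \<rho>" for \<rho>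
      using that assms(3) by (auto simp: vertex_cone_def)
    have "K \<union> vertex_cone v {{w}} - {{v}, {w, v}} = K" using notin by (auto simp: vertex_cone_def)
    then show "collapses (K \<union> vertex_cone v {{w}} - {{v}, {w, v}}) K" by (simp add: collapses.stop)
  qed (use \<open>w \<noteq> v\<close> in \<open>auto simp: vertex_cone_def\<close>)
  then show ?thesis
    using collapses_Un_cone [OF assms(1,3,2)] collapses_trans by blast
qed

text \<open>The faces of the base are removed from the largest down, each \<open>\<sigma>\<close>
  paired with \<open>insert v \<sigma>\<close>; only the apex has no partner.\<close>

lemma collapses_cone:
  "\<lbrakk>finite L; simplicial_complex L; v \<notin> \<Union>L\<rbrakk> \<Longrightarrow> collapses (L \<union> vertex_cone v L) {{v}}"
proof (induction "card L" arbitrary: L)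
  case 0
  then show ?case by (simp add: vertex_cone_def collapses.stop)
next
  case (Suc n)
  then have "L \<noteq> {}" by auto
  then obtain \<sigma> where \<sigma>: "\<sigma> \<in> L" "\<And>\<rho>. \<rho> \<in> L \<Longrightarrow> card \<rho> \<le> card \<sigma>"
    using Max_in [of "card ` L"] Max_ge [of "card ` L"] Suc.prems(1) by fastforce
  have max: "\<rho> = \<sigma>" if "\<rho> \<in> L" "\<sigma> \<subseteq> \<rho>" for \<rho>
    using card_seteq [of \<rho> \<sigma>] \<sigma> that simplicial_complexD [OF Suc.prems(2)] by metis
  have v: "v \<notin> \<sigma>" "\<sigma> \<noteq> {}" using \<sigma> Suc.prems simplicial_complexD by blast+
  have "simplicial_complex (L - {\<sigma>})"
    by (rule simplicial_complex_Diff_upward [OF Suc.prems(2)]) (use max in auto)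
  moreover have "n = card (L - {\<sigma>})" using Suc.hyps(2) \<sigma> Suc.prems(1) by simp
  ultimately have IH: "collapses (L - {\<sigma>} \<union> vertex_cone v (L - {\<sigma>})) {{v}}"
    using Suc by auto
  have "L - {\<sigma>} \<union> vertex_cone v (L - {\<sigma>}) = (L \<union> vertex_cone v L) - {\<sigma>, insert v \<sigma>}"
  proof -
    have "inj_on (insert v) L"
      by (rule inj_onI) (metis UnionI insert_ident Suc.prems(3))
    then have "insert v ` (L - {\<sigma>}) = insert v ` L - {insert v \<sigma>}"
      using inj_on_image_set_diff [of "insert v" L L "{\<sigma>}"] \<sigma> by auto
    moreover have "{v} \<noteq> insert v \<sigma>" "{v} \<noteq> \<sigma>" using v by auto
    moreover have "insert v \<sigma> \<notin> L" "\<sigma> \<notin> insert v ` L" using Suc.prems(3) v by auto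
    ultimately show ?thesis unfolding vertex_cone_def by blast
  qed
  then have c: "collapses ((L \<union> vertex_cone v L) - {\<sigma>, insert v \<sigma>}) {{v}}" using IH by simp
  show ?case
  proof (rule collapses.elementary [OF _ _ _ _ _ c])
    fix \<rho> assume \<rho>: "\<rho> \<in> L \<union> vertex_cone v L" "\<sigma> \<subseteq> \<rho>"
    show "\<rho> = \<sigma> \<or> \<rho> = insert v \<sigma>"
    proof (cases "\<rho> \<in> L")
      case False
      then obtain \<rho>' where "\<rho>' \<in> L" "\<rho> = insert v \<rho>'" using \<rho> v by (auto simp: vertex_cone_def)
      then show ?thesis using max [of \<rho>'] \<rho> v by blast
    qed (use max \<rho> in blast)
  qed (use \<sigma> v in \<open>auto simp: vertex_cone_def\<close>)
qed

section \<open>Spherical complexes\<close>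

text \<open>The index \<open>k\<close> is the dimension plus one, so that the empty complex is the sphere of index 0.\<close>

definition spherical :: "nat \<Rightarrow> 'a set set \<Rightarrow> bool" where
  "spherical k K \<longleftrightarrow> (\<forall>\<sigma>\<in>K. card \<sigma> \<le> k) \<and>
     (if k = 0 then K = {} else \<exists>M v. M \<subseteq> K \<and> (\<forall>\<sigma>\<in>M. card \<sigma> = k) \<and> collapses (K - M) {{v}})"

lemma spherical_if_collapses:
  assumes "collapses K {{v}}" "\<And>\<sigma>. \<sigma> \<in> K \<Longrightarrow> card \<sigma> \<le> k"
  shows "spherical k K"
proof -
  have "{v} \<in> K" using collapses_subset [OF assms(1)] by blast
  then have "k \<noteq> 0" using assms(2) by fastforce
  then show ?thesis unfolding spherical_def using assms by (metis Diff_empty empty_iff empty_subsetI)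
qed

text \<open>The cells deleted from the link have one dimension less, and become top-dimensional when
  \<open>v\<close> is added to them. Deleting these together with the cells of \<open>K\<close>
  leaves a collapsible link in a collapsible complex.\<close>

lemma spherical_add_vertex:
  assumes K: "spherical (Suc k) K" and L: "spherical k L" and sub: "L \<subseteq> K"
    and K_sc: "simplicial_complex K" and v: "v \<notin> \<Union>K"
  shows "spherical (Suc k) (K \<union> vertex_cone v L)"
proof -
  have fin: "finite \<sigma>" "v \<notin> \<sigma>" if "\<sigma> \<in> K" for \<sigma> using that K_sc v simplicial_complexD by blast+
  have cK: "card \<sigma> \<le> Suc k" if "\<sigma> \<in> K" for \<sigma> using K that by (simp add: spherical_def)
  have cL: "card \<sigma> \<le> k" if "\<sigma> \<in> L" for \<sigma> using L that by (simp add: spherical_def)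
  have 1: "\<forall>\<sigma>\<in>K \<union> vertex_cone v L. card \<sigma> \<le> Suc k"
  proof
    fix \<sigma> assume "\<sigma> \<in> K \<union> vertex_cone v L"
    then consider "\<sigma> \<in> K" | "\<sigma> = {v}" | \<rho> where "\<rho> \<in> L" "\<sigma> = insert v \<rho>" by (auto simp: vertex_cone_def)
    then show "card \<sigma> \<le> Suc k"
    proof cases
      case 3
      then have "card \<sigma> = Suc (card \<rho>)" using fin [of \<rho>] sub by auto
      then show ?thesis using cL 3 by simp
    qed (use cK in auto)
  qed
  obtain M w where M: "M \<subseteq> K" "\<And>\<sigma>. \<sigma> \<in> M \<Longrightarrow> card \<sigma> = Suc k" and w: "collapses (K - M) {{w}}"
    using K unfolding spherical_def by auto
  have vKM: "v \<notin> \<Union>(K - M)" using v by blast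
  have "\<exists>M' w. M' \<subseteq> K \<union> vertex_cone v L \<and> (\<forall>\<sigma>\<in>M'. card \<sigma> = Suc k) \<and> collapses (K \<union> vertex_cone v L - M') {{w}}"
  proof (cases "k = 0")
    case True
    \<comment> \<open>An empty link makes \<open>v\<close> an isolated point, and \<open>{v}\<close>
      is itself a top-dimensional face to be deleted, as \<open>Suc k = 1\<close>.\<close>
    then have "L = {}" using L by (simp add: spherical_def)
    have "{v} \<notin> K" using v by auto
    then have e: "K \<union> vertex_cone v L - insert {v} M = K - M" by (auto simp: vertex_cone_def \<open>L = {}\<close>)
    show ?thesis
      by (rule exI [of _ "insert {v} M"], rule exI [of _ w], unfold e)
         (use M w True in \<open>auto simp: vertex_cone_def\<close>)
  next
    case False
    then obtain N u where N: "N \<subseteq> L" "\<And>\<sigma>. \<sigma> \<in> N \<Longrightarrow> card \<sigma> = k" and u: "collapses (L - N) {{u}}"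
      using L unfolding spherical_def by auto
    \<comment> \<open>Faces of the link have at most \<open>k\<close> elements while those in
      \<open>M\<close> have \<open>Suc k\<close>, so deleting \<open>M\<close> leaves the link
      intact.\<close>
    have LM: "L - N \<subseteq> K - M" using M cL sub by fastforce
    let ?M = "M \<union> insert v ` N"
    have inj: "inj_on (insert v) L"
      by (rule inj_onI) (metis UnionI insert_ident v sub subsetD)
    have im: "insert v ` (L - N) = insert v ` L - insert v ` N"
      by (rule inj_on_image_set_diff [OF inj]) (use N in auto)
    have "{v} \<notin> insert v ` N"
      using N(1) sub simplicial_complexD(2) [OF K_sc] fin(2) by force
    moreover have "M \<inter> vertex_cone v L = {}" "K \<inter> insert v ` N = {}" using M(1) v by (auto simp: vertex_cone_def)
    ultimately have e: "K \<union> vertex_cone v L - ?M = (K - M) \<union> vertex_cone v (L - N)"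
      unfolding vertex_cone_def im by blast
    have "card (insert v \<sigma>) = Suc k" if "\<sigma> \<in> N" for \<sigma>
      using fin [of \<sigma>] N sub that by auto
    moreover have "collapses (K \<union> vertex_cone v L - ?M) {{w}}"
      unfolding e using collapses_add_vertex [OF u LM vKM] w collapses_trans by blast
    ultimately show ?thesis
      using M N by (intro exI [of _ ?M] exI [of _ w]) (auto simp: vertex_cone_def)
  qed
  then show ?thesis using 1 unfolding spherical_def by simp
qed

lemma spherical_image:
  assumes K: "spherical k K" and inj: "inj_on h (\<Union>K)"
  shows "spherical k ((`) h ` K)"
proof -
  have c: "card (h ` \<sigma>) = card \<sigma>" if "\<sigma> \<in> K" for \<sigma>
    by (rule card_image) (use inj that in \<open>auto intro: inj_on_subset\<close>)
  have inj': "inj_on ((`) h) K"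
    by (rule inj_onI) (metis Sup_upper inj_on_image_eq_iff inj)
  show ?thesis
  proof (cases "k = 0")
    case False
    then obtain M v where M: "M \<subseteq> K" "\<forall>\<sigma>\<in>M. card \<sigma> = k" and v: "collapses (K - M) {{v}}"
      using K unfolding spherical_def by auto
    have "collapses ((`) h ` (K - M)) ((`) h ` {{v}})"
      by (rule collapses_image [OF v]) (use inj in \<open>auto intro: inj_on_subset\<close>)
    then have "collapses ((`) h ` K - (`) h ` M) {{h v}}"
      using inj_on_image_set_diff [OF inj', of K M] M by auto
    then have "\<exists>M v. M \<subseteq> (`) h ` K \<and> (\<forall>\<sigma>\<in>M. card \<sigma> = k) \<and> collapses ((`) h ` K - M) {{v}}"
      using M c by (intro exI [of _ "(`) h ` M"] exI [of _ "h v"]) auto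
    then show ?thesis using K c False unfolding spherical_def by auto
  qed (use K in \<open>auto simp: spherical_def\<close>)
qed

section \<open>Order complexes\<close>

lemma in_order_complex:
  "C \<in> order_complex P r \<longleftrightarrow>
     C \<subseteq> P \<and> finite C \<and> C \<noteq> {} \<and> (\<forall>x\<in>C. \<forall>y\<in>C. r x y \<or> r y x)"
  by (simp add: order_complex_def)

lemma simplicial_complex_order_complex: "simplicial_complex (order_complex P r)"
proof -
  have "\<rho> \<in> order_complex P r" if "\<sigma> \<in> order_complex P r" "\<rho> \<noteq> {}" "\<rho> \<subseteq> \<sigma>" for \<sigma> \<rho>
    using that finite_subset [of \<rho> \<sigma>] unfolding in_order_complex by blast
  then show ?thesis unfolding simplicial_complex_def using in_order_complex by metis
qed

lemma finite_order_complex: "finite P \<Longrightarrow> finite (order_complex P r)"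
  by (rule finite_subset [of _ "Pow P"]) (auto simp: in_order_complex)

lemma Union_order_complex: "\<Union>(order_complex P r) \<subseteq> P"
  by (auto simp: in_order_complex)

text \<open>Lets a map that moves elements upwards be used as a coreflection, by passing to the
  converse order.\<close>

lemma order_complex_converse: "order_complex P (\<lambda>x y. r y x) = order_complex P r"
  unfolding order_complex_def by (rule Collect_cong) blast

lemma order_complex_insert:
  assumes "x \<notin> Q" "r x x"
  shows "order_complex (insert x Q) r =
         order_complex Q r \<union> vertex_cone x (order_complex {y \<in> Q. r x y \<or> r y x} r)"
proof (intro equalityI subsetI)
  fix C assume C: "C \<in> order_complex (insert x Q) r"
  show "C \<in> order_complex Q r \<union> vertex_cone x (order_complex {y \<in> Q. r x y \<or> r y x} r)"
  proof (cases "x \<in> C")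
    case True
    show ?thesis
    proof (cases "C = {x}")
      case False
      then have "C - {x} \<in> order_complex {y \<in> Q. r x y \<or> r y x} r"
        using C True unfolding in_order_complex by blast
      moreover have "C = insert x (C - {x})" using True by blast
      ultimately show ?thesis unfolding vertex_cone_def by blast
    qed (simp add: vertex_cone_def)
  next
    case False
    then have "C \<in> order_complex Q r" using C unfolding in_order_complex by blast
    then show ?thesis by blast
  qed
next
  fix C assume "C \<in> order_complex Q r \<union> vertex_cone x (order_complex {y \<in> Q. r x y \<or> r y x} r)"
  then consider "C \<in> order_complex Q r" | "C = {x}"
    | D where "D \<in> order_complex {y \<in> Q. r x y \<or> r y x} r" "C = insert x D"
    unfolding vertex_cone_def by blast
  then show "C \<in> order_complex (insert x Q) r"
  proof cases
    case 1 then show ?thesis unfolding in_order_complex by blast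
  next
    case 2 then show ?thesis using assms unfolding in_order_complex by blast
  next
    case 3
    then have "D \<subseteq> Q" "finite D" "\<And>y. y \<in> D \<Longrightarrow> r x y \<or> r y x" "\<And>y z. y \<in> D \<Longrightarrow> z \<in> D \<Longrightarrow> r y z \<or> r z y"
      unfolding in_order_complex by blast+
    then show ?thesis unfolding 3(2) in_order_complex using assms by blast
  qed
qed

lemma collapses_order_complex_cone:
  assumes "finite Q" "a \<in> Q" "\<And>y. y \<in> Q \<Longrightarrow> r a y \<or> r y a"
  shows "collapses (order_complex Q r) {{a}}"
proof -
  let ?L = "order_complex (Q - {a}) r"
  have l: "{y \<in> Q - {a}. r a y \<or> r y a} = Q - {a}" using assms by blast
  have "order_complex (insert a (Q - {a})) r = ?L \<union> vertex_cone a ?L"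
    using order_complex_insert [of a "Q - {a}" r] assms unfolding l by blast
  moreover have "insert a (Q - {a}) = Q" using assms by blast
  moreover have "collapses (?L \<union> vertex_cone a ?L) {{a}}"
    by (rule collapses_cone) (use assms Union_order_complex [of "Q - {a}" r]
        in \<open>auto simp: simplicial_complex_order_complex finite_order_complex\<close>)
  ultimately show ?thesis by simp
qed

text \<open>The link of \<open>x\<close> is the order complex of the elements comparable with it,
  and the last hypothesis makes this a cone with apex \<open>a\<close>.\<close>

lemma collapses_order_complex_insert:
  assumes "finite Q" "x \<notin> Q" "r x x" "a \<in> Q" "r x a \<or> r a x"
    and "\<And>y. \<lbrakk>y \<in> Q; r x y \<or> r y x\<rbrakk> \<Longrightarrow> r a y \<or> r y a"
  shows "collapses (order_complex (insert x Q) r) (order_complex Q r)"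
proof -
  let ?L = "order_complex {y \<in> Q. r x y \<or> r y x} r"
  have "collapses ?L {{a}}" by (rule collapses_order_complex_cone) (use assms in auto)
  moreover have "?L \<subseteq> order_complex Q r" unfolding order_complex_def by blast
  moreover have "x \<notin> \<Union>(order_complex Q r)" using Union_order_complex [of Q r] assms by blast
  ultimately show ?thesis
    unfolding order_complex_insert [of x Q r, OF assms(2,3)] by (rule collapses_add_vertex)
qed

lemma spherical_order_complex_insert:
  assumes "x \<notin> Q" "r x x" "spherical (Suc k) (order_complex Q r)"
    and "spherical k (order_complex {y \<in> Q. r x y \<or> r y x} r)"
  shows "spherical (Suc k) (order_complex (insert x Q) r)"
  unfolding order_complex_insert [of x Q r, OF assms(1,2)]
proof (rule spherical_add_vertex [OF assms(3,4)])
  show "order_complex {y \<in> Q. r x y \<or> r y x} r \<subseteq> order_complex Q r"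
    unfolding order_complex_def by blast
  show "x \<notin> \<Union>(order_complex Q r)" using Union_order_complex [of Q r] assms by blast
qed (rule simplicial_complex_order_complex)

text \<open>A cone is collapsible, hence spherical of every index that bounds its faces. Since a
  chain in the link can be extended by \<open>x\<close>, the bound on all chains yields the index
  required of the link, one less than \<open>k\<close>.\<close>

lemma spherical_order_complex_insert_cone:
  assumes "finite Q" "x \<notin> Q" "r x x" "a \<in> Q" "r a a" "r x a \<or> r a x"
    and "\<And>y. \<lbrakk>y \<in> Q; r x y \<or> r y x\<rbrakk> \<Longrightarrow> r a y \<or> r y a"
    and sph: "spherical k (order_complex Q r)"
    and bound: "\<And>C. C \<in> order_complex (insert x Q) r \<Longrightarrow> card C \<le> k"
  shows "spherical k (order_complex (insert x Q) r)"
proof -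
  let ?Q = "{y \<in> Q. r x y \<or> r y x}"
  have "{x, a} \<in> order_complex (insert x Q) r" using assms(3-6) by (auto simp: in_order_complex)
  then have "card {x, a} \<le> k" by (rule bound)
  then obtain j where j: "k = Suc j" using assms(2,4) by (cases k) auto
  have "spherical j (order_complex ?Q r)"
  proof (rule spherical_if_collapses)
    show "collapses (order_complex ?Q r) {{a}}"
      by (rule collapses_order_complex_cone) (use assms in auto)
    fix C assume C: "C \<in> order_complex ?Q r"
    then have "insert x C \<in> order_complex (insert x Q) r"
      unfolding order_complex_insert [of x Q r, OF assms(2,3)] by (simp add: vertex_cone_def)
    then have "card (insert x C) \<le> k" by (rule bound)
    moreover have "x \<notin> C" "finite C" using C assms(2) by (auto simp: in_order_complex)
    ultimately show "card C \<le> j" using j by simp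
  qed
  then show ?thesis using spherical_order_complex_insert [of x Q r, OF assms(2,3)] sph j by blast
qed

text \<open>If \<open>x\<close> is minimal in \<open>R - R'\<close>, everything below it lies in
  \<open>R'\<close> and hence below \<open>f x\<close>, and everything above it is above
  \<open>f x\<close>. So its link is a cone with apex \<open>f x\<close> and \<open>x\<close> can be
  removed; the other elements follow from the bottom up.\<close>

lemma collapses_coreflection:
  fixes r :: "'a \<Rightarrow> 'a \<Rightarrow> bool"
  assumes fin: "finite R" and sub: "R' \<subseteq> R"
    and refl: "\<And>x. x \<in> R \<Longrightarrow> r x x"
    and antisym: "\<And>x y. \<lbrakk>x \<in> R; y \<in> R; r x y; r y x\<rbrakk> \<Longrightarrow> x = y"
    and trans: "\<And>x y z. \<lbrakk>x \<in> R; y \<in> R; z \<in> R; r x y; r y z\<rbrakk> \<Longrightarrow> r x z"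
    and f: "\<And>x. x \<in> R - R' \<Longrightarrow> f x \<in> R' \<and> r (f x) x"
    and fmax: "\<And>x y. \<lbrakk>x \<in> R - R'; y \<in> R'; r y x\<rbrakk> \<Longrightarrow> r y (f x)"
  shows "collapses (order_complex R r) (order_complex R' r)"
  using assms
proof (induction "card (R - R')" arbitrary: R)
  case 0
  then have "R - R' = {}" using card_0_eq finite_Diff by metis
  then have "R = R'" using 0(3) by blast
  then show ?case by (simp add: collapses.stop)
next
  case (Suc n)
  have tr: "\<And>x y z. \<lbrakk>x \<in> R; y \<in> R; z \<in> R; r x y; r y z\<rbrakk> \<Longrightarrow> r x z" by (rule Suc.prems(5))
  have as: "\<And>x y. \<lbrakk>x \<in> R; y \<in> R; r x y; r y x\<rbrakk> \<Longrightarrow> x = y" by (rule Suc.prems(4))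
  have finD: "finite (R - R')" using Suc.prems(1) by simp
  have ne: "R - R' \<noteq> {}" using Suc.hyps(2) by (metis card.empty nat.simps(3))
  have "asymp_on (R - R') (\<lambda>x y. r x y \<and> x \<noteq> y)"
    by (rule asymp_onI) (use as in blast)
  moreover have "transp_on (R - R') (\<lambda>x y. r x y \<and> x \<noteq> y)"
    by (rule transp_onI) (use as tr in blast)
  ultimately obtain x where x: "x \<in> R - R'" "\<And>y. \<lbrakk>y \<in> R - R'; y \<noteq> x\<rbrakk> \<Longrightarrow> \<not> r y x"
    using Finite_Set.bex_min_element [OF finD _ _ ne, of "\<lambda>x y. r x y \<and> x \<noteq> y"] by metis
  let ?R = "R - {x}"
  have fx: "f x \<in> R'" "r (f x) x" using Suc.prems(6) x by auto
  have xne: "x \<noteq> f x" using x fx by auto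
  have c1: "collapses (order_complex (insert x ?R) r) (order_complex ?R r)"
  proof (rule collapses_order_complex_insert)
    show "r x x" using Suc.prems(3) x by blast
    show "f x \<in> ?R" using fx(1) Suc.prems(2) xne by (metis DiffI singletonD subsetD)
    fix y assume y: "y \<in> ?R" "r x y \<or> r y x"
    show "r (f x) y \<or> r y (f x)"
    proof (cases "r x y")
      case True
      then show ?thesis using tr [of "f x" x y] fx x y Suc.prems(2) by blast
    next
      case False
      then have "y \<in> R'" using x(2) y by blast
      then show ?thesis using Suc.prems(7) [of x y] False x y by blast
    qed
  qed (use Suc.prems(1) fx in auto)
  have "?R - R' = R - R' - {x}" by blast
  then have "n = card (?R - R')" using Suc.hyps(2) x finD by simp
  then have "collapses (order_complex ?R r) (order_complex R' r)"
  proof (rule Suc.hyps(1))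
    show "R' \<subseteq> ?R" using Suc.prems(2) x by blast
    show "\<And>u v w. \<lbrakk>u \<in> ?R; v \<in> ?R; w \<in> ?R; r u v; r v w\<rbrakk> \<Longrightarrow> r u w" using tr by blast
    show "\<And>u v. \<lbrakk>u \<in> ?R; v \<in> ?R; r u v; r v u\<rbrakk> \<Longrightarrow> u = v" using as by blast
    show "finite ?R" using Suc.prems(1) by simp
    show "\<And>u. u \<in> ?R \<Longrightarrow> r u u" using Suc.prems(3) by blast
    show "\<And>u. u \<in> ?R - R' \<Longrightarrow> f u \<in> R' \<and> r (f u) u" by (rule Suc.prems(6)) blast
    show "\<And>u v. \<lbrakk>u \<in> ?R - R'; v \<in> R'; r v u\<rbrakk> \<Longrightarrow> r v (f u)" by (rule Suc.prems(7)) blast+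
  qed
  moreover have "insert x ?R = R" using x by blast
  ultimately show ?case using c1 collapses_trans by metis
qed

lemma order_complex_image:
  assumes "\<And>x y. \<lbrakk>x \<in> P; y \<in> P\<rbrakk> \<Longrightarrow> r' (h x) (h y) \<longleftrightarrow> r x y"
  shows "order_complex (h ` P) r' = (`) h ` order_complex P r"
proof (intro equalityI subsetI)
  fix C assume C: "C \<in> order_complex (h ` P) r'"
  then obtain D where D: "D \<subseteq> P" "C = h ` D" "finite D"
    unfolding in_order_complex by (meson finite_subset_image)
  then have "D \<in> order_complex P r"
    using C assms unfolding in_order_complex by (auto simp: subset_iff)
  then show "C \<in> (`) h ` order_complex P r" using D by blast
next
  fix C assume "C \<in> (`) h ` order_complex P r"
  then obtain D where "D \<in> order_complex P r" "C = h ` D" by blast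
  then show "C \<in> order_complex (h ` P) r'"
    using assms unfolding in_order_complex by (auto simp: subset_iff)
qed

lemma spherical_order_iso:
  assumes "bij_betw h P P'" "\<And>x y. \<lbrakk>x \<in> P; y \<in> P\<rbrakk> \<Longrightarrow> r' (h x) (h y) \<longleftrightarrow> r x y"
    and "spherical k (order_complex P r)"
  shows "spherical k (order_complex P' r')"
proof -
  have "P' = h ` P" using assms(1) by (simp add: bij_betw_def)
  then have "order_complex P' r' = (`) h ` order_complex P r"
    using order_complex_image [of P r' h r, OF assms(2)] by simp
  moreover have "inj_on h (\<Union>(order_complex P r))"
    using assms(1) Union_order_complex [of P r] by (meson bij_betw_imp_inj_on inj_on_subset)
  ultimately show ?thesis using spherical_image [OF assms(3)] by simp
qed

section \<open>Collapsing the boundary of a simplex\<close>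

definition std_simplex :: "nat \<Rightarrow> (nat \<Rightarrow> real) set" where
  "std_simplex d = {y. (\<forall>i\<le>d. 0 \<le> y i) \<and> (\<Sum>i\<le>d. y i) = 1}"

definition min_coord :: "nat \<Rightarrow> (nat \<Rightarrow> real) \<Rightarrow> real" where
  "min_coord d y = Min (y ` {..d})"

text \<open>Divided by the square of the least coordinate, this is the squared norm of the vector
  \<open>u\<close> below, whose coordinate 0 vanishes.\<close>

definition spread :: "nat \<Rightarrow> (nat \<Rightarrow> real) \<Rightarrow> real" where
  "spread d y = (\<Sum>i\<le>d. (y i - y 0)\<^sup>2)"

text \<open>
  The radial expansion \<open>u\<^sub>i = (y\<^sub>i - y\<^sub>0) / m\<close>, where \<open>m\<close> is the least coordinate, identifies the open
  simplex with a Euclidean space; the map below is its composite with inverse stereographic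
  projection from the base point, cleared of the denominator \<open>m\<close>.
\<close>

definition simplex_to_sphere :: "nat \<Rightarrow> (nat \<Rightarrow> real) \<Rightarrow> (nat \<Rightarrow> real)" where
  "simplex_to_sphere d y = (\<lambda>i.
     if i = 0 then (spread d y - (min_coord d y)\<^sup>2) / (spread d y + (min_coord d y)\<^sup>2)
     else if i \<le> d then 2 * min_coord d y * (y i - y 0) / (spread d y + (min_coord d y)\<^sup>2)
     else 0)"

lemma min_coord_le: "i \<le> d \<Longrightarrow> min_coord d y \<le> y i"
  by (simp add: min_coord_def)

lemma min_coord_attained: "\<exists>i\<le>d. y i = min_coord d y"
proof -
  have "min_coord d y \<in> y ` {..d}" unfolding min_coord_def by (rule Min_in) auto
  then show ?thesis by auto
qed

lemma spread_nonneg: "0 \<le> spread d y"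
  unfolding spread_def by (rule sum_nonneg) simp

lemma spread_Suc: "spread d y = (\<Sum>i=1..d. (y i - y 0)\<^sup>2)"
proof -
  have "{..d} = insert 0 {1..d}" by auto
  then show ?thesis by (simp add: spread_def)
qed

text \<open>If both terms vanish, all coordinates agree and one of them is 0, against the sum being
  1. So the map is defined on the closed simplex, although \<open>u\<close> makes no sense on the
  boundary.\<close>

lemma simplex_to_sphere_denominator:
  assumes "y \<in> std_simplex d"
  shows "0 < spread d y + (min_coord d y)\<^sup>2"
proof (rule ccontr)
  assume "\<not> ?thesis"
  then have "spread d y = 0" "(min_coord d y)\<^sup>2 = 0"
    using spread_nonneg [of d y] zero_le_power2 [of "min_coord d y"] by linarith+
  then have m: "min_coord d y = 0" and s: "(\<Sum>i\<le>d. (y i - y 0)\<^sup>2) = 0"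
    by (simp_all add: spread_def)
  have "\<forall>i\<in>{..d}. (y i - y 0)\<^sup>2 = 0"
    by (rule iffD1 [OF sum_nonneg_eq_0_iff s]) simp_all
  then have eq: "y i - y 0 = 0" if "i \<le> d" for i
    using that by (metis atMost_iff power_eq_0_iff)
  obtain a where a: "a \<le> d" "y a = 0" using min_coord_attained [of d y] m by auto
  have "y i = 0" if "i \<le> d" for i
    using eq [OF that] eq [OF a(1)] a(2) by linarith
  then have "(\<Sum>i\<le>d. y i) = 0" by simp
  then show False using assms by (simp add: std_simplex_def)
qed

text \<open>With \<open>Q\<close> for the spread and \<open>m\<close> for the least coordinate this
  is the identity \<open>(Q - m^2)^2 + 4 m^2 Q = (Q + m^2)^2\<close>.\<close>

lemma simplex_to_sphere_in_nsphere:
  assumes y: "y \<in> std_simplex d"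
  shows "simplex_to_sphere d y \<in> topspace (nsphere d)"
proof -
  let ?Q = "spread d y" and ?m = "min_coord d y"
  have D: "?Q + ?m\<^sup>2 \<noteq> 0" using simplex_to_sphere_denominator [OF y] by simp
  have "{..d} = insert 0 {1..d}" by auto
  then have "(\<Sum>i\<le>d. (simplex_to_sphere d y i)\<^sup>2) =
      ((?Q - ?m\<^sup>2) / (?Q + ?m\<^sup>2))\<^sup>2 + (\<Sum>i=1..d. (2 * ?m * (y i - y 0) / (?Q + ?m\<^sup>2))\<^sup>2)"
    by (simp add: simplex_to_sphere_def)
  also have "(\<Sum>i=1..d. (2 * ?m * (y i - y 0) / (?Q + ?m\<^sup>2))\<^sup>2) =
      (\<Sum>i=1..d. (2 * ?m / (?Q + ?m\<^sup>2))\<^sup>2 * (y i - y 0)\<^sup>2)"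
    by (rule sum.cong) (simp_all add: power_mult_distrib power_divide)
  also have "\<dots> = (2 * ?m / (?Q + ?m\<^sup>2))\<^sup>2 * ?Q"
    by (simp add: spread_Suc sum_distrib_left)
  also have "((?Q - ?m\<^sup>2) / (?Q + ?m\<^sup>2))\<^sup>2 + (2 * ?m / (?Q + ?m\<^sup>2))\<^sup>2 * ?Q = 1"
    using D by (simp add: power_divide divide_simps) (simp add: algebra_simps power2_eq_square)
  finally show ?thesis by (simp add: nsphere simplex_to_sphere_def)
qed

lemma simplex_to_sphere_eq_base_iff:
  assumes y: "y \<in> std_simplex d"
  shows "simplex_to_sphere d y = nsphere_base \<longleftrightarrow> min_coord d y = 0"
proof
  have D: "spread d y + (min_coord d y)\<^sup>2 > 0" by (rule simplex_to_sphere_denominator [OF y])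
  show "simplex_to_sphere d y = nsphere_base" if "min_coord d y = 0"
    using D that by (auto simp: simplex_to_sphere_def nsphere_base_def)
  assume "simplex_to_sphere d y = nsphere_base"
  then have "simplex_to_sphere d y 0 = nsphere_base 0" by simp
  then show "min_coord d y = 0" using D by (simp add: simplex_to_sphere_def nsphere_base_def)
qed

text \<open>The left side is stereographic projection from the base point, so \<open>u\<close> can
  be read off from the image.\<close>

lemma simplex_to_sphere_expansion:
  assumes y: "y \<in> std_simplex d" and m: "0 < min_coord d y" and i: "i \<le> d" "i \<noteq> 0"
  shows "simplex_to_sphere d y i / (1 - simplex_to_sphere d y 0) = (y i - y 0) / min_coord d y"
proof -
  let ?D = "spread d y + (min_coord d y)\<^sup>2"
  have D: "?D > 0" by (rule simplex_to_sphere_denominator [OF y])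
  have "1 - simplex_to_sphere d y 0 = 2 * (min_coord d y)\<^sup>2 / ?D"
    using D by (simp add: simplex_to_sphere_def field_simps)
  moreover have "simplex_to_sphere d y i = 2 * min_coord d y * (y i - y 0) / ?D"
    using i by (simp add: simplex_to_sphere_def)
  ultimately show ?thesis using D m by (simp add: power2_eq_square)
qed

text \<open>The image determines \<open>u\<close>. This determines \<open>y 0 / m\<close>, because
  the least of the numbers \<open>y i / m = y 0 / m + u i\<close> is 1, and finally
  \<open>m\<close>, because the coordinates sum to 1.\<close>

lemma simplex_to_sphere_inj:
  assumes y: "y \<in> std_simplex d" "0 < min_coord d y"
    and z: "z \<in> std_simplex d" "0 < min_coord d z"
    and eq: "simplex_to_sphere d y = simplex_to_sphere d z" and "i \<le> d"
  shows "y i = z i"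
proof -
  let ?m = "min_coord d y" and ?n = "min_coord d z"
  define u where "u i = (y i - y 0) / ?m" for i
  have uz: "u i = (z i - z 0) / ?n" if "i \<le> d" for i
    using simplex_to_sphere_expansion [OF y that] simplex_to_sphere_expansion [OF z that] eq
    by (cases "i = 0") (simp_all add: u_def)
  have yi: "y i = ?m * (y 0 / ?m + u i)" for i using y(2) by (simp add: u_def field_simps)
  have zi: "z i = ?n * (z 0 / ?n + u i)" if "i \<le> d" for i using z(2) that by (simp add: uz field_simps)
  have y1: "1 \<le> y 0 / ?m + u i" if "i \<le> d" for i
    using min_coord_le [OF that, of y] y(2) by (simp add: u_def field_simps)
  have z1: "1 \<le> z 0 / ?n + u i" if "i \<le> d" for i
    using min_coord_le [OF that, of z] z(2) that by (simp add: uz field_simps)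
  obtain a where a: "a \<le> d" "y a = ?m" using min_coord_attained by blast
  obtain b where b: "b \<le> d" "z b = ?n" using min_coord_attained by blast
  have "y 0 / ?m + u a = 1" using yi [of a] a y(2) by simp
  moreover have "z 0 / ?n + u b = 1" using zi [of b] b z(2) by simp
  ultimately have c: "y 0 / ?m = z 0 / ?n" using y1 [OF b(1)] z1 [OF a(1)] by linarith
  define S where "S = (\<Sum>i\<le>d. y 0 / ?m + u i)"
  have "(\<Sum>i\<le>d. y i) = ?m * S" unfolding S_def sum_distrib_left by (rule sum.cong [OF refl yi])
  moreover have "(\<Sum>i\<le>d. z i) = ?n * S"
    unfolding S_def sum_distrib_left c by (rule sum.cong [OF refl]) (rule zi, simp)
  ultimately have "?m * S = 1" "?n * S = 1" using y(1) z(1) by (simp_all add: std_simplex_def)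
  then have "?m * S = ?n * S" "S \<noteq> 0" by auto
  then have "?m = ?n" by simp
  then show ?thesis using yi [of i] zi [OF \<open>i \<le> d\<close>] c by simp
qed

lemma simplex_to_sphere_surj:
  assumes s: "s \<in> topspace (nsphere d)" "s \<noteq> nsphere_base"
  obtains y where "y \<in> std_simplex d" "0 < min_coord d y" "simplex_to_sphere d y = s"
proof -
  have s1: "(\<Sum>i\<le>d. (s i)\<^sup>2) = 1" and s0: "\<And>i. d < i \<Longrightarrow> s i = 0"
    using s(1) by (auto simp: nsphere)
  have "{..d} = insert 0 {1..d}" by auto
  then have split: "(s 0)\<^sup>2 + (\<Sum>i=1..d. (s i)\<^sup>2) = 1" using s1 by simp
  have nn: "0 \<le> (\<Sum>i=1..d. (s i)\<^sup>2)" by (rule sum_nonneg) simp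
  have "s 0 \<noteq> 1"
  proof
    assume "s 0 = 1"
    then have "(\<Sum>i=1..d. (s i)\<^sup>2) = 0" using split by simp
    then have "\<forall>i\<in>{1..d}. s i = 0" by (simp add: sum_nonneg_eq_0_iff)
    then have "s i = 0" if "i \<noteq> 0" for i using s0 [of i] that by (cases "i \<le> d") auto
    then have "s = nsphere_base" using \<open>s 0 = 1\<close> by (auto simp: nsphere_base_def)
    then show False using s(2) by simp
  qed
  moreover have "(s 0)\<^sup>2 \<le> 1" using split nn by linarith
  ultimately have lt: "s 0 < 1" by (simp add: abs_square_le_1)
  \<comment> \<open>Stereographic projection gives \<open>u\<close>; shifting it to have minimum 1
    and dividing by the sum \<open>D\<close> gives a point of the simplex, whose least coordinate is
    then \<open>1 / D\<close>.\<close>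
  define u where "u i = (if i = 0 then 0 else s i / (1 - s 0))" for i
  define \<mu> where "\<mu> = min_coord d u"
  define D where "D = (\<Sum>i\<le>d. 1 - \<mu> + u i)"
  have \<mu>_le: "\<mu> \<le> u i" if "i \<le> d" for i using min_coord_le that by (simp add: \<mu>_def)
  have "D \<ge> (\<Sum>i\<le>d. 1)" unfolding D_def by (rule sum_mono) (use \<mu>_le in fastforce)
  then have D: "D > 0" by simp
  define y where "y i = (1 - \<mu> + u i) / D" for i
  have "1 / D \<le> y i" if "i \<le> d" for i
    unfolding y_def using \<mu>_le [OF that] D by (intro divide_right_mono) auto
  moreover obtain a where "a \<le> d" "u a = \<mu>" using min_coord_attained [of d u] by (auto simp: \<mu>_def)
  then have "y a = 1 / D" "a \<le> d" by (simp_all add: y_def)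
  ultimately have m: "min_coord d y = 1 / D"
    using min_coord_attained [of d y] min_coord_le [of a d y] by (metis order_antisym)
  have "y \<in> std_simplex d"
    using \<open>\<And>i. i \<le> d \<Longrightarrow> 1 / D \<le> y i\<close> D
    by (auto simp: std_simplex_def y_def sum_divide_distrib [symmetric] D_def [symmetric]
        intro: order_trans [of 0 "1 / D"])
  moreover have v: "y i - y 0 = u i / D" for i
    by (simp add: y_def u_def diff_divide_distrib [symmetric])
  moreover have "simplex_to_sphere d y = s"
  proof -
    have "(\<Sum>i=1..d. (s i)\<^sup>2) = 1 - (s 0)\<^sup>2" using split by simp
    then have "(\<Sum>i=1..d. (u i)\<^sup>2) = (1 - (s 0)\<^sup>2) / (1 - s 0)\<^sup>2"
      by (simp add: u_def power_divide flip: sum_divide_distrib)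
    also have "\<dots> = (1 + s 0) / (1 - s 0)"
    proof -
      have "1 - (s 0)\<^sup>2 = (1 + s 0) * (1 - s 0)" by (simp add: algebra_simps power2_eq_square)
      then show ?thesis using lt by (simp add: power2_eq_square)
    qed
    finally have "spread d y = (1 + s 0) / (1 - s 0) / D\<^sup>2"
      by (simp add: spread_Suc v power_divide flip: sum_divide_distrib)
    moreover have "(min_coord d y)\<^sup>2 = 1 / D\<^sup>2" by (simp add: m power_divide)
    ultimately have "spread d y + (min_coord d y)\<^sup>2 = ((1 + s 0) / (1 - s 0) + 1) / D\<^sup>2"
      and "spread d y - (min_coord d y)\<^sup>2 = ((1 + s 0) / (1 - s 0) - 1) / D\<^sup>2"
      by (simp_all only: add_divide_distrib diff_divide_distrib)
    moreover have "(1 + s 0) / (1 - s 0) + 1 = 2 / (1 - s 0)" "(1 + s 0) / (1 - s 0) - 1 = 2 * s 0 / (1 - s 0)"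
      using lt by (simp_all add: field_simps)
    ultimately have sum: "spread d y + (min_coord d y)\<^sup>2 = 2 / (1 - s 0) / D\<^sup>2"
      and diff: "spread d y - (min_coord d y)\<^sup>2 = 2 * s 0 / (1 - s 0) / D\<^sup>2"
      by (simp_all only:)
    show ?thesis
    proof
      fix i
      consider "i = 0" | "i \<noteq> 0" "i \<le> d" | "d < i" by linarith
      then show "simplex_to_sphere d y i = s i"
      proof cases
        case 1
        then show ?thesis using lt D by (simp add: simplex_to_sphere_def sum diff)
      next
        case 2
        then have "simplex_to_sphere d y i = 2 * (1 / D) * (u i / D) / (2 / (1 - s 0) / D\<^sup>2)"
          unfolding simplex_to_sphere_def sum v unfolding m by simp
        also have "\<dots> = u i * (1 - s 0)" using lt D by (simp add: power2_eq_square)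
        also have "\<dots> = s i" using 2 lt by (simp add: u_def)
        finally show ?thesis .
      qed (use s0 in \<open>auto simp: simplex_to_sphere_def\<close>)
    qed
  qed
  ultimately show thesis using that m D by simp
qed

lemma continuous_map_simplex_to_sphere:
  assumes f: "\<And>i. i \<le> d \<Longrightarrow> continuous_map X euclideanreal (\<lambda>x. f x i)"
    and fX: "\<And>x. x \<in> topspace X \<Longrightarrow> f x \<in> std_simplex d"
  shows "continuous_map X (nsphere d) (\<lambda>x. simplex_to_sphere d (f x))"
proof -
  have m: "continuous_map X euclideanreal (\<lambda>x. min_coord d (f x))"
    unfolding min_coord_def by (rule continuous_map_Min) (use f in auto)
  have Q: "continuous_map X euclideanreal (\<lambda>x. spread d (f x))"
    unfolding spread_def by (intro continuous_intros) (use f in auto)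
  have D: "spread d (f x) + (min_coord d (f x))\<^sup>2 \<noteq> 0" if "x \<in> topspace X" for x
    using simplex_to_sphere_denominator [OF fX [OF that]] by simp
  have "continuous_map X euclideanreal (\<lambda>x. simplex_to_sphere d (f x) i)" for i
  proof -
    consider "i = 0" | "i \<noteq> 0" "i \<le> d" | "d < i" by linarith
    then show ?thesis
    proof cases
      case 1
      then show ?thesis unfolding simplex_to_sphere_def
        using D by (auto intro!: continuous_intros m Q)
    next
      case 2
      then show ?thesis unfolding simplex_to_sphere_def
        using D by (auto intro!: continuous_intros m Q f)
    qed (auto simp: simplex_to_sphere_def)
  qed
  then show ?thesis
    using simplex_to_sphere_in_nsphere [OF fX]
    by (simp add: nsphere continuous_map_in_subtopology continuous_map_componentwise_UNIV Pi_iff)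
qed

section \<open>Attaching top-dimensional cells to a contractible complex\<close>

text \<open>The facets \<open>\<sigma> i\<close> are the cells, and the rest of \<open>K\<close> is
  the core to be shrunk to the wedge point; \<open>e i\<close> puts the coordinates of the standard
  simplex on facet \<open>i\<close>.\<close>

locale facet_attachment =
  fixes K :: "'a set set" and d k :: nat and \<sigma> :: "nat \<Rightarrow> 'a set" and e :: "nat \<Rightarrow> nat \<Rightarrow> 'a"
  assumes complex: "simplicial_complex K"
    and facet: "i < k \<Longrightarrow> \<sigma> i \<in> K"
    and maximal: "\<lbrakk>i < k; \<rho> \<in> K; \<sigma> i \<subseteq> \<rho>\<rbrakk> \<Longrightarrow> \<rho> = \<sigma> i"
    and inj: "inj_on \<sigma> {..<k}"
    and vertices: "i < k \<Longrightarrow> bij_betw (e i) {..d} (\<sigma> i)"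
    and core_nonempty: "K - \<sigma> ` {..<k} \<noteq> {}"
    and core_contractible: "contractible_space (geometric_realization (K - \<sigma> ` {..<k}))"
begin

abbreviation "X \<equiv> geometric_realization K"
abbreviation "X\<^sub>0 \<equiv> geometric_realization (K - \<sigma> ` {..<k})"

text \<open>As the facets are maximal faces, this is positive exactly in the interior of facet
  \<open>i\<close>; so at most one of these functions is nonzero at a given point of
  \<open>X\<close>.\<close>

definition \<mu> :: "nat \<Rightarrow> ('a \<Rightarrow> real) \<Rightarrow> real" where
  "\<mu> i x = min_coord d (x \<circ> e i)"

text \<open>The factor normalizes the value to 1 at the barycentre of a facet, where every
  coordinate is \<open>1 / (d + 1)\<close>; on the core it is 0.\<close>

definition depth :: "('a \<Rightarrow> real) \<Rightarrow> real" where
  "depth x = (real d + 1) * (\<Sum>i<k. \<mu> i x)"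

text \<open>Radial projection of an open facet away from its barycentre; the denominator restores
  the sum 1 and vanishes only for \<open>s = 1\<close> at the barycentre. Summing over all facets
  gives one formula on the whole of \<open>X\<close>, which is the identity on the core.\<close>

definition push :: "real \<Rightarrow> ('a \<Rightarrow> real) \<Rightarrow> ('a \<Rightarrow> real)" where
  "push s x = (\<lambda>v. (x v - s * (\<Sum>i<k. if v \<in> \<sigma> i then \<mu> i x else 0)) / (1 - s * depth x))"

definition wedge_map :: "('a \<Rightarrow> real) \<Rightarrow> (nat \<times> (nat \<Rightarrow> real)) option" where
  "wedge_map x = (if \<exists>i<k. 0 < \<mu> i x
     then (let i = (SOME i. i < k \<and> 0 < \<mu> i x) in Some (i, simplex_to_sphere d (x \<circ> e i)))
     else None)"

lemma e_in: "i < k \<Longrightarrow> j \<le> d \<Longrightarrow> e i j \<in> \<sigma> i"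
  using vertices by (meson atMost_iff bij_betwE)

lemma e_surj: "i < k \<Longrightarrow> v \<in> \<sigma> i \<Longrightarrow> \<exists>j\<le>d. e i j = v"
  using vertices [of i] unfolding bij_betw_def by (metis atMost_iff imageE)

lemma finite_\<sigma>: "i < k \<Longrightarrow> finite (\<sigma> i)"
  using facet complex simplicial_complexD(1) by blast

lemma card_\<sigma>: "i < k \<Longrightarrow> card (\<sigma> i) = d + 1"
  using bij_betw_same_card [OF vertices] by simp

lemma \<mu>_le: "\<lbrakk>i < k; v \<in> \<sigma> i\<rbrakk> \<Longrightarrow> \<mu> i x \<le> x v"
  using e_surj [of i v] min_coord_le [of _ d "x \<circ> e i"] by (auto simp: \<mu>_def)

lemma \<mu>_attained: "i < k \<Longrightarrow> \<exists>v\<in>\<sigma> i. x v = \<mu> i x"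
  using min_coord_attained [of d "x \<circ> e i"] e_in by (auto simp: \<mu>_def)

lemma nonneg: "x \<in> topspace X \<Longrightarrow> 0 \<le> x v"
  by (simp add: in_realization)

lemma \<mu>_nonneg: "\<lbrakk>x \<in> topspace X; i < k\<rbrakk> \<Longrightarrow> 0 \<le> \<mu> i x"
  using \<mu>_attained [of i x] nonneg [of x] by metis

lemma \<mu>_pos_iff:
  assumes "x \<in> topspace X" "i < k"
  shows "0 < \<mu> i x \<longleftrightarrow> {v. x v \<noteq> 0} = \<sigma> i"
proof
  assume "0 < \<mu> i x"
  then have "\<sigma> i \<subseteq> {v. x v \<noteq> 0}" using \<mu>_le [OF assms(2), of _ x] by force
  then show "{v. x v \<noteq> 0} = \<sigma> i" using maximal assms by (simp add: in_realization)
next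
  assume s: "{v. x v \<noteq> 0} = \<sigma> i"
  obtain v where "v \<in> \<sigma> i" "x v = \<mu> i x" using \<mu>_attained [OF assms(2)] by blast
  then show "0 < \<mu> i x" using s \<mu>_nonneg [OF assms] by force
qed

lemma in_core_iff: "x \<in> topspace X\<^sub>0 \<longleftrightarrow> x \<in> topspace X \<and> (\<forall>i<k. \<mu> i x = 0)"
proof -
  have "(\<forall>i<k. \<mu> i x = 0) \<longleftrightarrow> {v. x v \<noteq> 0} \<notin> \<sigma> ` {..<k}" if x: "x \<in> topspace X"
  proof -
    have "\<mu> i x = 0 \<longleftrightarrow> {v. x v \<noteq> 0} \<noteq> \<sigma> i" if "i < k" for i
      using \<mu>_pos_iff [OF x that] \<mu>_nonneg [OF x that] by linarith
    then show ?thesis by blast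
  qed
  then show ?thesis by (auto simp: in_realization)
qed

lemma \<mu>_unique:
  assumes "x \<in> topspace X" "i < k" "j < k" "0 < \<mu> i x" "0 < \<mu> j x"
  shows "i = j"
  using \<mu>_pos_iff [OF assms(1)] assms inj by (metis inj_on_def lessThan_iff)

lemma facet_sums:
  assumes x: "x \<in> topspace X" and j: "j < k" "0 < \<mu> j x"
  shows "depth x = (real d + 1) * \<mu> j x"
    and "(\<Sum>i<k. if v \<in> \<sigma> i then \<mu> i x else 0) = (if v \<in> \<sigma> j then \<mu> j x else 0)"
    and "depth x \<le> 1"
proof -
  have z: "\<mu> i x = 0" if "i \<in> {..<k} - {j}" for i
    using \<mu>_unique [OF x _ j(1) _ j(2), of i] \<mu>_nonneg [OF x, of i] that by fastforce
  have "(\<Sum>i<k. \<mu> i x) = \<mu> j x + (\<Sum>i\<in>{..<k} - {j}. \<mu> i x)"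
    by (rule sum.remove) (use j in auto)
  then show d: "depth x = (real d + 1) * \<mu> j x" using z by (simp add: depth_def)
  have "(\<Sum>i<k. if v \<in> \<sigma> i then \<mu> i x else 0) = (if v \<in> \<sigma> j then \<mu> j x else 0) +
      (\<Sum>i\<in>{..<k} - {j}. if v \<in> \<sigma> i then \<mu> i x else 0)"
    by (rule sum.remove) (use j in auto)
  moreover have "(\<Sum>i\<in>{..<k} - {j}. if v \<in> \<sigma> i then \<mu> i x else 0) = 0"
    by (rule sum.neutral) (use z in auto)
  ultimately show "(\<Sum>i<k. if v \<in> \<sigma> i then \<mu> i x else 0) = (if v \<in> \<sigma> j then \<mu> j x else 0)" by simp
  \<comment> \<open>The \<open>d + 1\<close> coordinates on the facet sum to 1, so the least of them
    is at most \<open>1 / (d + 1)\<close>.\<close>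
  have "(\<Sum>v\<in>\<sigma> j. \<mu> j x) \<le> sum x (\<sigma> j)" by (rule sum_mono) (use \<mu>_le j in auto)
  moreover have "sum x (\<sigma> j) = 1"
    by (rule sum_realization [OF x finite_\<sigma>]) (use \<mu>_pos_iff [OF x] j in auto)
  ultimately show "depth x \<le> 1" using card_\<sigma> j by (simp add: d algebra_simps)
qed

lemma depth_core: "x \<in> topspace X\<^sub>0 \<Longrightarrow> depth x = 0"
  by (simp add: in_core_iff depth_def)

lemma push_core: "x \<in> topspace X\<^sub>0 \<Longrightarrow> push s x = x"
  by (auto simp: in_core_iff depth_def push_def fun_eq_iff cong: if_cong)

lemma depth_bounds:
  assumes x: "x \<in> topspace X"
  shows "0 \<le> depth x" "depth x \<le> 1"
proof -
  show "0 \<le> depth x" unfolding depth_def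
    by (intro mult_nonneg_nonneg sum_nonneg) (use \<mu>_nonneg x in auto)
  show "depth x \<le> 1"
  proof (cases "x \<in> topspace X\<^sub>0")
    case False
    then obtain j where "j < k" "0 < \<mu> j x" using x \<mu>_nonneg [OF x] unfolding in_core_iff by force
    then show ?thesis using facet_sums [OF x] by blast
  qed (simp add: depth_core)
qed

lemma push_in:
  assumes x: "x \<in> topspace X" and s: "s \<in> {0..1}" "s * depth x < 1"
  shows "push s x \<in> topspace X" and "s = 1 \<Longrightarrow> push s x \<in> topspace X\<^sub>0"
proof -
  have "push s x \<in> topspace X \<and> (s = 1 \<longrightarrow> push s x \<in> topspace X\<^sub>0)"
  proof (cases "x \<in> topspace X\<^sub>0")
    case False
    then obtain j where j: "j < k" "0 < \<mu> j x" using x \<mu>_nonneg [OF x] unfolding in_core_iff by force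
    have sup: "{v. x v \<noteq> 0} = \<sigma> j" using \<mu>_pos_iff [OF x] j by simp
    have p: "push s x v = (x v - s * (if v \<in> \<sigma> j then \<mu> j x else 0)) / (1 - s * depth x)" for v
      by (simp add: push_def facet_sums(2) [OF x j])
    have fin: "finite (\<sigma> j)" by (rule finite_\<sigma> [OF j(1)])
    have "sum x (\<sigma> j) = 1" by (rule sum_realization [OF x fin]) (use sup in simp)
    then have "(\<Sum>v\<in>\<sigma> j. x v - s * \<mu> j x) = 1 - s * depth x"
      using card_\<sigma> [OF j(1)] by (simp add: sum_subtractf facet_sums(1) [OF x j])
    then have "sum (push s x) (\<sigma> j) = 1"
      using s by (simp add: p flip: sum_divide_distrib)
    moreover have "0 \<le> push s x v" for v
    proof -
      have "s * \<mu> j x \<le> 1 * \<mu> j x" by (rule mult_right_mono) (use s j in auto)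
      then have "v \<in> \<sigma> j \<Longrightarrow> s * \<mu> j x \<le> x v" using \<mu>_le [OF j(1), of v x] by linarith
      then show ?thesis using s nonneg [OF x, of v] by (simp add: p)
    qed
    moreover have "push s x v = 0" if "v \<notin> \<sigma> j" for v using that sup by (auto simp: p)
    ultimately have in_X: "push s x \<in> topspace X"
      by (intro in_realizationI [OF complex facet [OF j(1)]]) auto
    moreover have "push s x \<in> topspace X\<^sub>0" if "s = 1"
    proof -
      \<comment> \<open>At \<open>s = 1\<close> the smallest coordinate on the facet has become 0,
        so the support is a proper face of a facet; by maximality such a face belongs to the
        core.\<close>
      obtain v where v: "v \<in> \<sigma> j" "x v = \<mu> j x" using \<mu>_attained [OF j(1)] by blast
      then have "push s x v = 0" unfolding p using that by simp
      have "{u. push s x u \<noteq> 0} \<noteq> \<sigma> i" if "i < k" for i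
      proof
        assume i: "{u. push s x u \<noteq> 0} = \<sigma> i"
        have "{u. push s x u \<noteq> 0} \<subseteq> \<sigma> j" using \<open>\<And>v. v \<notin> \<sigma> j \<Longrightarrow> push s x v = 0\<close> by blast
        then have "\<sigma> j = \<sigma> i" using maximal [OF that facet [OF j(1)]] i by simp
        then show False using i v \<open>push s x v = 0\<close> by blast
      qed
      then show ?thesis using in_X by (auto simp: in_realization)
    qed
    ultimately show ?thesis by blast
  qed (use x in \<open>simp add: push_core\<close>)
  then show "push s x \<in> topspace X" and "s = 1 \<Longrightarrow> push s x \<in> topspace X\<^sub>0" by blast+
qed

lemma continuous_map_\<mu>: "continuous_map X euclideanreal (\<mu> i)"
  unfolding \<mu>_def min_coord_def
  by (rule continuous_map_Min) (auto intro: continuous_map_realization_proj)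

lemma continuous_map_depth: "continuous_map X euclideanreal depth"
  unfolding depth_def by (intro continuous_intros continuous_map_\<mu>) auto

lemma continuous_map_push:
  assumes f: "continuous_map Z X f" and s: "continuous_map Z euclideanreal s"
    and "\<And>z. z \<in> topspace Z \<Longrightarrow> s z \<in> {0..1} \<and> s z * depth (f z) < 1"
  shows "continuous_map Z X (\<lambda>z. push (s z) (f z))"
  unfolding continuous_map_into_realization
proof (intro conjI allI)
  have fz: "f z \<in> topspace X" if "z \<in> topspace Z" for z
    using f that by (auto simp: continuous_map_def)
  fix v
  have D: "continuous_map Z euclideanreal (\<lambda>z. depth (f z))"
    using continuous_map_compose [OF f continuous_map_depth] by (simp add: comp_def)
  have V: "continuous_map Z euclideanreal (\<lambda>z. f z v)"
    using continuous_map_compose [OF f continuous_map_realization_proj [of K v]] by (simp add: comp_def)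
  have M: "continuous_map Z euclideanreal (\<lambda>z. if v \<in> \<sigma> i then \<mu> i (f z) else 0)" for i
    using continuous_map_compose [OF f continuous_map_\<mu> [of i]] by (simp add: comp_def)
  have "1 - s z * depth (f z) \<noteq> 0" if "z \<in> topspace Z" for z using assms(3) [OF that] by simp
  then show "continuous_map Z euclideanreal (\<lambda>z. push (s z) (f z) v)"
    unfolding push_def by (intro continuous_intros D V M s) auto
  show "(\<lambda>z. push (s z) (f z)) \<in> topspace Z \<rightarrow> topspace X"
    using push_in(1) fz assms(3) by auto
qed

subsection \<open>The collapsing map to the wedge of spheres\<close>

lemma wedge_map_Some:
  assumes "x \<in> topspace X" "i < k" "0 < \<mu> i x"
  shows "wedge_map x = Some (i, simplex_to_sphere d (x \<circ> e i))"
proof -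
  have "(SOME i. i < k \<and> 0 < \<mu> i x) = i"
    by (rule some_equality) (use assms \<mu>_unique [OF assms(1)] in auto)
  then show ?thesis unfolding wedge_map_def using assms by auto
qed

lemma wedge_map_None: "x \<in> topspace X\<^sub>0 \<Longrightarrow> wedge_map x = None"
  by (auto simp: wedge_map_def in_core_iff)

lemma core_or_facet:
  assumes "x \<in> topspace X"
  obtains "x \<in> topspace X\<^sub>0" | i where "i < k" "0 < \<mu> i x"
  using assms \<mu>_nonneg [OF assms] unfolding in_core_iff by force

definition closed_facet :: "nat \<Rightarrow> ('a \<Rightarrow> real) set" where
  "closed_facet i = {x \<in> topspace X. {v. x v \<noteq> 0} \<subseteq> \<sigma> i}"

lemma closed_facet_simplex:
  assumes "i < k" "x \<in> closed_facet i"
  shows "x \<circ> e i \<in> std_simplex d"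
proof -
  have x: "x \<in> topspace X" "{v. x v \<noteq> 0} \<subseteq> \<sigma> i" using assms by (auto simp: closed_facet_def)
  have "(\<Sum>j\<le>d. x (e i j)) = sum x (\<sigma> i)"
    using sum.reindex_bij_betw [OF vertices [OF assms(1)], of x] by simp
  also have "\<dots> = 1"
    by (rule sum_realization [OF x(1) _ x(2)]) (use assms facet complex simplicial_complexD in blast)
  finally show ?thesis using nonneg [OF x(1)] by (simp add: std_simplex_def)
qed

text \<open>On the boundary of the facet both sides are the wedge point: the sphere coordinate is
  the base point, and no other facet has the point in its interior, since that facet would be
  contained in facet \<open>i\<close>.\<close>

lemma wedge_map_closed_facet:
  assumes "i < k" "x \<in> closed_facet i"
  shows "wedge_map x = wedge_proj (\<lambda>_. nsphere_base) (i, simplex_to_sphere d (x \<circ> e i))"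
proof -
  have x: "x \<in> topspace X" "{v. x v \<noteq> 0} \<subseteq> \<sigma> i" using assms by (auto simp: closed_facet_def)
  have b: "simplex_to_sphere d (x \<circ> e i) = nsphere_base \<longleftrightarrow> \<mu> i x = 0"
    using simplex_to_sphere_eq_base_iff [OF closed_facet_simplex [OF assms]] by (simp add: \<mu>_def)
  show ?thesis
  proof (cases "0 < \<mu> i x")
    case True
    then show ?thesis using wedge_map_Some [OF x(1) assms(1)] b by (simp add: wedge_proj_def)
  next
    case False
    have "\<mu> j x = 0" if "j < k" for j
    proof (rule ccontr)
      assume "\<mu> j x \<noteq> 0"
      then have "0 < \<mu> j x" using \<mu>_nonneg [OF x(1) that] by simp
      then have "\<sigma> j \<subseteq> \<sigma> i" using \<mu>_pos_iff [OF x(1) that] x(2) by simp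
      then have "\<sigma> i = \<sigma> j" using maximal [OF that facet [OF assms(1)]] by simp
      then have "i = j" using inj assms(1) that by (simp add: inj_on_def)
      then show False using False \<open>0 < \<mu> j x\<close> by simp
    qed
    then show ?thesis using b assms(1) by (auto simp: wedge_map_def wedge_proj_def)
  qed
qed

text \<open>By injectivity of \<open>simplex_to_sphere\<close> on the open simplex, the only
  identification made is that of the core to a point.\<close>

lemma wedge_map_eqD:
  assumes x: "x \<in> topspace X" and y: "y \<in> topspace X" and eq: "wedge_map x = wedge_map y"
  shows "x = y \<or> x \<in> topspace X\<^sub>0 \<and> y \<in> topspace X\<^sub>0"
proof (cases rule: core_or_facet [OF x])
  case 1
  then show ?thesis
    by (cases rule: core_or_facet [OF y]) (use eq wedge_map_None wedge_map_Some [OF y] in auto)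
next
  case (2 i)
  show ?thesis
  proof (cases rule: core_or_facet [OF y])
    case 1
    then show ?thesis using eq wedge_map_None [OF 1] wedge_map_Some [OF x 2] by simp
  next
    case (2 j)
    have ij: "i = j" and s: "simplex_to_sphere d (x \<circ> e i) = simplex_to_sphere d (y \<circ> e i)"
      using eq wedge_map_Some [OF x \<open>i < k\<close> \<open>0 < \<mu> i x\<close>] wedge_map_Some [OF y 2] by auto
    have sx: "{v. x v \<noteq> 0} = \<sigma> i" and sy: "{v. y v \<noteq> 0} = \<sigma> i"
      using \<mu>_pos_iff [OF x \<open>i < k\<close>] \<mu>_pos_iff [OF y 2(1)] \<open>0 < \<mu> i x\<close> 2 ij by auto
    have "(x \<circ> e i) j = (y \<circ> e i) j" if "j \<le> d" for j
      by (rule simplex_to_sphere_inj [OF _ _ _ _ s that])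
        (use closed_facet_simplex [OF \<open>i < k\<close>] x y sx sy \<open>0 < \<mu> i x\<close> 2 ij in \<open>auto simp: closed_facet_def \<mu>_def\<close>)
    then have "x v = y v" if "v \<in> \<sigma> i" for v using e_surj [OF \<open>i < k\<close> that] by (metis comp_apply)
    moreover have "x v = y v" if "v \<notin> \<sigma> i" for v
    proof -
      have "v \<notin> {v. x v \<noteq> 0}" "v \<notin> {v. y v \<noteq> 0}" by (simp_all only: sx sy that not_False_eq_True)
      then show ?thesis by simp
    qed
    ultimately have "x = y" by blast
    then show ?thesis ..
  qed
qed

lemma closedin_core: "closedin X (topspace X\<^sub>0)"
proof -
  have "(\<Sum>i<k. \<mu> i x) = 0 \<longleftrightarrow> (\<forall>i<k. \<mu> i x = 0)" if "x \<in> topspace X" for x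
    using sum_nonneg_eq_0_iff [of "{..<k}" "\<lambda>i. \<mu> i x"] \<mu>_nonneg [OF that] by auto
  then have "topspace X\<^sub>0 = {x \<in> topspace X. (\<Sum>i<k. \<mu> i x) \<in> {0}}"
    by (auto simp: in_core_iff)
  moreover have "continuous_map X euclideanreal (\<lambda>x. \<Sum>i<k. \<mu> i x)"
    by (intro continuous_intros continuous_map_\<mu>) auto
  ultimately show ?thesis by (simp only:) (rule closedin_continuous_map_preimage, auto)
qed

lemma closedin_closed_facet:
  assumes i: "i < k"
  shows "closedin X (closed_facet i)"
proof -
  have fin: "finite (\<sigma> i)" by (rule finite_\<sigma> [OF i])
  \<comment> \<open>Rewritten by a finite sum of coordinates, the condition on the support becomes a
    closed one.\<close>
  have "{v. x v \<noteq> 0} \<subseteq> \<sigma> i \<longleftrightarrow> sum x (\<sigma> i) = 1" if x: "x \<in> topspace X" for x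
  proof
    assume "sum x (\<sigma> i) = 1"
    let ?s = "{v. x v \<noteq> 0}"
    have fins: "finite ?s" using x complex simplicial_complexD by (auto simp: in_realization)
    have "sum x ?s = 1" using x by (simp add: in_realization)
    moreover have "sum x (?s \<union> \<sigma> i) = sum x (\<sigma> i) + sum x (?s - \<sigma> i)"
      using sum.union_disjoint [of "\<sigma> i" "?s - \<sigma> i" x] fin fins by (simp add: Un_commute)
    moreover have "sum x (?s \<union> \<sigma> i) = 1" by (rule sum_realization [OF x]) (use fin fins in auto)
    ultimately have "sum x (?s - \<sigma> i) = 0" using \<open>sum x (\<sigma> i) = 1\<close> by simp
    then have "\<forall>v\<in>?s - \<sigma> i. x v = 0"
      using fins nonneg [OF x] by (simp add: sum_nonneg_eq_0_iff)
    then show "?s \<subseteq> \<sigma> i" by blast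
  qed (rule sum_realization [OF x fin])
  then have "closed_facet i = {x \<in> topspace X. sum x (\<sigma> i) \<in> {1}}"
    by (auto simp: closed_facet_def)
  moreover have "continuous_map X euclideanreal (\<lambda>x. sum x (\<sigma> i))"
    by (intro continuous_intros) (use fin in auto)
  ultimately show ?thesis by (simp only:) (rule closedin_continuous_map_preimage, auto)
qed

text \<open>A closed facet is a closed subset of a product of compact intervals and points.
  Compactness is what makes its map to the sphere a closed map.\<close>

lemma compact_closed_facet:
  assumes i: "i < k"
  shows "compact_space (subtopology X (closed_facet i))"
proof -
  have fin: "finite (\<sigma> i)" by (rule finite_\<sigma> [OF i])
  let ?P = "powertop_real (UNIV :: 'a set)"
  let ?B = "PiE UNIV (\<lambda>v. if v \<in> \<sigma> i then {0..1::real} else {0})"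
  have "compactin ?P ?B" by (auto simp: compactin_PiE)
  moreover have "closedin ?P {x \<in> topspace ?P. sum x (\<sigma> i) \<in> {1}}"
    by (rule closedin_continuous_map_preimage)
       (auto intro!: continuous_intros simp: fin)
  moreover have "closed_facet i = {x \<in> topspace ?P. sum x (\<sigma> i) \<in> {1}} \<inter> ?B"
  proof (intro equalityI subsetI)
    fix x assume "x \<in> closed_facet i"
    then have x: "x \<in> topspace X" "{v. x v \<noteq> 0} \<subseteq> \<sigma> i" by (auto simp: closed_facet_def)
    have s: "sum x (\<sigma> i) = 1" by (rule sum_realization [OF x(1) fin x(2)])
    then have "x v \<le> 1" if "v \<in> \<sigma> i" for v
      using member_le_sum [of v "\<sigma> i" x] that fin nonneg [OF x(1)] by simp
    then show "x \<in> {x \<in> topspace ?P. sum x (\<sigma> i) \<in> {1}} \<inter> ?B"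
      using s x(2) nonneg [OF x(1)] by (auto simp: PiE_iff)
  next
    fix x assume x: "x \<in> {x \<in> topspace ?P. sum x (\<sigma> i) \<in> {1}} \<inter> ?B"
    then have "x v \<in> (if v \<in> \<sigma> i then {0..1} else {0})" for v by (simp add: PiE_iff)
    then have b: "0 \<le> x v" "v \<notin> \<sigma> i \<Longrightarrow> x v = 0" for v by (smt (verit) atLeastAtMost_iff singletonD)+
    have "x \<in> topspace X"
      by (rule in_realizationI [OF complex facet [OF i]]) (use b x in auto)
    then show "x \<in> closed_facet i" using b by (auto simp: closed_facet_def)
  qed
  ultimately have "compactin ?P (closed_facet i)" by (simp add: closed_Int_compactin)
  moreover have "closed_facet i \<subseteq> {x. (\<forall>v. 0 \<le> x v) \<and> {v. x v \<noteq> 0} \<in> K \<and> sum x {v. x v \<noteq> 0} = 1}"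
    by (auto simp: closed_facet_def in_realization)
  ultimately have "compactin X (closed_facet i)"
    unfolding geometric_realization_def by (simp add: compactin_subtopology)
  then show ?thesis by (rule compact_space_subtopology)
qed

lemma continuous_map_facet_sphere:
  assumes i: "i < k"
  shows "continuous_map (subtopology X (closed_facet i)) (nsphere d) (\<lambda>x. simplex_to_sphere d (x \<circ> e i))"
proof (rule continuous_map_simplex_to_sphere)
  show "continuous_map (subtopology X (closed_facet i)) euclideanreal (\<lambda>x. (x \<circ> e i) j)" for j
    by (simp add: continuous_map_from_subtopology continuous_map_realization_proj)
  show "x \<circ> e i \<in> std_simplex d" if "x \<in> topspace (subtopology X (closed_facet i))" for x
    using that closed_facet_simplex [OF i] by auto
qed

text \<open>Pasting over the finite closed cover by the closed facets and the core.\<close>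

lemma continuous_map_wedge_map: "continuous_map X (sphere_wedge d k) wedge_map"
proof (rule pasting_lemma_closed)
  let ?T = "\<lambda>i. if i < k then closed_facet i else topspace X\<^sub>0"
  let ?f = "\<lambda>i x. if i < k then wedge_proj (\<lambda>_. nsphere_base) (i, simplex_to_sphere d (x \<circ> e i)) else None"
  have f: "?f i x = wedge_map x" if "x \<in> ?T i" for i x
    using that wedge_map_closed_facet [of i x] wedge_map_None [of x] by (auto split: if_splits)
  show "finite {..k}" by simp
  show "closedin X (?T i)" for i using closedin_core closedin_closed_facet by auto
  show "?f i x = ?f j x" if "x \<in> topspace X \<inter> ?T i \<inter> ?T j" for i j x
  proof -
    have "x \<in> ?T i" "x \<in> ?T j" using that by blast+
    then show ?thesis using f [of x i] f [of x j] by metis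
  qed
  show "\<exists>j. j \<in> {..k} \<and> x \<in> ?T j \<and> wedge_map x = ?f j x" if x: "x \<in> topspace X" for x
  proof -
    have "\<exists>j\<le>k. x \<in> ?T j"
    proof (cases rule: core_or_facet [OF x])
      case 1
      then have "x \<in> ?T k" by simp
      then show ?thesis by blast
    next
      case (2 i)
      then have "x \<in> ?T i" using \<mu>_pos_iff [OF x] x by (simp add: closed_facet_def)
      then show ?thesis using 2 less_imp_le by blast
    qed
    then show ?thesis using f by (metis atMost_iff)
  qed
  show "continuous_map (subtopology X (?T i)) (sphere_wedge d k) (?f i)" if "i \<in> {..k}" for i
  proof (cases "i < k")
    case True
    have "continuous_map (sum_topology (\<lambda>_. nsphere d) {..<k}) (sphere_wedge d k) (wedge_proj (\<lambda>_. nsphere_base))"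
      unfolding sphere_wedge_def
      by (rule quotient_imp_continuous_map [OF quotient_map_wedge_proj])
         (use True nsphere_base_in_topspace in auto)
    moreover have "continuous_map (nsphere d) (sum_topology (\<lambda>_. nsphere d) {..<k}) (\<lambda>x. (i, x))"
      by (rule continuous_map_component_injection) (use True in simp)
    ultimately have "continuous_map (subtopology X (closed_facet i)) (sphere_wedge d k)
        (wedge_proj (\<lambda>_. nsphere_base) \<circ> (\<lambda>x. (i, x)) \<circ> (\<lambda>x. simplex_to_sphere d (x \<circ> e i)))"
      by (intro continuous_map_compose [OF continuous_map_facet_sphere [OF True]]) (rule continuous_map_compose)
    then show ?thesis using True by (simp add: comp_def)
  next
    case False
    then show ?thesis by (simp add: sphere_wedge_def topspace_wedge_sum)
  qed
qed

lemma facet_point_over: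
  assumes i: "i < k" and s: "s \<in> topspace (nsphere d)" "s \<noteq> nsphere_base"
  obtains x where "x \<in> closed_facet i" "simplex_to_sphere d (x \<circ> e i) = s"
proof -
  obtain y where y: "y \<in> std_simplex d" "simplex_to_sphere d y = s"
    using simplex_to_sphere_surj [OF s] by blast
  define f where "f = the_inv_into {..d} (e i)"
  define x where "x v = (if v \<in> \<sigma> i then y (f v) else 0)" for v
  have f: "f (e i j) = j" if "j \<le> d" for j
    using vertices [OF i] that unfolding f_def by (simp add: bij_betw_def the_inv_into_f_f)
  have fd: "f v \<le> d" if "v \<in> \<sigma> i" for v using e_surj [OF i that] f by auto
  have xe: "x (e i j) = y j" if "j \<le> d" for j using that e_in [OF i] f by (simp add: x_def)
  have "sum x (\<sigma> i) = (\<Sum>j\<le>d. x (e i j))"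
    using sum.reindex_bij_betw [OF vertices [OF i], of x] by simp
  also have "\<dots> = 1" using xe y(1) by (simp add: std_simplex_def)
  finally have "x \<in> topspace X"
    by (intro in_realizationI [OF complex facet [OF i]]) (use y(1) fd in \<open>auto simp: x_def std_simplex_def\<close>)
  then have "x \<in> closed_facet i" by (auto simp: closed_facet_def x_def)
  moreover have "simplex_to_sphere d (x \<circ> e i) = simplex_to_sphere d y"
  proof -
    have "min_coord d (x \<circ> e i) = min_coord d y"
      unfolding min_coord_def by (intro arg_cong [where f = Min] image_cong) (auto simp: xe)
    moreover have "spread d (x \<circ> e i) = spread d y"
      unfolding spread_def by (intro sum.cong) (auto simp: xe)
    ultimately show ?thesis by (auto simp: simplex_to_sphere_def xe)
  qed
  ultimately show thesis using that y(2) by blast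
qed

lemma core_point: obtains x where "x \<in> topspace X\<^sub>0"
proof -
  obtain \<rho> where "\<rho> \<in> K - \<sigma> ` {..<k}" using core_nonempty by blast
  then have \<rho>: "\<rho> \<in> K" "\<rho> \<notin> \<sigma> ` {..<k}" "finite \<rho>" "\<rho> \<noteq> {}"
    using complex simplicial_complexD by blast+
  define x where "x v = (if v \<in> \<rho> then 1 / real (card \<rho>) else 0)" for v
  have "{v. x v \<noteq> 0} = \<rho>" using \<rho> by (auto simp: x_def)
  moreover have "sum x \<rho> = 1" using \<rho> by (simp add: x_def)
  ultimately have "x \<in> topspace X\<^sub>0" using \<rho> by (auto simp: in_realization x_def)
  then show thesis by (rule that)
qed

text \<open>A set with open preimage in \<open>X\<close> is tested on each sphere separately. Its
  complement there is, up to the base point, the image of a closed part of a compact facet, hence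
  closed.\<close>

lemma quotient_map_wedge_map: "quotient_map X (sphere_wedge d k) wedge_map"
  unfolding quotient_map_def
proof (intro conjI allI impI)
  let ?W = "sphere_wedge d k" and ?p = "\<lambda>_::nat. nsphere_base" and ?S = "sum_topology (\<lambda>_::nat. nsphere d) {..<k}"
  show "wedge_map ` topspace X = topspace ?W"
  proof
    show "wedge_map ` topspace X \<subseteq> topspace ?W"
      using continuous_map_wedge_map by (simp add: continuous_map_def image_subset_iff_funcset)
    show "topspace ?W \<subseteq> wedge_map ` topspace X"
    proof
      fix w assume w: "w \<in> topspace ?W"
      show "w \<in> wedge_map ` topspace X"
      proof (cases w)
        case None
        obtain x where "x \<in> topspace X\<^sub>0" by (rule core_point)
        then show ?thesis using wedge_map_None [of x] None by (auto simp: in_core_iff image_iff) metis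
      next
        case (Some z)
        then obtain i s where iz: "i < k" "s \<in> topspace (nsphere d)" "s \<noteq> nsphere_base" "z = (i, s)"
          using w by (auto simp: sphere_wedge_def topspace_wedge_sum wedge_proj_def split: if_splits)
        obtain x where x: "x \<in> closed_facet i" "simplex_to_sphere d (x \<circ> e i) = s"
          by (rule facet_point_over [OF iz(1-3)])
        have "wedge_map x = w"
          using wedge_map_closed_facet [OF iz(1) x(1)] x(2) iz Some by (simp add: wedge_proj_def)
        then show ?thesis using x(1) by (auto simp: closed_facet_def)
      qed
    qed
  qed
  fix U assume U: "U \<subseteq> topspace ?W"
  show "openin X {x \<in> topspace X. wedge_map x \<in> U} = openin ?W U"
  proof
    assume "openin ?W U"
    then show "openin X {x \<in> topspace X. wedge_map x \<in> U}"
      by (rule openin_continuous_map_preimage [OF continuous_map_wedge_map])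
  next
    assume opn: "openin X {x \<in> topspace X. wedge_map x \<in> U}"
    have "openin (nsphere d) {s \<in> topspace (nsphere d). wedge_proj ?p (i, s) \<in> U}" if i: "i < k" for i
    proof -
      let ?c = "\<lambda>x. simplex_to_sphere d (x \<circ> e i)"
      let ?C = "{s \<in> topspace (nsphere d). wedge_proj ?p (i, s) \<notin> U}"
      let ?F = "closed_facet i - {x \<in> topspace X. wedge_map x \<in> U}"
      have Hd: "Hausdorff_space (nsphere d)"
        unfolding nsphere by (intro Hausdorff_space_subtopology) (simp add: Hausdorff_space_product_topology)
      have "closed_map (subtopology X (closed_facet i)) (nsphere d) ?c"
        by (rule continuous_imp_closed_map [OF continuous_map_facet_sphere [OF i] compact_closed_facet [OF i] Hd])
      moreover have "closedin (subtopology X (closed_facet i)) ?F"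
      proof -
        have "closedin X ?F" by (rule closedin_diff [OF closedin_closed_facet [OF i] opn])
        then show ?thesis by (rule closedin_subset_topspace) blast
      qed
      ultimately have "closedin (nsphere d) (?c ` ?F)" by (simp add: closed_map_def)
      \<comment> \<open>The base point is treated separately because the facet need not reach it:
        for \<open>d = 0\<close> the facet is one point and goes to the other point of the
        sphere.\<close>
      moreover have "closedin (nsphere d) (if None \<in> U then {} else {nsphere_base})"
        using closedin_Hausdorff_sing_eq [OF Hd] nsphere_base_in_topspace by simp
      moreover have "?C = ?c ` ?F \<union> (if None \<in> U then {} else {nsphere_base})"
      proof (intro equalityI subsetI)
        fix s assume s: "s \<in> ?C"
        show "s \<in> ?c ` ?F \<union> (if None \<in> U then {} else {nsphere_base})"
        proof (cases "s = nsphere_base")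
          case True
          then show ?thesis using s by (simp add: wedge_proj_def)
        next
          case False
          obtain x where x: "x \<in> closed_facet i" "?c x = s"
            by (rule facet_point_over [OF i _ False]) (use s in auto)
          then have "wedge_map x \<notin> U" using wedge_map_closed_facet [OF i x(1)] s by simp
          then show ?thesis using x by blast
        qed
      next
        fix s assume s: "s \<in> ?c ` ?F \<union> (if None \<in> U then {} else {nsphere_base})"
        show "s \<in> ?C"
        proof (cases "s \<in> ?c ` ?F")
          case True
          then obtain x where x: "x \<in> closed_facet i" "wedge_map x \<notin> U" "s = ?c x"
            by (auto simp: closed_facet_def)
          then show ?thesis
            using wedge_map_closed_facet [OF i x(1)] simplex_to_sphere_in_nsphere closed_facet_simplex [OF i x(1)] by auto
        next
          case False
          then show ?thesis using s nsphere_base_in_topspace by (auto simp: wedge_proj_def split: if_splits)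
        qed
      qed
      ultimately have "closedin (nsphere d) ?C" by (simp only: closedin_Un)
      moreover have "{s \<in> topspace (nsphere d). wedge_proj ?p (i, s) \<in> U} = topspace (nsphere d) - ?C" by blast
      ultimately show ?thesis by (simp only: openin_diff openin_topspace)
    qed
    then have "openin ?S {y \<in> topspace ?S. wedge_proj ?p y \<in> U}"
      by (auto simp: openin_sum_topology)
    then show "openin ?W U"
      using U unfolding sphere_wedge_def openin_wedge_sum topspace_wedge_sum by blast
  qed
qed

text \<open>
  The contraction of the core is extended over a facet by pushing its points radially to the boundary,
  with a speed that vanishes at the barycentre (where \<open>depth\<close> is 1), and then applying the contraction.
\<close>

theorem homotopy_equivalent_sphere_wedge: "X homotopy_equivalent_space sphere_wedge d k"
proof -
  let ?I = "top_of_set {0..1::real}"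
  let ?J = "prod_topology ?I X"
  obtain a where "homotopic_with (\<lambda>x. True) X\<^sub>0 X\<^sub>0 id (\<lambda>x. a)"
    using core_contractible by (auto simp: contractible_space_def)
  then obtain h where h: "continuous_map (prod_topology ?I X\<^sub>0) X\<^sub>0 h"
    and h0: "\<And>x. x \<in> topspace X\<^sub>0 \<Longrightarrow> h (0, x) = x" and h1: "\<And>x. x \<in> topspace X\<^sub>0 \<Longrightarrow> h (1, x) = a"
    by (subst (asm) homotopic_with) auto
  have h_in: "h (t, x) \<in> topspace X\<^sub>0" if "t \<in> {0..1}" "x \<in> topspace X\<^sub>0" for t x
    using h that by (auto simp: continuous_map_def)
  \<comment> \<open>On the core the clock runs to 2: \<open>push\<close> fixes the core up to 1, and
    then \<open>h\<close> contracts it. In a facet the clock stops at \<open>2 - 2 * depth\<close>,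
    so only points of depth less than 1/2 get beyond the push.\<close>
  define \<tau> where "\<tau> z = fst z * (2 - 2 * depth (snd z))" for z :: "real \<times> ('a \<Rightarrow> real)"
  define H where "H z = (if \<tau> z \<le> 1 then push (\<tau> z) (snd z) else h (\<tau> z - 1, push 1 (snd z)))" for z
  have \<tau>: "0 \<le> \<tau> z" "\<tau> z \<le> 2" "1 \<le> \<tau> z \<Longrightarrow> depth (snd z) < 1" "\<tau> z \<le> 1 \<Longrightarrow> \<tau> z * depth (snd z) < 1"
    if z: "z \<in> topspace ?J" for z
  proof -
    have t: "0 \<le> fst z" "fst z \<le> 1" and b: "0 \<le> depth (snd z)" "depth (snd z) \<le> 1"
      using z depth_bounds [of "snd z"] by auto
    show "0 \<le> \<tau> z" using t b by (simp add: \<tau>_def)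
    show "\<tau> z \<le> 2" using mult_mono [of "fst z" 1 "2 - 2 * depth (snd z)" 2] t b by (simp add: \<tau>_def)
    show lt: "depth (snd z) < 1" if "1 \<le> \<tau> z"
    proof (rule ccontr)
      assume "\<not> depth (snd z) < 1"
      then have "\<tau> z = 0" using b by (simp add: \<tau>_def)
      then show False using that by simp
    qed
    show "\<tau> z * depth (snd z) < 1" if "\<tau> z \<le> 1"
    proof (cases "depth (snd z) = 1")
      case False
      have "\<tau> z * depth (snd z) \<le> 1 * depth (snd z)" using that b by (intro mult_right_mono)
      then show ?thesis using False b by linarith
    qed (simp add: \<tau>_def)
  qed
  have snd_in: "snd z \<in> topspace X" if "z \<in> topspace ?J" for z using that by auto
  have sndc: "continuous_map ?J X snd" by (rule continuous_map_snd)
  have fstc: "continuous_map ?J euclideanreal fst"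
    using continuous_map_fst continuous_map_into_fulltopology by blast
  have depthc: "continuous_map ?J euclideanreal (\<lambda>z. depth (snd z))"
    using continuous_map_compose [OF sndc continuous_map_depth] by (simp add: comp_def)
  have \<tau>c: "continuous_map ?J euclideanreal \<tau>"
    unfolding \<tau>_def by (intro continuous_intros fstc depthc)
  have push1: "push 1 (snd z) \<in> topspace X\<^sub>0" if "z \<in> topspace ?J" "1 \<le> \<tau> z" for z
    using push_in(2) [of "snd z" 1] snd_in \<tau>(3) that by simp
  have Hc: "continuous_map ?J X H"
  proof (rule pasting_lemma_closed)
    let ?T = "\<lambda>b. {z \<in> topspace ?J. \<tau> z \<in> (if b then {..1} else {1..})}"
    let ?f = "\<lambda>b z. if b then push (\<tau> z) (snd z) else h (\<tau> z - 1, push 1 (snd z))"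
    show "finite {True, False}" by simp
    show "closedin ?J (?T b)" for b
      by (rule closedin_continuous_map_preimage [OF \<tau>c]) auto
    show "continuous_map (subtopology ?J (?T b)) X (?f b)" for b
    proof (cases b)
      case True
      have "continuous_map (subtopology ?J (?T True)) X (\<lambda>z. push (\<tau> z) (snd z))"
        by (rule continuous_map_push)
           (use \<tau> in \<open>auto intro: continuous_map_from_subtopology sndc \<tau>c\<close>)
      then show ?thesis using True by simp
    next
      case False
      let ?Z = "subtopology ?J (?T False)"
      have pc: "continuous_map ?Z X (\<lambda>z. push 1 (snd z))"
        by (rule continuous_map_push)
           (use \<tau> in \<open>auto intro: continuous_map_from_subtopology sndc\<close>)
      have "continuous_map ?Z X\<^sub>0 (\<lambda>z. push 1 (snd z))"
        using pc push1 by (auto simp: continuous_map_into_realization)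
      moreover have "continuous_map ?Z ?I (\<lambda>z. \<tau> z - 1)"
      proof -
        have "continuous_map ?Z euclideanreal (\<lambda>z. \<tau> z - 1)"
          by (intro continuous_intros continuous_map_from_subtopology \<tau>c)
        then show ?thesis using \<tau>(2) by (fastforce simp: continuous_map_in_subtopology)
      qed
      ultimately have "continuous_map ?Z (prod_topology ?I X\<^sub>0) (\<lambda>z. (\<tau> z - 1, push 1 (snd z)))"
        by (simp add: continuous_map_paired)
      then have "continuous_map ?Z X\<^sub>0 (h \<circ> (\<lambda>z. (\<tau> z - 1, push 1 (snd z))))"
        using h by (rule continuous_map_compose)
      then have "continuous_map ?Z X (h \<circ> (\<lambda>z. (\<tau> z - 1, push 1 (snd z))))"
        by (auto simp: continuous_map_into_realization in_core_iff Pi_iff)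
      then show ?thesis using False by (simp add: comp_def)
    qed
    show "?f b z = ?f c z" if "z \<in> topspace ?J \<inter> ?T b \<inter> ?T c" for b c z
    proof (cases "b = c")
      case False
      then have "\<tau> z = 1" "z \<in> topspace ?J" using that by (auto split: if_splits)
      then show ?thesis using h0 [OF push1 [of z]] by simp
    qed simp
    show "\<exists>b. b \<in> {True, False} \<and> z \<in> ?T b \<and> H z = ?f b z" if "z \<in> topspace ?J" for z
      using that by (intro exI [of _ "\<tau> z \<le> 1"]) (auto simp: H_def)
  qed
  \<comment> \<open>The core stays inside itself throughout and ends at the point \<open>a\<close>,
    which is what the quotient criterion asks for.\<close>
  have H_core: "H (t, x) = (if 2 * t \<le> 1 then x else h (2 * t - 1, x))" if "x \<in> topspace X\<^sub>0" for t x
    using that by (simp add: H_def \<tau>_def depth_core push_core mult.commute)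
  show ?thesis
  proof (rule homotopy_equivalent_space_quotient [OF quotient_map_wedge_map Hc])
    fix x assume "x \<in> topspace X"
    show "H (0, x) = x" by (simp add: H_def \<tau>_def push_def)
  next
    fix t :: real and x y
    assume t: "t \<in> {0..1}" and xy: "x \<in> topspace X" "y \<in> topspace X" "wedge_map x = wedge_map y"
    have "wedge_map (H (t, x)) = None" if "x \<in> topspace X\<^sub>0" for x
      using that t h_in [of "2 * t - 1" x] by (auto simp: H_core wedge_map_None)
    then show "wedge_map (H (t, x)) = wedge_map (H (t, y))"
      using wedge_map_eqD [OF xy] by auto
  next
    fix x y
    assume xy: "x \<in> topspace X" "y \<in> topspace X" "wedge_map x = wedge_map y"
    then show "H (1, x) = H (1, y)"
      using wedge_map_eqD [OF xy] by (auto simp: H_core h1)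
  qed
qed

end

text \<open>Faces of the maximal cardinality are facets, and the rest is contractible because it
  collapses to a vertex; so the deleted faces are the cells of a facet attachment.\<close>

theorem spherical_homotopy_equivalent:
  assumes K: "simplicial_complex K" "finite K" and sph: "spherical (Suc d) K"
  shows "\<exists>k. geometric_realization K homotopy_equivalent_space sphere_wedge d k"
proof -
  obtain M v where M: "M \<subseteq> K" "\<And>\<sigma>. \<sigma> \<in> M \<Longrightarrow> card \<sigma> = Suc d" and v: "collapses (K - M) {{v}}"
    using sph unfolding spherical_def by auto
  have max: "\<rho> = \<sigma>" if "\<sigma> \<in> M" "\<rho> \<in> K" "\<sigma> \<subseteq> \<rho>" for \<sigma> \<rho>
    using card_seteq [of \<rho> \<sigma>] that M(2) sph simplicial_complexD(1) [OF K(1)]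
    by (fastforce simp: spherical_def)
  have "finite M" using M(1) K(2) finite_subset by blast
  then obtain s where s: "bij_betw s {..<card M} M"
    using ex_bij_betw_nat_finite [of M] by (auto simp: atLeast0LessThan)
  have "\<exists>f. bij_betw f {..d} \<sigma>" if "\<sigma> \<in> M" for \<sigma>
  proof -
    have "finite \<sigma>" "card \<sigma> = Suc d" using that M simplicial_complexD(1) [OF K(1)] by blast+
    then show ?thesis using ex_bij_betw_nat_finite [of \<sigma>]
      by (metis atLeast0LessThan lessThan_Suc_atMost)
  qed
  then obtain f where f: "\<And>\<sigma>. \<sigma> \<in> M \<Longrightarrow> bij_betw (f \<sigma>) {..d} \<sigma>" by metis
  have sM: "s i \<in> M" if "i < card M" for i using s that by (auto simp: bij_betw_def)
  have im: "s ` {..<card M} = M" using s by (simp add: bij_betw_def)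
  have sc: "simplicial_complex (K - M)"
    by (rule simplicial_complex_Diff_upward [OF K(1)]) (use max in blast)
  interpret facet_attachment K d "card M" s "\<lambda>i. f (s i)"
  proof
    show "contractible_space (geometric_realization (K - s ` {..<card M}))"
      unfolding im
      using homotopy_equivalent_space_contractibility [OF collapses_realization [OF v sc]]
        contractible_realization_vertex by (simp only:)
    show "K - s ` {..<card M} \<noteq> {}" unfolding im using collapses_subset [OF v] by blast
    show "inj_on s {..<card M}" using s by (simp add: bij_betw_def)
  qed (use K M max f sM in auto)
  show ?thesis using homotopy_equivalent_sphere_wedge by blast
qed

section \<open>Labelled states\<close>

text \<open>
  An element of the Dowling poset is encoded as a pair of a relation and a partial colouring:
  \<open>(i, g, j)\<close> is in the relation if \<open>i = g \<cdot> j\<close> holds, that is, if \<open>b(i) = g b(j)\<close> in a common block or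
  \<open>z(i) = g \<cdot> z(j)\<close> in the zero block. The order then becomes componentwise inclusion.
\<close>

type_synonym ('g, 's) state = "(nat \<times> 'g \<times> nat) set \<times> (nat \<rightharpoonup> 's)"

definition state_le :: "('g, 's) state \<Rightarrow> ('g, 's) state \<Rightarrow> bool" (infix "\<sqsubseteq>" 50) where
  "x \<sqsubseteq> y \<longleftrightarrow> fst x \<subseteq> fst y \<and> snd x \<subseteq>\<^sub>m snd y"

definition restr :: "nat set \<Rightarrow> ('g, 's) state \<Rightarrow> ('g, 's) state" where
  "restr M x = ({(a, h, b) \<in> fst x. a \<in> M \<and> b \<in> M}, snd x |` M)"

definition fib :: "('g, 's) state \<Rightarrow> 's \<Rightarrow> nat set" where
  "fib x s = {j. snd x j = Some s}"

definition single :: "nat \<Rightarrow> ('g, 's) state \<Rightarrow> bool" where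
  "single i x \<longleftrightarrow> snd x i = None \<and> (\<forall>h b. (i, h, b) \<in> fst x \<longrightarrow> b = i)"

lemma state_le_refl [simp]: "x \<sqsubseteq> x"
  by (simp add: state_le_def)

lemma state_le_trans: "x \<sqsubseteq> y \<Longrightarrow> y \<sqsubseteq> w \<Longrightarrow> x \<sqsubseteq> w"
  unfolding state_le_def using map_le_trans by blast

lemma state_le_antisym: "x \<sqsubseteq> y \<Longrightarrow> y \<sqsubseteq> x \<Longrightarrow> x = y"
  unfolding state_le_def using map_le_antisym by (metis prod_eqI subset_antisym)

lemma state_leD:
  assumes "x \<sqsubseteq> y"
  shows "(i, g, j) \<in> fst x \<Longrightarrow> (i, g, j) \<in> fst y" "snd x i = Some s \<Longrightarrow> snd y i = Some s"
  using assms by (auto simp: state_le_def map_le_def dom_def)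

lemma state_leI:
  assumes "\<And>i g j. (i, g, j) \<in> fst x \<Longrightarrow> (i, g, j) \<in> fst y" "\<And>i s. snd x i = Some s \<Longrightarrow> snd y i = Some s"
  shows "x \<sqsubseteq> y"
  using assms by (auto simp: state_le_def map_le_def dom_def)

lemma restr_mono: "x \<sqsubseteq> y \<Longrightarrow> restr M x \<sqsubseteq> restr M y"
  by (rule state_leI) (auto simp: restr_def restrict_map_def dest: state_leD split: if_splits)

lemma in_restr: "(a, h, b) \<in> fst (restr M x) \<longleftrightarrow> (a, h, b) \<in> fst x \<and> a \<in> M \<and> b \<in> M"
  by (auto simp: restr_def)

lemma snd_restr: "snd (restr M x) i = (if i \<in> M then snd x i else None)"
  by (simp add: restr_def)

lemma (in group_action) action_laws:
  assumes "s \<in> E"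
  shows "g \<in> carrier G \<Longrightarrow> \<phi> g s \<in> E" "\<phi> \<one> s = s"
    "\<lbrakk>g \<in> carrier G; h \<in> carrier G\<rbrakk> \<Longrightarrow> \<phi> (g \<otimes> h) s = \<phi> g (\<phi> h s)"
  using element_image [OF _ assms] composition_rule [OF assms] assms by (simp_all flip: id_eq_one)

locale dowling_action = group G for G (structure) +
  fixes S :: "'s set" and \<phi> :: "'a \<Rightarrow> 's \<Rightarrow> 's"
  assumes act_closed [simp]: "\<lbrakk>g \<in> carrier G; s \<in> S\<rbrakk> \<Longrightarrow> \<phi> g s \<in> S"
    and act_one [simp]: "s \<in> S \<Longrightarrow> \<phi> \<one> s = s"
    and act_mult: "\<lbrakk>g \<in> carrier G; h \<in> carrier G; s \<in> S\<rbrakk> \<Longrightarrow> \<phi> (g \<otimes> h) s = \<phi> g (\<phi> h s)"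
begin

lemma act_inv [simp]: "\<lbrakk>g \<in> carrier G; s \<in> S\<rbrakk> \<Longrightarrow> \<phi> (inv g) (\<phi> g s) = s"
  by (simp flip: act_mult)

text \<open>Every \<open>g\<close> carrying one colour to the other is recorded, so two points with
  colours in one orbit are related by a whole coset of a stabilizer.\<close>

definition coloured :: "(nat \<rightharpoonup> 's) \<Rightarrow> (nat \<times> 'a \<times> nat) set" where
  "coloured z = {(i, g, j). g \<in> carrier G \<and> (\<exists>t. z j = Some t \<and> z i = Some (\<phi> g t))}"

text \<open>The relation is a groupoid on the points with labels in \<open>G\<close>. Its isotropy
  at an uncoloured point is trivial, as in a block, and at a coloured point it is the stabilizer of
  the colour.\<close>

definition state :: "nat set \<Rightarrow> ('a, 's) state \<Rightarrow> bool" where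
  "state N x \<longleftrightarrow> dom (snd x) \<subseteq> N \<and> ran (snd x) \<subseteq> S \<and> fst x \<subseteq> N \<times> carrier G \<times> N \<and>
     (\<forall>i\<in>N. (i, \<one>, i) \<in> fst x) \<and>
     (\<forall>i g j. (i, g, j) \<in> fst x \<longrightarrow> (j, inv g, i) \<in> fst x) \<and>
     (\<forall>i g j h l. (i, g, j) \<in> fst x \<longrightarrow> (j, h, l) \<in> fst x \<longrightarrow> (i, g \<otimes> h, l) \<in> fst x) \<and>
     (\<forall>i g j t. (i, g, j) \<in> fst x \<longrightarrow> snd x j = Some t \<longrightarrow> snd x i = Some (\<phi> g t)) \<and>
     coloured (snd x) \<subseteq> fst x \<and>
     (\<forall>i g. (i, g, i) \<in> fst x \<longrightarrow> snd x i = None \<longrightarrow> g = \<one>)"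

lemma stateI:
  assumes "\<And>i t. z i = Some t \<Longrightarrow> i \<in> N \<and> t \<in> S"
    and "\<And>i g j. (i, g, j) \<in> E \<Longrightarrow> i \<in> N \<and> g \<in> carrier G \<and> j \<in> N"
    and "\<And>i. i \<in> N \<Longrightarrow> (i, \<one>, i) \<in> E"
    and "\<And>i g j. (i, g, j) \<in> E \<Longrightarrow> (j, inv g, i) \<in> E"
    and "\<And>i g j h l. \<lbrakk>(i, g, j) \<in> E; (j, h, l) \<in> E\<rbrakk> \<Longrightarrow> (i, g \<otimes> h, l) \<in> E"
    and "\<And>i g j t. \<lbrakk>(i, g, j) \<in> E; z j = Some t\<rbrakk> \<Longrightarrow> z i = Some (\<phi> g t)"
    and "\<And>i g j t. \<lbrakk>g \<in> carrier G; z j = Some t; z i = Some (\<phi> g t)\<rbrakk> \<Longrightarrow> (i, g, j) \<in> E"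
    and "\<And>i g. \<lbrakk>(i, g, i) \<in> E; z i = None\<rbrakk> \<Longrightarrow> g = \<one>"
  shows "state N (E, z)"
proof -
  have "dom z \<subseteq> N" "ran z \<subseteq> S" using assms(1) by (auto simp: ran_def)
  moreover have "E \<subseteq> N \<times> carrier G \<times> N" using assms(2) by auto
  moreover have "coloured z \<subseteq> E" using assms(7) by (auto simp: coloured_def)
  ultimately show ?thesis unfolding state_def fst_conv snd_conv
    using assms(3,4,5,6,8) by (intro conjI) blast+
qed

context
  fixes N x assumes x: "state N x"
begin

lemma state_colour: "snd x i = Some t \<Longrightarrow> i \<in> N" "snd x i = Some t \<Longrightarrow> t \<in> S"
  using x unfolding state_def by (auto simp: ran_def)

lemma state_rel:
  assumes "(i, g, j) \<in> fst x"
  shows "i \<in> N" "g \<in> carrier G" "j \<in> N"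
proof -
  have "(i, g, j) \<in> N \<times> carrier G \<times> N" using assms x unfolding state_def by blast
  then show "i \<in> N" "g \<in> carrier G" "j \<in> N" by auto
qed

lemma state_one: "i \<in> N \<Longrightarrow> (i, \<one>, i) \<in> fst x"
  using x unfolding state_def by blast

lemma state_inv: "(i, g, j) \<in> fst x \<Longrightarrow> (j, inv g, i) \<in> fst x"
  using x unfolding state_def by blast

lemma state_mult: "\<lbrakk>(i, g, j) \<in> fst x; (j, h, l) \<in> fst x\<rbrakk> \<Longrightarrow> (i, g \<otimes> h, l) \<in> fst x"
  using x unfolding state_def by blast

lemma state_act: "\<lbrakk>(i, g, j) \<in> fst x; snd x j = Some t\<rbrakk> \<Longrightarrow> snd x i = Some (\<phi> g t)"
  using x unfolding state_def by blast

lemma state_act': "\<lbrakk>(i, g, j) \<in> fst x; snd x i = Some t\<rbrakk> \<Longrightarrow> snd x j = Some (\<phi> (inv g) t)"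
  using state_inv state_act by blast

lemma state_coloured: "\<lbrakk>g \<in> carrier G; snd x j = Some t; snd x i = Some (\<phi> g t)\<rbrakk> \<Longrightarrow> (i, g, j) \<in> fst x"
  using x unfolding state_def by (auto simp: coloured_def)

lemma state_free: "\<lbrakk>(i, g, i) \<in> fst x; snd x i = None\<rbrakk> \<Longrightarrow> g = \<one>"
  using x unfolding state_def by blast

lemma single_iff: "single i x \<longleftrightarrow> snd x i = None \<and> (\<forall>a h b. (a, h, b) \<in> fst x \<longrightarrow> (a = i \<longleftrightarrow> b = i))"
  unfolding single_def using state_inv by blast

lemma state_restr:
  assumes "M \<subseteq> N"
  shows "state M (restr M x)"
  unfolding restr_def
  by (rule stateI)
     (use assms in \<open>auto simp: restrict_map_def split: if_splits
       dest: state_colour state_rel state_inv state_mult state_act state_free intro: state_one state_coloured\<close>)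

end

lemma state_eqI:
  assumes "\<And>i g j. (i, g, j) \<in> fst x \<longleftrightarrow> (i, g, j) \<in> fst y" "\<And>i. snd x i = snd y i"
  shows "x = y"
  using assms by (intro prod_eqI) auto

subsection \<open>The bottom state\<close>

definition bot_state :: "nat set \<Rightarrow> ('a, 's) state" where
  "bot_state N = ({(i, \<one>, i) | i. i \<in> N}, Map.empty)"

lemma in_bot [simp]: "(i, g, j) \<in> fst (bot_state N) \<longleftrightarrow> i \<in> N \<and> g = \<one> \<and> j = i"
  by (auto simp: bot_state_def)

lemma snd_bot [simp]: "snd (bot_state N) = Map.empty"
  by (simp add: bot_state_def)

lemma state_bot: "state N (bot_state N)"
  unfolding bot_state_def by (rule stateI) auto

lemma bot_le: "state N x \<Longrightarrow> bot_state N \<sqsubseteq> x"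
  by (rule state_leI) (auto simp: state_one)

lemma restr_bot: "M \<subseteq> N \<Longrightarrow> restr M (bot_state N) = bot_state M"
  by (rule state_eqI) (auto simp: in_restr snd_restr)

subsection \<open>Isolating points\<close>

definition isolate :: "nat set \<Rightarrow> nat set \<Rightarrow> ('a, 's) state \<Rightarrow> ('a, 's) state" where
  "isolate N I x = ({(a, h, b) \<in> fst x. a \<notin> I \<and> b \<notin> I} \<union> {(a, \<one>, a) | a. a \<in> N}, snd x |` (- I))"

lemma in_isolate:
  "(a, h, b) \<in> fst (isolate N I x) \<longleftrightarrow> (a, h, b) \<in> fst x \<and> a \<notin> I \<and> b \<notin> I \<or> a \<in> N \<and> h = \<one> \<and> b = a"
  by (auto simp: isolate_def)

lemma snd_isolate: "snd (isolate N I x) i = (if i \<in> I then None else snd x i)"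
  by (simp add: isolate_def)

lemma state_isolate:
  assumes x: "state N x"
  shows "state N (isolate N I x)"
proof -
  have "state N (fst (isolate N I x), snd (isolate N I x))"
  proof (rule stateI, goal_cases)
    case (1 i t) then show ?case using state_colour [OF x] by (simp add: snd_isolate split: if_splits)
  next
    case (2 i g j) then show ?case using state_rel [OF x] by (auto simp: in_isolate)
  next
    case (3 i) then show ?case by (simp add: in_isolate)
  next
    case (4 i g j) then show ?case using state_inv [OF x] by (auto simp: in_isolate)
  next
    case (5 i g j h l)
    then show ?case using state_mult [OF x, of i g j h l] state_rel [OF x] by (auto simp: in_isolate)
  next
    case (6 i g j t)
    then show ?case using state_act [OF x] state_colour [OF x] by (auto simp: in_isolate snd_isolate split: if_splits)
  next
    case (7 i g j t) then show ?case using state_coloured [OF x] by (simp add: in_isolate snd_isolate split: if_splits)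
  next
    case (8 i g) then show ?case using state_free [OF x] by (auto simp: in_isolate snd_isolate split: if_splits)
  qed
  then show ?thesis by simp
qed

lemma isolate_le: "state N x \<Longrightarrow> isolate N I x \<sqsubseteq> x"
  by (rule state_leI) (auto simp: in_isolate snd_isolate state_one split: if_splits)

lemma isolate_greatest:
  assumes y: "state N y" and le: "y \<sqsubseteq> x" and single: "\<And>i. i \<in> I \<Longrightarrow> single i y"
  shows "y \<sqsubseteq> isolate N I x"
proof (rule state_leI)
  fix a h b assume e: "(a, h, b) \<in> fst y"
  show "(a, h, b) \<in> fst (isolate N I x)"
  proof (cases "a \<in> I \<or> b \<in> I")
    case True
    then have "single a y \<or> single b y" using single by blast
    then have "a = b \<and> snd y a = None" using e single_iff [OF y] by metis
    then show ?thesis using e state_free [OF y] state_rel [OF y] by (auto simp: in_isolate)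
  next
    case False
    then show ?thesis using e state_leD(1) [OF le] by (simp add: in_isolate)
  qed
next
  fix i s assume "snd y i = Some s"
  then show "snd (isolate N I x) i = Some s"
    using state_leD(2) [OF le] single [of i] by (auto simp: snd_isolate single_def)
qed

lemma single_isolate: "i \<in> I \<Longrightarrow> single i (isolate N I x)"
  by (simp add: single_def snd_isolate in_isolate)

lemma isolate_eq_bot_iff:
  assumes "state N x"
  shows "isolate N I x = bot_state N \<longleftrightarrow>
    (\<forall>a h b. (a, h, b) \<in> fst x \<longrightarrow> a \<notin> I \<longrightarrow> b \<notin> I \<longrightarrow> b = a \<and> h = \<one>) \<and> dom (snd x) \<subseteq> I"
proof
  assume "isolate N I x = bot_state N"
  then have 1: "(a, h, b) \<in> fst (isolate N I x) \<Longrightarrow> b = a \<and> h = \<one>" and 2: "snd (isolate N I x) a = None" for a h b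
    by simp_all
  show "(\<forall>a h b. (a, h, b) \<in> fst x \<longrightarrow> a \<notin> I \<longrightarrow> b \<notin> I \<longrightarrow> b = a \<and> h = \<one>) \<and> dom (snd x) \<subseteq> I"
  proof (intro conjI allI impI subsetI)
    show "b = a" "h = \<one>" if "(a, h, b) \<in> fst x" "a \<notin> I" "b \<notin> I" for a h b
      using 1 [of a h b] that by (simp_all add: in_isolate)
    show "a \<in> I" if "a \<in> dom (snd x)" for a
      using 2 [of a] that by (auto simp: snd_isolate split: if_splits)
  qed
next
  assume r: "(\<forall>a h b. (a, h, b) \<in> fst x \<longrightarrow> a \<notin> I \<longrightarrow> b \<notin> I \<longrightarrow> b = a \<and> h = \<one>) \<and> dom (snd x) \<subseteq> I"
  show "isolate N I x = bot_state N"
    by (rule state_eqI) (use r state_rel [OF assms] in \<open>auto simp: in_isolate snd_isolate\<close>)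
qed

subsection \<open>Attaching a point to another one\<close>

text \<open>The pullback along the map sending \<open>n\<close> to \<open>i\<close>, with the label
  \<open>g\<close> on \<open>n\<close>. What \<open>x\<close> says about \<open>n\<close> is
  overwritten, so the operation serves both as an extension from \<open>N - {n}\<close> and, if
  \<open>n\<close> is single in \<open>x\<close>, as the join with an atom.\<close>

definition attach :: "nat set \<Rightarrow> nat \<Rightarrow> 'a \<Rightarrow> nat \<Rightarrow> ('a, 's) state \<Rightarrow> ('a, 's) state" where
  "attach N n g i x =
     (let \<pi> = (\<lambda>a. if a = n then i else a); \<gamma> = (\<lambda>a. if a = n then g else \<one>)
      in ({(a, h, b). a \<in> N \<and> h \<in> carrier G \<and> b \<in> N \<and> (\<pi> a, inv (\<gamma> a) \<otimes> h \<otimes> \<gamma> b, \<pi> b) \<in> fst x},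
          \<lambda>a. if a \<in> N then map_option (\<phi> (\<gamma> a)) (snd x (\<pi> a)) else None))"

lemma state_pull:
  assumes x: "state M x" and \<pi>: "\<And>a. a \<in> N \<Longrightarrow> \<pi> a \<in> M" and \<gamma>: "\<And>a. a \<in> N \<Longrightarrow> \<gamma> a \<in> carrier G"
  shows "state N ({(a, h, b). a \<in> N \<and> h \<in> carrier G \<and> b \<in> N \<and> (\<pi> a, inv (\<gamma> a) \<otimes> h \<otimes> \<gamma> b, \<pi> b) \<in> fst x},
          \<lambda>a. if a \<in> N then map_option (\<phi> (\<gamma> a)) (snd x (\<pi> a)) else None)" (is "state N (?E, ?z)")
proof (rule stateI, goal_cases)
  case (1 i t)
  then show ?case using state_colour [OF x] \<gamma> by (auto split: if_splits)
next
  case (3 i)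
  then show ?case using state_one [OF x] \<pi> \<gamma> by auto
next
  case (4 i g j)
  then have c: "i \<in> N" "g \<in> carrier G" "j \<in> N" and e: "(\<pi> i, inv (\<gamma> i) \<otimes> g \<otimes> \<gamma> j, \<pi> j) \<in> fst x" by auto
  have eq: "inv (inv (\<gamma> i) \<otimes> g \<otimes> \<gamma> j) = inv (\<gamma> j) \<otimes> inv g \<otimes> \<gamma> i"
    using \<gamma> c by (simp add: inv_mult_group m_assoc)
  have "(\<pi> j, inv (\<gamma> j) \<otimes> inv g \<otimes> \<gamma> i, \<pi> i) \<in> fst x" using state_inv [OF x e] unfolding eq .
  then show ?case using c by simp
next
  case (5 i g j h l)
  then have c: "i \<in> N" "g \<in> carrier G" "j \<in> N" "h \<in> carrier G" "l \<in> N" by auto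
  have "(inv (\<gamma> i) \<otimes> g \<otimes> \<gamma> j) \<otimes> (inv (\<gamma> j) \<otimes> h \<otimes> \<gamma> l) = inv (\<gamma> i) \<otimes> g \<otimes> (\<gamma> j \<otimes> inv (\<gamma> j)) \<otimes> h \<otimes> \<gamma> l"
    using \<gamma> c by (simp only: m_assoc m_closed inv_closed)
  also have "\<dots> = inv (\<gamma> i) \<otimes> (g \<otimes> h) \<otimes> \<gamma> l"
    using \<gamma> c by (simp add: m_assoc)
  finally have eq: "(inv (\<gamma> i) \<otimes> g \<otimes> \<gamma> j) \<otimes> (inv (\<gamma> j) \<otimes> h \<otimes> \<gamma> l) = inv (\<gamma> i) \<otimes> (g \<otimes> h) \<otimes> \<gamma> l" .
  have "(\<pi> i, inv (\<gamma> i) \<otimes> g \<otimes> \<gamma> j, \<pi> j) \<in> fst x" "(\<pi> j, inv (\<gamma> j) \<otimes> h \<otimes> \<gamma> l, \<pi> l) \<in> fst x"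
    using 5 by auto
  from state_mult [OF x this] have "(\<pi> i, inv (\<gamma> i) \<otimes> (g \<otimes> h) \<otimes> \<gamma> l, \<pi> l) \<in> fst x"
    unfolding eq .
  then show ?case using c by simp
next
  case (6 i g j t)
  then have c: "i \<in> N" "g \<in> carrier G" "j \<in> N" by auto
  obtain u where u: "snd x (\<pi> j) = Some u" "t = \<phi> (\<gamma> j) u" using 6 c by auto
  then have uS: "u \<in> S" using state_colour [OF x] by blast
  have xi: "snd x (\<pi> i) = Some (\<phi> (inv (\<gamma> i) \<otimes> g \<otimes> \<gamma> j) u)" using 6 u state_act [OF x] by auto
  have "\<phi> (\<gamma> i) (\<phi> (inv (\<gamma> i) \<otimes> g \<otimes> \<gamma> j) u) = \<phi> (\<gamma> i \<otimes> (inv (\<gamma> i) \<otimes> (g \<otimes> \<gamma> j))) u"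
    using \<gamma> c uS by (simp add: act_mult m_assoc)
  also have "\<gamma> i \<otimes> (inv (\<gamma> i) \<otimes> (g \<otimes> \<gamma> j)) = g \<otimes> \<gamma> j" using \<gamma> c by (simp flip: m_assoc)
  also have "\<phi> (g \<otimes> \<gamma> j) u = \<phi> g t" using \<gamma> c uS u by (simp add: act_mult)
  finally show ?case using c xi by simp
next
  case (7 i g j t)
  then have c: "i \<in> N" "g \<in> carrier G" "j \<in> N" by (auto split: if_splits)
  obtain u where u: "snd x (\<pi> j) = Some u" "t = \<phi> (\<gamma> j) u" using 7 c by auto
  obtain w where w: "snd x (\<pi> i) = Some w" "\<phi> g t = \<phi> (\<gamma> i) w" using 7 c by auto
  have uS: "u \<in> S" and wS: "w \<in> S" using u w state_colour [OF x] by blast+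
  have "\<phi> (inv (\<gamma> i) \<otimes> g \<otimes> \<gamma> j) u = \<phi> (inv (\<gamma> i)) (\<phi> g t)"
    using u \<gamma> c uS by (simp add: act_mult)
  also have "\<dots> = w" using w \<gamma> c wS by simp
  finally have "(\<pi> i, inv (\<gamma> i) \<otimes> g \<otimes> \<gamma> j, \<pi> j) \<in> fst x"
    using state_coloured [OF x _ u(1)] w(1) \<gamma> c by simp
  then show ?case using c by simp
next
  case (8 i g)
  then have c: "i \<in> N" "g \<in> carrier G" by auto
  have "inv (\<gamma> i) \<otimes> g \<otimes> \<gamma> i = \<one>" using 8 c state_free [OF x] by auto
  then have "\<gamma> i \<otimes> (inv (\<gamma> i) \<otimes> g \<otimes> \<gamma> i) \<otimes> inv (\<gamma> i) = \<one>" using \<gamma> c by simp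
  then show ?case using \<gamma> c by (simp add: m_assoc) (simp flip: m_assoc)
qed auto

lemma state_attach:
  assumes "state M x" "N - {n} \<subseteq> M" "i \<in> M" "g \<in> carrier G"
  shows "state N (attach N n g i x)"
  unfolding attach_def Let_def
  by (rule state_pull [OF assms(1)]) (use assms in auto)

lemma in_attach:
  "(a, h, b) \<in> fst (attach N n g i x) \<longleftrightarrow> a \<in> N \<and> h \<in> carrier G \<and> b \<in> N \<and>
     (if a = n then i else a, inv (if a = n then g else \<one>) \<otimes> h \<otimes> (if b = n then g else \<one>), if b = n then i else b) \<in> fst x"
  by (simp add: attach_def Let_def)

lemma snd_attach:
  "snd (attach N n g i x) a = (if a \<in> N then map_option (\<phi> (if a = n then g else \<one>)) (snd x (if a = n then i else a)) else None)"
  by (simp add: attach_def Let_def)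

lemma attach_mono: "x \<sqsubseteq> y \<Longrightarrow> attach N n g i x \<sqsubseteq> attach N n g i y"
  by (rule state_leI) (auto simp: in_attach snd_attach dest: state_leD split: if_splits)

lemma attach_rel:
  assumes "state M x" "i \<in> M" "i \<in> N" "n \<in> N" "i \<noteq> n" "g \<in> carrier G"
  shows "(n, g, i) \<in> fst (attach N n g i x)"
  using assms by (simp add: in_attach state_one)

text \<open>Once \<open>n\<close> is \<open>g\<close> times \<open>i\<close>, every statement about
  \<open>n\<close> translates into one about \<open>i\<close>. Together with
  \<open>restr_attach\<close> this identifies the states above an atom with the states on one point
  less.\<close>

lemma attach_restr:
  assumes x: "state N x" and e: "(n, g, i) \<in> fst x" and i: "i \<noteq> n"
  shows "attach N n g i (restr (N - {n}) x) = x"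
proof (rule state_eqI)
  have c: "n \<in> N" "g \<in> carrier G" "i \<in> N" using state_rel [OF x e] by auto
  fix a h b
  let ?\<pi> = "\<lambda>a. if a = n then i else a" and ?\<gamma> = "\<lambda>a. if a = n then g else \<one>"
  have er: "(a, ?\<gamma> a, ?\<pi> a) \<in> fst x" if "a \<in> N" for a using e state_one [OF x] that by auto
  have g: "?\<gamma> a \<in> carrier G" for a using c by simp
  show "(a, h, b) \<in> fst (attach N n g i (restr (N - {n}) x)) \<longleftrightarrow> (a, h, b) \<in> fst x"
  proof
    assume "(a, h, b) \<in> fst (attach N n g i (restr (N - {n}) x))"
    then have *: "a \<in> N" "h \<in> carrier G" "b \<in> N" "(?\<pi> a, inv (?\<gamma> a) \<otimes> h \<otimes> ?\<gamma> b, ?\<pi> b) \<in> fst x"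
      unfolding in_attach in_restr by auto
    have "(a, ?\<gamma> a \<otimes> (inv (?\<gamma> a) \<otimes> h \<otimes> ?\<gamma> b) \<otimes> inv (?\<gamma> b), b) \<in> fst x"
      using state_mult [OF x state_mult [OF x er *(4)] state_inv [OF x er]] * by blast
    moreover have "?\<gamma> a \<otimes> (inv (?\<gamma> a) \<otimes> h \<otimes> ?\<gamma> b) \<otimes> inv (?\<gamma> b) = h"
    proof -
      have "u \<otimes> (inv u \<otimes> h \<otimes> v) \<otimes> inv v = h" if "u \<in> carrier G" "v \<in> carrier G" for u v
        using that *(2) by (simp add: m_assoc) (simp flip: m_assoc)
      then show ?thesis using g by blast
    qed
    ultimately show "(a, h, b) \<in> fst x" by simp
  next
    assume h: "(a, h, b) \<in> fst x"
    then have *: "a \<in> N" "h \<in> carrier G" "b \<in> N" using state_rel [OF x] by blast+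
    have "(?\<pi> a, inv (?\<gamma> a) \<otimes> h \<otimes> ?\<gamma> b, ?\<pi> b) \<in> fst x"
      using state_mult [OF x state_mult [OF x state_inv [OF x er] h] er] * by blast
    then show "(a, h, b) \<in> fst (attach N n g i (restr (N - {n}) x))"
      unfolding in_attach in_restr using * i c by auto
  qed
next
  fix a
  have c: "n \<in> N" "g \<in> carrier G" "i \<in> N" using state_rel [OF x e] by auto
  show "snd (attach N n g i (restr (N - {n}) x)) a = snd x a"
  proof (cases "a = n")
    case True
    show ?thesis
    proof (cases "snd x i")
      case None
      then have "snd x n = None" using state_act' [OF x e] by (cases "snd x n") auto
      then show ?thesis using None True c i by (simp add: snd_attach snd_restr)
    next
      case (Some t)
      then show ?thesis using state_act [OF x e] True c i by (simp add: snd_attach snd_restr)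
    qed
  next
    case False
    then show ?thesis using state_colour [OF x, of a]
      by (cases "snd x a") (auto simp: snd_attach snd_restr)
  qed
qed

lemma restr_attach:
  assumes x: "state (N - {n}) x" and "i \<in> N" "i \<noteq> n"
  shows "restr (N - {n}) (attach N n g i x) = x"
proof (rule state_eqI)
  show "(a, h, b) \<in> fst (restr (N - {n}) (attach N n g i x)) \<longleftrightarrow> (a, h, b) \<in> fst x" for a h b
    using state_rel [OF x, of a h b] by (auto simp: in_restr in_attach)
  show "snd (restr (N - {n}) (attach N n g i x)) a = snd x a" for a
    using state_colour [OF x, of a] by (cases "snd x a") (auto simp: snd_restr snd_attach)
qed

lemma attach_restr_eq:
  assumes "i \<in> N" "i \<noteq> n"
  shows "attach N n g i (restr (N - {n}) x) = attach N n g i x"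
  by (rule state_eqI) (use assms in \<open>auto simp: in_attach in_restr snd_attach snd_restr\<close>)

lemma attach_id:
  assumes "state N x" "(n, g, i) \<in> fst x" "i \<noteq> n"
  shows "attach N n g i x = x"
  using attach_restr [OF assms] attach_restr_eq [of i N n g x] state_rel [OF assms(1,2)] assms(3) by simp

lemma le_attach:
  assumes x: "state N x" and s: "single n x" and "i \<in> N" "i \<noteq> n" "n \<in> N" "g \<in> carrier G"
  shows "x \<sqsubseteq> attach N n g i x"
proof (rule state_leI)
  fix a h b assume e: "(a, h, b) \<in> fst x"
  have "a = n \<longleftrightarrow> b = n" using e s single_iff [OF x] by blast
  moreover have "h = \<one>" if "a = n" "b = n"
    using e that s state_free [OF x] by (auto simp: single_def)
  ultimately show "(a, h, b) \<in> fst (attach N n g i x)"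
    using e state_rel [OF x e] assms state_one [OF x] by (auto simp: in_attach)
next
  fix a t assume "snd x a = Some t"
  then show "snd (attach N n g i x) a = Some t"
    using s state_colour [OF x, of a t] by (auto simp: snd_attach single_def)
qed

subsection \<open>Atoms\<close>

definition atom :: "nat set \<Rightarrow> nat \<Rightarrow> 'a \<Rightarrow> nat \<Rightarrow> ('a, 's) state" where
  "atom N n g i = attach N n g i (bot_state N)"

definition paint :: "nat \<Rightarrow> 's \<Rightarrow> ('a, 's) state \<Rightarrow> ('a, 's) state" where
  "paint n t x = (fst x \<union> coloured ((snd x)(n \<mapsto> t)), (snd x)(n \<mapsto> t))"

context
  fixes N :: "nat set" and n :: nat and g :: 'a and i :: nat
  assumes ni: "n \<in> N" "i \<in> N" "i \<noteq> n" "g \<in> carrier G"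
begin

lemma state_atom: "state N (atom N n g i)"
  unfolding atom_def by (rule state_attach [OF state_bot]) (use ni in auto)

lemma atom_rel: "(n, g, i) \<in> fst (atom N n g i)"
  unfolding atom_def by (rule attach_rel [OF state_bot]) (use ni in auto)

lemma snd_atom: "snd (atom N n g i) = Map.empty"
  by (auto simp: atom_def snd_attach)

lemma atom_le_iff:
  assumes x: "state N x"
  shows "atom N n g i \<sqsubseteq> x \<longleftrightarrow> (n, g, i) \<in> fst x"
proof
  show "(n, g, i) \<in> fst x" if "atom N n g i \<sqsubseteq> x"
    using atom_rel state_leD(1) [OF that] by blast
  assume "(n, g, i) \<in> fst x"
  then have "attach N n g i x = x" using attach_id [OF x] ni by blast
  then show "atom N n g i \<sqsubseteq> x" using attach_mono [OF bot_le [OF x], of N n g i] by (simp add: atom_def)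
qed

lemma restr_atom: "restr (N - {n}) (atom N n g i) = bot_state (N - {n})"
proof -
  have "atom N n g i = attach N n g i (bot_state (N - {n}))"
    using attach_restr_eq [of i N n g "bot_state N"] restr_bot [of "N - {n}" N] ni by (simp add: atom_def Diff_subset)
  then show ?thesis using restr_attach [OF state_bot] ni by simp
qed

lemma atom_unique:
  assumes x: "state N x" and e: "(n, g, i) \<in> fst x" and r: "restr (N - {n}) x = bot_state (N - {n})"
  shows "x = atom N n g i"
proof -
  have "x = attach N n g i (restr (N - {n}) x)" using attach_restr [OF x e] ni by simp
  also have "\<dots> = attach N n g i (restr (N - {n}) (atom N n g i))" by (simp add: r restr_atom)
  also have "\<dots> = atom N n g i" using attach_restr [OF state_atom atom_rel] ni by simp
  finally show ?thesis .
qed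

lemma atom_ne_bot: "atom N n g i \<noteq> bot_state N"
  using atom_rel ni in_bot by metis

lemma in_atomD:
  assumes "(n, h, j) \<in> fst (atom N n g i)" "j \<noteq> n"
  shows "j = i" "h = g"
proof -
  have "i = j \<and> inv g \<otimes> h = \<one>" "h \<in> carrier G"
    using assms ni by (auto simp: atom_def in_attach split: if_splits)
  then show "j = i" "h = g" using ni inv_equality [of "inv g" h] inv_solve_left' by (auto simp: inv_solve_left)
qed

end

lemma in_paint: "(a, h, b) \<in> fst (paint n t x) \<longleftrightarrow> (a, h, b) \<in> fst x \<or> (a, h, b) \<in> coloured ((snd x)(n \<mapsto> t))"
  by (simp add: paint_def)

lemma snd_paint: "snd (paint n t x) = (snd x)(n \<mapsto> t)"
  by (simp add: paint_def)

lemma state_paint: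
  assumes x: "state (N - {n}) x" and "n \<in> N" "t \<in> S"
  shows "state N (paint n t x)"
  unfolding paint_def
proof (rule stateI, goal_cases)
  case (1 i u) then show ?case using state_colour [OF x] assms by (auto split: if_splits)
next
  case (2 i g j)
  then show ?case using state_rel [OF x] state_colour [OF x] assms by (auto simp: coloured_def split: if_splits)
next
  case (3 i)
  then show ?case using state_one [OF x] assms by (cases "i = n") (auto simp: coloured_def)
next
  case (4 i g j)
  then show ?case
  proof
    assume "(i, g, j) \<in> coloured ((snd x)(n \<mapsto> t))"
    then obtain u where u: "g \<in> carrier G" "((snd x)(n \<mapsto> t)) j = Some u" "((snd x)(n \<mapsto> t)) i = Some (\<phi> g u)"
      by (auto simp: coloured_def)
    then have "u \<in> S" using state_colour [OF x] assms by (auto split: if_splits)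
    then have "((snd x)(n \<mapsto> t)) j = Some (\<phi> (inv g) (\<phi> g u))" using u by simp
    then have "(j, inv g, i) \<in> coloured ((snd x)(n \<mapsto> t))"
      using u(1,3) unfolding coloured_def by blast
    then show ?thesis by blast
  qed (use state_inv [OF x] in blast)
next
  case (5 i g j h l)
  \<comment> \<open>An old relation with a coloured end lies in the new coloured part, so a product
    of an old and a new relation is a product of new ones.\<close>
  have c: "(i, g, j) \<in> coloured ((snd x)(n \<mapsto> t))" if "(i, g, j) \<in> fst x" "((snd x)(n \<mapsto> t)) j \<noteq> None" for i g j
    using that state_rel [OF x that(1)] state_act [OF x that(1)] by (auto simp: coloured_def split: if_splits)
  have c': "(i, g, j) \<in> coloured ((snd x)(n \<mapsto> t))" if "(i, g, j) \<in> fst x" "((snd x)(n \<mapsto> t)) i \<noteq> None" for i g j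
  proof -
    have "snd x i \<noteq> None" "i \<noteq> n" "j \<noteq> n" using that state_rel [OF x that(1)] by auto
    then show ?thesis using that c state_act' [OF x that(1)] by auto
  qed
  have m: "(i, g \<otimes> h, l) \<in> coloured ((snd x)(n \<mapsto> t))"
    if "(i, g, j) \<in> coloured ((snd x)(n \<mapsto> t))" "(j, h, l) \<in> coloured ((snd x)(n \<mapsto> t))" for i g j h l
    using that state_colour [OF x] assms by (auto simp: coloured_def act_mult split: if_splits)
  show ?case
  proof (cases "((snd x)(n \<mapsto> t)) j = None")
    case True
    then have "(i, g, j) \<notin> coloured ((snd x)(n \<mapsto> t))" "(j, h, l) \<notin> coloured ((snd x)(n \<mapsto> t))"
      by (auto simp: coloured_def)
    then show ?thesis using 5 state_mult [OF x] by blast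
  next
    case False
    then show ?thesis using 5 m c c' by blast
  qed
next
  case (6 i g j u)
  from 6(1) show ?case
  proof (rule UnE)
    assume e: "(i, g, j) \<in> fst x"
    then have "i \<noteq> n" "j \<noteq> n" using state_rel [OF x e] by auto
    then show ?thesis using 6 state_act [OF x e] by simp
  qed (use 6 in \<open>auto simp: coloured_def\<close>)
next
  case (7 i g j u)
  then show ?case by (auto simp: coloured_def)
next
  case (8 i g)
  then show ?case using state_free [OF x] by (auto simp: coloured_def split: if_splits)
qed

lemma restr_paint:
  assumes x: "state (N - {n}) x"
  shows "restr (N - {n}) (paint n t x) = x"
proof (rule state_eqI)
  show "(a, h, b) \<in> fst (restr (N - {n}) (paint n t x)) \<longleftrightarrow> (a, h, b) \<in> fst x" for a h b
    using state_rel [OF x, of a h b] state_coloured [OF x] by (auto simp: in_restr in_paint coloured_def)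
  show "snd (restr (N - {n}) (paint n t x)) a = snd x a" for a
    using state_colour [OF x, of a] by (cases "snd x a") (auto simp: snd_restr snd_paint)
qed

lemma paint_restr:
  assumes x: "state N x" and n: "snd x n = Some t"
  shows "paint n t (restr (N - {n}) x) = x"
proof -
  have z: "(snd (restr (N - {n}) x))(n \<mapsto> t) = snd x"
  proof
    show "((snd (restr (N - {n}) x))(n \<mapsto> t)) a = snd x a" for a
      using n state_colour [OF x, of a] by (cases "snd x a") (auto simp: snd_restr)
  qed
  show ?thesis
  proof (rule state_eqI)
    fix a h b
    show "(a, h, b) \<in> fst (paint n t (restr (N - {n}) x)) \<longleftrightarrow> (a, h, b) \<in> fst x"
    proof
      assume "(a, h, b) \<in> fst (paint n t (restr (N - {n}) x))"
      then show "(a, h, b) \<in> fst x"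
        unfolding in_paint z using state_coloured [OF x] by (auto simp: in_restr coloured_def)
    next
      assume e: "(a, h, b) \<in> fst x"
      show "(a, h, b) \<in> fst (paint n t (restr (N - {n}) x))"
      proof (cases "a = n \<or> b = n")
        case True
        then have "snd x b \<noteq> None" using n state_act' [OF x e] by auto
        then have "(a, h, b) \<in> coloured (snd x)"
          using state_act [OF x e] state_rel [OF x e] by (auto simp: coloured_def)
        then show ?thesis unfolding in_paint z by blast
      next
        case False
        then show ?thesis using e state_rel [OF x e] by (simp add: in_paint in_restr)
      qed
    qed
  qed (simp add: snd_paint z)
qed

lemma paint_mono:
  assumes "state (N - {n}) x" "x \<sqsubseteq> y"
  shows "paint n t x \<sqsubseteq> paint n t y"
proof (rule state_leI)
  have z: "((snd y)(n \<mapsto> t)) a = Some u" if "((snd x)(n \<mapsto> t)) a = Some u" for a u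
    using that state_leD(2) [OF assms(2)] by (auto split: if_splits)
  show "(a, h, b) \<in> fst (paint n t y)" if "(a, h, b) \<in> fst (paint n t x)" for a h b
    using that z state_leD(1) [OF assms(2)] unfolding in_paint coloured_def by blast
  show "snd (paint n t y) a = Some u" if "snd (paint n t x) a = Some u" for a u
    using that z by (simp add: snd_paint)
qed

subsection \<open>Rank\<close>

text \<open>The least elements of the uncoloured blocks; their number is the corank.\<close>

definition leaders :: "nat set \<Rightarrow> ('a, 's) state \<Rightarrow> nat set" where
  "leaders N x = {i \<in> N. snd x i = None \<and> (\<forall>g j. (i, g, j) \<in> fst x \<longrightarrow> i \<le> j)}"

lemma leader_exists:
  assumes x: "state N x" and i: "i \<in> N" "snd x i = None"
  obtains g l where "(i, g, l) \<in> fst x" "l \<in> leaders N x"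
proof -
  define l where "l = (LEAST l. \<exists>g. (i, g, l) \<in> fst x)"
  have "\<exists>g. (i, g, l) \<in> fst x" unfolding l_def by (rule LeastI) (use state_one [OF x i(1)] in blast)
  then obtain g where g: "(i, g, l) \<in> fst x" by blast
  moreover have "l \<in> leaders N x"
    unfolding leaders_def
  proof (intro CollectI conjI allI impI)
    show "l \<in> N" using state_rel [OF x g] by blast
    show "snd x l = None" using state_act [OF x g] i(2) by (cases "snd x l") auto
    fix h j assume "(l, h, j) \<in> fst x"
    then have "(i, g \<otimes> h, j) \<in> fst x" by (rule state_mult [OF x g])
    then show "l \<le> j" unfolding l_def by (intro Least_le) blast
  qed
  ultimately show thesis by (rule that)
qed

lemma leaders_antimono:
  assumes "x \<sqsubseteq> y"
  shows "leaders N y \<subseteq> leaders N x"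
proof
  fix i assume i: "i \<in> leaders N y"
  then have "snd x i = None" using state_leD(2) [OF assms, of i] by (cases "snd x i") (auto simp: leaders_def)
  then show "i \<in> leaders N x" using i state_leD(1) [OF assms] unfolding leaders_def by blast
qed

text \<open>An uncoloured point of \<open>x\<close> is related to a leader, which is also a leader
  of \<open>y\<close>; so the point is uncoloured in \<open>y\<close>, too. Uncoloured points
  related in \<open>y\<close> have leaders related in \<open>y\<close>, hence equal by minimality.
  So they are already related in \<open>x\<close>, with the same label because isotropy is
  trivial.\<close>

lemma leaders_eq_imp_eq:
  assumes x: "state N x" and y: "state N y" and le: "x \<sqsubseteq> y" and eq: "leaders N x = leaders N y"
  shows "x = y"
proof (rule state_le_antisym [OF le])
  have z: "snd x i = Some t" if t: "snd y i = Some t" for i t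
  proof (cases "snd x i")
    case None
    obtain g l where l: "(i, g, l) \<in> fst x" "l \<in> leaders N x"
      by (rule leader_exists [OF x state_colour(1) [OF y t] None])
    then have "l \<in> leaders N y" using eq by simp
    then have "snd y l = None" by (simp add: leaders_def)
    then show ?thesis using state_act' [OF y state_leD(1) [OF le l(1)] t] by simp
  next
    case (Some u)
    then show ?thesis using state_leD(2) [OF le] t by fastforce
  qed
  show "y \<sqsubseteq> x"
  proof (rule state_leI)
    fix i g j assume e: "(i, g, j) \<in> fst y"
    note N = state_rel [OF y e]
    show "(i, g, j) \<in> fst x"
    proof (cases "snd y j")
      case (Some t)
      then show ?thesis using state_act [OF y e Some] z state_coloured [OF x N(2)] by blast
    next
      case None
      then have ni: "snd y i = None" using state_act' [OF y e] by (cases "snd y i") auto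
      have xj: "snd x j = None" using None state_leD(2) [OF le, of j] by (cases "snd x j") auto
      have xi: "snd x i = None" using ni state_leD(2) [OF le, of i] by (cases "snd x i") auto
      obtain h l where l: "(i, h, l) \<in> fst x" "l \<in> leaders N x" by (rule leader_exists [OF x N(1) xi])
      obtain k m where m: "(j, k, m) \<in> fst x" "m \<in> leaders N x" by (rule leader_exists [OF x N(3) xj])
      have yl: "(i, h, l) \<in> fst y" and ym: "(j, k, m) \<in> fst y" using l m state_leD(1) [OF le] by blast+
      have lm: "(l, inv h \<otimes> g \<otimes> k, m) \<in> fst y"
        by (rule state_mult [OF y state_mult [OF y state_inv [OF y yl] e] ym])
      then have "l \<le> m" "m \<le> l" using l m state_inv [OF y lm] eq unfolding leaders_def by blast+
      then have "l = m" by simp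
      then have "(j, k, l) \<in> fst x" using m by simp
      then have "(i, h \<otimes> inv k, j) \<in> fst x" by (rule state_mult [OF x l(1) state_inv [OF x]])
      moreover have "h \<otimes> inv k = g"
      proof -
        have hk: "h \<in> carrier G" "k \<in> carrier G" using state_rel [OF x l(1)] state_rel [OF x m(1)] by auto
        have "(i, (h \<otimes> inv k) \<otimes> inv g, i) \<in> fst y"
          using state_mult [OF y state_leD(1) [OF le calculation] state_inv [OF y e]] .
        then have "h \<otimes> inv k \<otimes> inv g = \<one>" using state_free [OF y _ ni] by blast
        then show ?thesis using hk N(2) by (metis inv_closed inv_equality inv_inv m_closed)
      qed
      ultimately show ?thesis by simp
    qed
  qed (rule z)
qed

lemma card_leaders_strict:
  assumes "finite N" "state N x" "state N y" "x \<sqsubseteq> y" "x \<noteq> y"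
  shows "card (leaders N y) < card (leaders N x)"
proof -
  have "leaders N y \<subset> leaders N x"
    using leaders_antimono [OF assms(4)] leaders_eq_imp_eq [OF assms(2-4)] assms(5) by blast
  moreover have "finite (leaders N x)" using assms(1) by (simp add: leaders_def)
  ultimately show ?thesis by (rule psubset_card_mono [rotated])
qed

text \<open>Along a chain the number of leaders strictly decreases, and it is below
  \<open>card N\<close> for states other than the bottom. Without colours at least one leader
  remains, which excludes the value 0.\<close>

lemma card_chain_le:
  assumes N: "finite N" "N \<noteq> {}" and C: "C \<in> order_complex Q (\<sqsubseteq>)"
    and Q: "\<And>x. x \<in> Q \<Longrightarrow> state N x \<and> x \<noteq> bot_state N"
  shows "card C \<le> card N - (if S = {} then 1 else 0)"
proof -
  let ?r = "\<lambda>x. card (leaders N x)"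
  have C': "C \<subseteq> Q" "\<And>x y. \<lbrakk>x \<in> C; y \<in> C\<rbrakk> \<Longrightarrow> x \<sqsubseteq> y \<or> y \<sqsubseteq> x"
    using C by (auto simp: in_order_complex)
  have "inj_on ?r C"
  proof (rule inj_onI, rule ccontr)
    fix x y assume "x \<in> C" "y \<in> C" "?r x = ?r y" "x \<noteq> y"
    then show False using C' Q card_leaders_strict [OF N(1), of x y] card_leaders_strict [OF N(1), of y x] by (metis less_irrefl subsetD)
  qed
  then have "card C = card (?r ` C)" by (simp add: card_image)
  also have "\<dots> \<le> card {(if S = {} then 1 else 0)..<card N}"
  proof (rule card_mono)
    show "?r ` C \<subseteq> {(if S = {} then 1 else 0)..<card N}"
    proof (intro image_subsetI)
      fix x assume "x \<in> C"
      then have x: "state N x" "x \<noteq> bot_state N" using C' Q by blast+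
      have "leaders N (bot_state N) \<subseteq> N" by (auto simp: leaders_def)
      then have "card (leaders N (bot_state N)) \<le> card N" using N(1) card_mono by blast
      then have "?r x < card N"
        using card_leaders_strict [OF N(1) state_bot x(1) bot_le [OF x(1)]] x(2) by fastforce
      moreover have "1 \<le> ?r x" if "S = {}"
      proof -
        obtain i where i: "i \<in> N" using N by blast
        have "snd x i = None" using state_colour(2) [OF x(1), of i] that by (cases "snd x i") auto
        then have "leaders N x \<noteq> {}" using leader_exists [OF x(1) i] by blast
        moreover have "finite (leaders N x)" using N by (simp add: leaders_def)
        ultimately show ?thesis by (simp add: Suc_le_eq card_gt_0_iff)
      qed
      ultimately show "?r x \<in> {(if S = {} then 1 else 0)..<card N}" by simp
    qed
  qed simp
  finally show ?thesis by simp
qed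

lemma finite_states:
  assumes "finite N" "finite S" "finite (carrier G)"
  shows "finite {x. state N x}"
proof (rule finite_subset)
  show "{x. state N x} \<subseteq> Pow (N \<times> carrier G \<times> N) \<times> {z. dom z \<subseteq> N \<and> ran z \<subseteq> S}"
    by (auto simp: state_def)
  have "{z. dom z \<subseteq> N \<and> ran z \<subseteq> S} = (\<Union>D\<in>Pow N. {z. dom z = D \<and> ran z \<subseteq> S})" by blast
  moreover have "finite {z. dom z = D \<and> ran z \<subseteq> S}" if "D \<subseteq> N" for D
    by (rule finite_set_of_finite_maps) (use that assms finite_subset in auto)
  ultimately show "finite (Pow (N \<times> carrier G \<times> N) \<times> {z. dom z \<subseteq> N \<and> ran z \<subseteq> S})"
    using assms by auto
qed

end

section \<open>Sphericity of the posets of states\<close>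

text \<open>The link condition is required for every \<open>P\<close> between \<open>Q\<close> and
  the final poset without \<open>x\<close>, so the order in which \<open>B\<close> is added is
  immaterial.\<close>

lemma spherical_add_vertices:
  assumes "finite B" "Q \<inter> B = {}" "\<And>x. x \<in> B \<Longrightarrow> r x x"
    and "spherical (Suc k) (order_complex Q r)"
    and "\<And>x P. \<lbrakk>x \<in> B; Q \<subseteq> P; P \<subseteq> Q \<union> B - {x}\<rbrakk> \<Longrightarrow> spherical k (order_complex {y \<in> P. r x y \<or> r y x} r)"
  shows "spherical (Suc k) (order_complex (Q \<union> B) r)"
  using assms
proof (induction B rule: finite_induct)
  case (insert x B)
  have "spherical (Suc k) (order_complex (insert x (Q \<union> B)) r)"
  proof (rule spherical_order_complex_insert)
    show "spherical (Suc k) (order_complex (Q \<union> B) r)"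
    proof (rule insert.IH)
      fix y P assume "y \<in> B" "Q \<subseteq> P" "P \<subseteq> Q \<union> B - {y}"
      then show "spherical k (order_complex {z \<in> P. r y z \<or> r z y} r)"
        by (intro insert.prems(4)) auto
    qed (use insert.prems in auto)
    show "spherical k (order_complex {y \<in> Q \<union> B. r x y \<or> r y x} r)"
      by (rule insert.prems(4)) (use insert.hyps insert.prems(1) in auto)
    show "x \<notin> Q \<union> B" "r x x" using insert.hyps insert.prems(1,2) by auto
  qed
  then show ?case by simp
qed simp

text \<open>The apex of each link is taken in \<open>Q\<close>, so it is present whatever part of
  \<open>B\<close> has been added before.\<close>

lemma spherical_add_cone_vertices:
  assumes "finite B" "finite Q" "Q \<inter> B = {}" "\<And>x. x \<in> Q \<union> B \<Longrightarrow> r x x"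
    and "spherical k (order_complex Q r)"
    and "\<And>x. x \<in> B \<Longrightarrow> \<exists>a\<in>Q. (r x a \<or> r a x) \<and> (\<forall>y\<in>Q \<union> B. r x y \<or> r y x \<longrightarrow> r a y \<or> r y a)"
    and "\<And>C. C \<in> order_complex (Q \<union> B) r \<Longrightarrow> card C \<le> k"
  shows "spherical k (order_complex (Q \<union> B) r)"
  using assms
proof (induction B rule: finite_induct)
  case (insert x B)
  obtain a where a: "a \<in> Q" "r x a \<or> r a x" "\<And>y. \<lbrakk>y \<in> Q \<union> insert x B; r x y \<or> r y x\<rbrakk> \<Longrightarrow> r a y \<or> r y a"
    using insert.prems(5) by blast
  have mono: "order_complex (Q \<union> B) r \<subseteq> order_complex (Q \<union> insert x B) r"
    unfolding order_complex_def by blast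
  have "spherical k (order_complex (insert x (Q \<union> B)) r)"
  proof (rule spherical_order_complex_insert_cone [where a = a])
    show "spherical k (order_complex (Q \<union> B) r)"
    proof (rule insert.IH)
      show "\<And>y. y \<in> B \<Longrightarrow> \<exists>a\<in>Q. (r y a \<or> r a y) \<and> (\<forall>z\<in>Q \<union> B. r y z \<or> r z y \<longrightarrow> r a z \<or> r z a)"
        using insert.prems(5) by blast
      show "\<And>C. C \<in> order_complex (Q \<union> B) r \<Longrightarrow> card C \<le> k" using mono insert.prems(6) by blast
    qed (use insert.prems in auto)
    show "card C \<le> k" if "C \<in> order_complex (insert x (Q \<union> B)) r" for C
      by (rule insert.prems(6)) (use that in simp)
    show "\<And>y. \<lbrakk>y \<in> Q \<union> B; r x y \<or> r y x\<rbrakk> \<Longrightarrow> r a y \<or> r y a" by (rule a(3)) auto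
    show "r x a \<or> r a x" by (rule a(2))
  qed (use insert a(1) in auto)
  then show ?case by simp
qed simp

context dowling_action
begin

section \<open>The posets of the induction, and detaching a point\<close>

definition fixed_points :: "'s set \<Rightarrow> bool" where
  "fixed_points F \<longleftrightarrow> F \<subseteq> S \<and> (\<forall>s\<in>F. \<forall>g\<in>carrier G. \<phi> g s = s)"

text \<open>
  The points in \<open>L\<close> are light: none of them may be the only point of its colour if the colour is in
  \<open>F\<close>. In an interval above an atom the points are blocks, and only singleton blocks are light.
\<close>

definition fam :: "nat set \<Rightarrow> nat set \<Rightarrow> 's set \<Rightarrow> ('a, 's) state set" where
  "fam N L F = {x. state N x \<and> (\<forall>s\<in>F. \<forall>i\<in>L. fib x s \<noteq> {i})}"

definition nonbot :: "nat set \<Rightarrow> nat set \<Rightarrow> 's set \<Rightarrow> ('a, 's) state set" where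
  "nonbot N L F = fam N L F - {bot_state N}"

text \<open>
  The atoms colouring only \<open>n\<close>, by \<open>F\<close>, are deleted because of the induction: a state colouring just
  a pair \<open>{i, n}\<close> with \<open>i\<close> light is added only after the first atom joining \<open>n\<close> to \<open>i\<close>, so it is missing
  from the link of that atom, where the block \<open>{i, n}\<close> plays the role of \<open>n\<close>.
\<close>

definition pruned :: "nat set \<Rightarrow> nat set \<Rightarrow> 's set \<Rightarrow> nat \<Rightarrow> ('a, 's) state set" where
  "pruned N L F n = {x \<in> nonbot N L F. \<not> (restr (N - {n}) x = bot_state (N - {n}) \<and> (\<exists>s\<in>F. snd x n = Some s))}"

text \<open>
  Removing \<open>n\<close> from a fibre \<open>{i, n}\<close> over \<open>F\<close> would leave a light point \<open>i\<close> alone with its colour, so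
  \<open>i\<close> has to be isolated together with \<open>n\<close>.
\<close>

definition lonely :: "nat set \<Rightarrow> 's set \<Rightarrow> nat \<Rightarrow> ('a, 's) state \<Rightarrow> nat set" where
  "lonely L F n x = insert n {i \<in> L. \<exists>s\<in>F. snd x i = Some s \<and> fib x s \<subseteq> {i, n}}"

definition detach :: "nat set \<Rightarrow> nat set \<Rightarrow> 's set \<Rightarrow> nat \<Rightarrow> ('a, 's) state \<Rightarrow> ('a, 's) state" where
  "detach N L F n x = isolate N (lonely L F n x) x"

lemma isolate_bot_iff_restr:
  assumes x: "state N x" and "n \<in> N"
  shows "isolate N {n} x = bot_state N \<longleftrightarrow> restr (N - {n}) x = bot_state (N - {n})"
proof
  assume "isolate N {n} x = bot_state N"
  then have i: "\<And>a h b. \<lbrakk>(a, h, b) \<in> fst x; a \<noteq> n; b \<noteq> n\<rbrakk> \<Longrightarrow> b = a \<and> h = \<one>" "dom (snd x) \<subseteq> {n}"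
    using isolate_eq_bot_iff [OF x, of "{n}"] by blast+
  then have "\<And>a. a \<noteq> n \<Longrightarrow> snd x a = None" by auto
  then show "restr (N - {n}) x = bot_state (N - {n})"
    using i(1) by (intro state_eqI) (auto simp: in_restr snd_restr state_one [OF x])
next
  assume r: "restr (N - {n}) x = bot_state (N - {n})"
  have "b = a \<and> h = \<one>" if "(a, h, b) \<in> fst x" "a \<noteq> n" "b \<noteq> n" for a h b
  proof -
    have "(a, h, b) \<in> fst (restr (N - {n}) x)" using that state_rel [OF x that(1)] by (simp add: in_restr)
    then show ?thesis unfolding r in_bot by blast
  qed
  moreover have "a = n" if "snd x a = Some t" for a t
  proof (rule ccontr)
    assume "a \<noteq> n"
    then have "snd (restr (N - {n}) x) a = Some t" using that state_colour [OF x that] by (simp add: snd_restr)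
    then show False unfolding r by simp
  qed
  ultimately show "isolate N {n} x = bot_state N" using isolate_eq_bot_iff [OF x, of "{n}"] by auto
qed

lemma singleD: "\<lbrakk>state N x; single n x; (a, h, b) \<in> fst x\<rbrakk> \<Longrightarrow> a = n \<longleftrightarrow> b = n"
  using single_iff by metis

lemma famD: "x \<in> fam N L F \<Longrightarrow> state N x" "\<lbrakk>x \<in> fam N L F; s \<in> F; i \<in> L\<rbrakk> \<Longrightarrow> fib x s \<noteq> {i}"
  by (auto simp: fam_def)

lemma prunedD: "x \<in> pruned N L F n \<Longrightarrow> x \<in> fam N L F" "x \<in> pruned N L F n \<Longrightarrow> x \<noteq> bot_state N"
  by (auto simp: pruned_def nonbot_def)

lemma fixed_act:
  assumes "fixed_points F" "state N x" "(i, g, j) \<in> fst x" "s \<in> F"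
  shows "snd x i = Some s \<longleftrightarrow> snd x j = Some s"
  using state_act [OF assms(2,3), of s] state_act' [OF assms(2,3), of s] state_rel [OF assms(2,3)] assms(1,4)
  by (auto simp: fixed_points_def)

text \<open>A colour in \<open>F\<close> is fixed by the group, so \<open>n\<close> has it exactly
  if \<open>i\<close> has it. After the removal of \<open>n\<close>, the point \<open>i\<close>
  stands for a block containing both and may be alone with its colour; hence it is no longer
  light.\<close>

lemma fam_attach_iff:
  assumes F: "fixed_points F" and y: "state N y" and e: "(n, g, i) \<in> fst y" and i: "i \<noteq> n"
  shows "y \<in> fam N L F \<longleftrightarrow> restr (N - {n}) y \<in> fam (N - {n}) (L - {i}) F"
proof -
  have fr: "fib (restr (N - {n}) y) s = fib y s - {n}" for s
    using state_colour [OF y] by (auto simp: fib_def snd_restr split: if_splits)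
  have ni: "n \<in> fib y s \<longleftrightarrow> i \<in> fib y s" if "s \<in> F" for s
    using fixed_act [OF F y e that] by (simp add: fib_def)
  have st: "state (N - {n}) (restr (N - {n}) y)" by (rule state_restr [OF y]) blast
  show ?thesis
  proof
    assume f: "y \<in> fam N L F"
    have "fib y s - {n} \<noteq> {j}" if "s \<in> F" "j \<in> L - {i}" for s j
    proof
      assume d: "fib y s - {n} = {j}"
      have "i \<notin> fib y s"
      proof
        assume "i \<in> fib y s"
        then have "i \<in> fib y s - {n}" using i by simp
        then show False unfolding d using that by simp
      qed
      then have "fib y s = {j}" using ni [OF that(1)] d by blast
      then show False using famD(2) [OF f, of s j] that by blast
    qed
    then show "restr (N - {n}) y \<in> fam (N - {n}) (L - {i}) F"
      using st by (simp add: fam_def fr)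
  next
    assume f: "restr (N - {n}) y \<in> fam (N - {n}) (L - {i}) F"
    have "fib y s \<noteq> {j}" if "s \<in> F" "j \<in> L" for s j
    proof
      assume d: "fib y s = {j}"
      then have "j \<noteq> n" "j \<noteq> i" using ni [OF that(1)] i by auto
      then have "fib (restr (N - {n}) y) s = {j}" "j \<in> L - {i}" using d fr that by auto
      then show False using famD(2) [OF f] that by blast
    qed
    then show "y \<in> fam N L F" using y by (simp add: fam_def)
  qed
qed

lemma fam_paint_iff:
  assumes y: "state N y" and n: "snd y n = Some t" and t: "t \<notin> F"
  shows "y \<in> fam N L F \<longleftrightarrow> restr (N - {n}) y \<in> fam (N - {n}) L F"
proof -
  have fr: "fib (restr (N - {n}) y) s = fib y s" if "s \<in> F" for s
    using state_colour [OF y] n t that by (auto simp: fib_def snd_restr split: if_splits)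
  have "state (N - {n}) (restr (N - {n}) y)" by (rule state_restr [OF y]) blast
  then show ?thesis using y fr by (simp add: fam_def)
qed

context
  fixes N L :: "nat set" and F :: "'s set" and n :: nat
  assumes F: "fixed_points F" and n: "n \<in> N"
begin

lemma n_lonely: "n \<in> lonely L F n x"
  by (simp add: lonely_def)

lemma lonelyD:
  assumes "x \<in> fam N L F" "i \<in> lonely L F n x" "i \<noteq> n"
  obtains s where "s \<in> F" "i \<in> L" "fib x s = {i, n}"
proof -
  obtain s where s: "s \<in> F" "i \<in> L" "snd x i = Some s" "fib x s \<subseteq> {i, n}"
    using assms by (auto simp: lonely_def)
  then have "i \<in> fib x s" "fib x s \<noteq> {i}" using famD(2) [OF assms(1)] by (auto simp: fib_def)
  then have "fib x s = {i, n}" using s(4) by blast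
  then show thesis using that s by blast
qed

lemma detach_fam:
  assumes x: "x \<in> fam N L F"
  shows "detach N L F n x \<in> fam N L F"
proof -
  have fd: "fib (detach N L F n x) s = fib x s - lonely L F n x" for s
    by (auto simp: fib_def detach_def snd_isolate split: if_splits)
  have "fib x s - lonely L F n x \<noteq> {i}" if s: "s \<in> F" and i: "i \<in> L" for s i
  proof
    assume d: "fib x s - lonely L F n x = {i}"
    \<comment> \<open>A further point \<open>j\<close> of this fibre would have been removed as
      lonely; but then the fibre is \<open>{j, n}\<close> and does not contain
      \<open>i\<close>.\<close>
    have "fib x s \<subseteq> {i, n}"
    proof
      fix j assume j: "j \<in> fib x s"
      show "j \<in> {i, n}"
      proof (rule ccontr)
        assume "j \<notin> {i, n}"
        then have "j \<in> lonely L F n x" using d j by blast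
        then obtain s' where s': "fib x s' = {j, n}"
          using lonelyD [OF x, of j] \<open>j \<notin> {i, n}\<close> by blast
        then have "j \<in> fib x s'" by simp
        then have "s' = s" using j by (simp add: fib_def)
        have "i \<in> fib x s - lonely L F n x" unfolding d by simp
        then have "i \<in> {j, n}" "i \<noteq> n" using s' \<open>s' = s\<close> n_lonely [of x] by auto
        then show False using \<open>j \<notin> {i, n}\<close> by simp
      qed
    qed
    moreover have "snd x i = Some s" using d by (auto simp: fib_def)
    ultimately have "i \<in> lonely L F n x" using s i by (auto simp: lonely_def)
    then show False using d by blast
  qed
  then show ?thesis
    using state_isolate [OF famD(1) [OF x]] by (simp add: fam_def fd) (simp add: detach_def)
qed

lemma detach_le: "x \<in> fam N L F \<Longrightarrow> detach N L F n x \<sqsubseteq> x"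
  unfolding detach_def by (rule isolate_le [OF famD(1)])

lemma single_detach: "single n (detach N L F n x)"
  unfolding detach_def by (rule single_isolate [OF n_lonely])

text \<open>Let \<open>{i, n}\<close> be a fibre of \<open>x\<close> over \<open>F\<close>. In
  \<open>y\<close> the point \<open>i\<close> cannot have this colour, as it would be alone with it;
  and points related to \<open>i\<close> in \<open>y\<close> have the same colour in
  \<open>x\<close> and differ from \<open>n\<close>, so they are \<open>i\<close> itself.\<close>

lemma detach_greatest:
  assumes x: "x \<in> fam N L F" and y: "y \<in> fam N L F" and s: "single n y" and le: "y \<sqsubseteq> x"
  shows "y \<sqsubseteq> detach N L F n x"
  unfolding detach_def
proof (rule isolate_greatest [OF famD(1) [OF y] le])
  fix i assume i: "i \<in> lonely L F n x"
  show "single i y"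
  proof (cases "i = n")
    case False
    obtain t where t: "t \<in> F" "i \<in> L" "fib x t = {i, n}" by (rule lonelyD [OF x i False])
    have fy: "fib y t \<subseteq> {i}" using t(3) state_leD(2) [OF le] s by (auto simp: fib_def single_def)
    have "snd y i = None"
    proof (rule ccontr)
      assume "snd y i \<noteq> None"
      then obtain u where u: "snd y i = Some u" by blast
      then have "snd x i = Some u" by (rule state_leD(2) [OF le])
      moreover have "snd x i = Some t" using t(3) by (auto simp: fib_def)
      ultimately have "fib y t = {i}" using u fy by (auto simp: fib_def)
      then show False using famD(2) [OF y] t by blast
    qed
    moreover have "b = i" if e: "(i, h, b) \<in> fst y" for h b
    proof -
      have "snd x i = Some t" using t(3) by (auto simp: fib_def)
      then have "snd x b = Some t"
        using fixed_act [OF F famD(1) [OF x] state_leD(1) [OF le e] t(1)] by blast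
      then have "b \<in> {i, n}" using t(3) by (auto simp: fib_def)
      moreover have "b \<noteq> n" using singleD [OF famD(1) [OF y] s e] False by simp
      ultimately show ?thesis by simp
    qed
    ultimately show ?thesis by (simp add: single_def)
  qed (use s in simp)
qed

lemma detach_mono:
  assumes "x \<in> fam N L F" "y \<in> fam N L F" "y \<sqsubseteq> x"
  shows "detach N L F n y \<sqsubseteq> detach N L F n x"
  using detach_greatest [OF assms(1) detach_fam [OF assms(2)] single_detach]
    state_le_trans [OF detach_le [OF assms(2)] assms(3)] by blast

abbreviation "\<P> \<equiv> pruned N L F n"
text \<open>An element of this set is an atom joining \<open>n\<close> to another point, or colours
  only \<open>n\<close>, by a colour outside \<open>F\<close>, or colours just a pair
  \<open>{i, n}\<close> with \<open>i\<close> light, by a colour in \<open>F\<close>. Those of the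
  first two kinds are minimal in \<open>\<P>\<close>.\<close>

abbreviation "\<A> \<equiv> {x \<in> \<P>. detach N L F n x = bot_state N}"

text \<open>Colouring \<open>n\<close> alone by \<open>F\<close> is excluded by the pruning, so some
  other point is lonely. The fibres of lonely points other than \<open>n\<close> all contain
  \<open>n\<close>, hence coincide, which leaves only one such point.\<close>

lemma in_A_F:
  assumes x: "x \<in> \<A>" and s: "s \<in> F" "snd x n = Some s"
  obtains i where "i \<in> L" "i \<in> N" "i \<noteq> n" "fib x s = {i, n}" "(n, \<one>, i) \<in> fst x"
    "lonely L F n x = {i, n}"
proof -
  have f: "x \<in> fam N L F" using x prunedD by blast
  have "restr (N - {n}) x \<noteq> bot_state (N - {n})" using x s by (auto simp: pruned_def)
  then have "isolate N {n} x \<noteq> bot_state N" using isolate_bot_iff_restr [OF famD(1) [OF f] n] by simp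
  then have "lonely L F n x \<noteq> {n}" using x by (auto simp: detach_def)
  then obtain i where i: "i \<in> lonely L F n x" "i \<noteq> n" using n_lonely [of x] by blast
  have fib: "fib x s = {j, n}" if j: "j \<in> lonely L F n x" "j \<noteq> n" for j
  proof -
    obtain t where t: "fib x t = {j, n}" by (rule lonelyD [OF f j])
    then have "n \<in> fib x t" by simp
    then have "t = s" using s by (simp add: fib_def)
    then show ?thesis using t by simp
  qed
  have "snd x i = Some s" using fib [OF i] by (auto simp: fib_def)
  moreover have "s \<in> S" using F s by (auto simp: fixed_points_def)
  ultimately have "(n, \<one>, i) \<in> fst x" "i \<in> N"
    using state_coloured [OF famD(1) [OF f], of \<one> i s n] s state_colour [OF famD(1) [OF f]] by auto
  moreover have "lonely L F n x = {i, n}"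
  proof -
    have "j = i" if "j \<in> lonely L F n x" "j \<noteq> n" for j using fib [OF that] fib [OF i] i by auto
    then show ?thesis using i n_lonely by blast
  qed
  moreover have "i \<in> L" using lonelyD [OF f i] by blast
  ultimately show thesis using that fib [OF i] i by blast
qed

lemma in_A_restr:
  assumes x: "x \<in> \<A>" and "\<And>s. s \<in> F \<Longrightarrow> snd x n \<noteq> Some s"
  shows "restr (N - {n}) x = bot_state (N - {n})"
proof -
  have f: "x \<in> fam N L F" using x prunedD by blast
  have "lonely L F n x = {n}"
  proof (rule ccontr)
    assume "lonely L F n x \<noteq> {n}"
    then obtain i where i: "i \<in> lonely L F n x" "i \<noteq> n" using n_lonely [of x] by blast
    obtain t where "t \<in> F" "fib x t = {i, n}" by (rule lonelyD [OF f i])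
    then show False using assms(2) by (auto simp: fib_def)
  qed
  then show ?thesis using x isolate_bot_iff_restr [OF famD(1) [OF f] n] by (simp add: detach_def)
qed

lemma in_A_uncoloured:
  assumes x: "x \<in> \<A>" and s: "snd x n = None"
  obtains g i where "g \<in> carrier G" "i \<in> N" "i \<noteq> n" "x = atom N n g i"
proof -
  have f: "x \<in> fam N L F" "x \<noteq> bot_state N" using x prunedD by blast+
  have r: "restr (N - {n}) x = bot_state (N - {n})" by (rule in_A_restr [OF x]) (simp add: s)
  have "\<not> single n x"
  proof
    assume "single n x"
    then have "x \<sqsubseteq> bot_state N"
      using detach_greatest [OF f(1) f(1)] x by auto
    then show False using f(2) bot_le [OF famD(1) [OF f(1)]] state_le_antisym by blast
  qed
  then obtain g i where e: "(n, g, i) \<in> fst x" "i \<noteq> n" using s by (auto simp: single_def)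
  then have "g \<in> carrier G" "i \<in> N" using state_rel [OF famD(1) [OF f(1)]] by blast+
  then show thesis using that e atom_unique [OF n _ _ _ famD(1) [OF f(1)] e(1) r] by blast
qed

lemma in_A_painted:
  assumes x: "x \<in> \<A>" and s: "snd x n = Some t" "t \<notin> F"
  shows "x = paint n t (bot_state (N - {n}))"
proof -
  have "restr (N - {n}) x = bot_state (N - {n})" by (rule in_A_restr [OF x]) (use s in auto)
  moreover have "state N x" using x prunedD famD by blast
  ultimately show ?thesis using paint_restr [of N x n t] s by simp
qed

text \<open>A state above the atom that is trivial apart from \<open>n\<close> is the atom itself,
  and this has no colours.\<close>

lemma above_atom_pruned:
  assumes y: "y \<in> nonbot N L F" and e: "(n, g, i) \<in> fst y" "i \<noteq> n"
  shows "y \<in> \<P>"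
proof -
  have st: "state N y" using y by (auto simp: nonbot_def fam_def)
  have c: "g \<in> carrier G" "i \<in> N" using state_rel [OF st e(1)] by auto
  have "snd y n = None" if "restr (N - {n}) y = bot_state (N - {n})"
    using atom_unique [OF n c(2) e(2) c(1) st e(1) that] snd_atom [OF n c(2) e(2) c(1)] by simp
  then show ?thesis using y by (auto simp: pruned_def)
qed

lemma atom_in_A:
  assumes c: "g \<in> carrier G" "i \<in> N" "i \<noteq> n"
  shows "atom N n g i \<in> \<A>"
proof -
  let ?a = "atom N n g i"
  note ni = n c(2,3,1)
  have s: "snd ?a = Map.empty" by (rule snd_atom [OF ni])
  have "?a \<in> fam N L F" using state_atom [OF ni] by (simp add: fam_def fib_def s)
  then have pr: "?a \<in> \<P>" using above_atom_pruned atom_rel [OF ni] c atom_ne_bot [OF ni] by (auto simp: nonbot_def)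
  have "lonely L F n ?a = {n}" by (simp add: lonely_def s)
  then have "detach N L F n ?a = bot_state N"
    using isolate_bot_iff_restr [OF state_atom [OF ni] n] restr_atom [OF ni] by (simp add: detach_def)
  then show ?thesis using pr by simp
qed

text \<open>By monotonicity of \<open>detach\<close>, \<open>w\<close> is detached to the bottom as
  well and is one of the explicit states; a comparison of these gives equality.\<close>

lemma A_minimal:
  assumes w: "w \<in> \<P>" and y: "y \<in> \<A>" and le: "w \<sqsubseteq> y" and s: "\<And>s. s \<in> F \<Longrightarrow> snd y n \<noteq> Some s"
  shows "w = y"
proof -
  have "detach N L F n w \<sqsubseteq> bot_state N"
    using detach_mono [OF _ _ le] y prunedD(1) [OF w] prunedD(1) [of y N L F n] by simp
  then have wA: "w \<in> \<A>"
    using w bot_le [OF famD(1) [OF detach_fam]] prunedD state_le_antisym by blast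
  show ?thesis
  proof (cases "snd y n")
    case None
    then have wn: "snd w n = None" using state_leD(2) [OF le, of n] by (cases "snd w n") auto
    obtain g i where y': "g \<in> carrier G" "i \<in> N" "i \<noteq> n" "y = atom N n g i" by (rule in_A_uncoloured [OF y None])
    obtain h j where w': "h \<in> carrier G" "j \<in> N" "j \<noteq> n" "w = atom N n h j" by (rule in_A_uncoloured [OF wA wn])
    have "(n, h, j) \<in> fst y" using state_leD(1) [OF le] atom_rel [OF n w'(2,3,1)] w'(4) by blast
    then show ?thesis using in_atomD [OF n y'(2,3,1)] w' y' by blast
  next
    case (Some t)
    then have t: "t \<notin> F" using s by blast
    have yp: "y = paint n t (bot_state (N - {n}))" by (rule in_A_painted [OF y Some t])
    show ?thesis
    proof (cases "snd w n")
      case None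
      obtain h j where w': "h \<in> carrier G" "j \<in> N" "j \<noteq> n" "w = atom N n h j" by (rule in_A_uncoloured [OF wA None])
      have "(n, h, j) \<in> fst y" using state_leD(1) [OF le] atom_rel [OF n w'(2,3,1)] w'(4) by blast
      moreover have "state N y" using y prunedD famD by blast
      \<comment> \<open>An atom below \<open>y\<close> would give \<open>j\<close> a colour, but
        \<open>n\<close> is the only coloured point of \<open>y\<close>.\<close>
      ultimately have "snd y j \<noteq> None" using state_act' [of N y n h j t] Some by auto
      then show ?thesis using w'(3) by (simp add: yp snd_paint)
    next
      case (Some u)
      then have "u = t" using state_leD(2) [OF le Some] \<open>snd y n = Some t\<close> by simp
      then show ?thesis using in_A_painted [OF wA Some] t yp by simp
    qed
  qed
qed

subsection \<open>Intervals above the minimal elements\<close>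

text \<open>\<open>attach\<close> is an isomorphism from the states on \<open>N - {n}\<close>, where
  \<open>i\<close> stands for the block of \<open>i\<close> and \<open>n\<close> and is not light.
  The predicate \<open>R\<close> allows further states to be cut out on both sides.\<close>

lemma spherical_above_atom:
  assumes c: "g \<in> carrier G" "i \<in> N" "i \<noteq> n"
    and sph: "spherical k (order_complex {y \<in> nonbot (N - {n}) (L - {i}) F. R y} (\<sqsubseteq>))"
    and Q: "Q = {y \<in> nonbot N L F. atom N n g i \<sqsubseteq> y \<and> y \<noteq> atom N n g i \<and> R (restr (N - {n}) y)}"
  shows "spherical k (order_complex Q (\<sqsubseteq>))"
proof (rule spherical_order_iso [where h = "attach N n g i" and r = "(\<sqsubseteq>)"])
  note ni = n c(2,3,1)
  let ?P = "{y \<in> nonbot (N - {n}) (L - {i}) F. R y}"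
  have st: "state (N - {n}) y" if "y \<in> ?P" for y using that by (auto simp: nonbot_def fam_def)
  have ra: "restr (N - {n}) (attach N n g i y) = y" if "y \<in> ?P" for y
    by (rule restr_attach [OF st [OF that] c(2,3)])
  have ar: "attach N n g i (restr (N - {n}) y) = y" "(n, g, i) \<in> fst y" "state N y" if "y \<in> Q" for y
  proof -
    show y: "state N y" using that by (auto simp: Q nonbot_def fam_def)
    show e: "(n, g, i) \<in> fst y" using that atom_le_iff [OF ni y] by (simp add: Q)
    show "attach N n g i (restr (N - {n}) y) = y" by (rule attach_restr [OF y e c(3)])
  qed
  show "bij_betw (attach N n g i) ?P Q"
  proof (rule bij_betw_byWitness [where f' = "restr (N - {n})"])
    show "\<forall>y\<in>?P. restr (N - {n}) (attach N n g i y) = y" using ra by blast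
    show "\<forall>y\<in>Q. attach N n g i (restr (N - {n}) y) = y" using ar by blast
    show "attach N n g i ` ?P \<subseteq> Q"
    proof (rule image_subsetI)
      fix y assume y: "y \<in> ?P"
      let ?y = "attach N n g i y"
      have sy: "state N ?y" by (rule state_attach [OF st [OF y]]) (use c in auto)
      have e: "(n, g, i) \<in> fst ?y" by (rule attach_rel [OF st [OF y]]) (use c n in auto)
      have "?y \<in> fam N L F"
        using fam_attach_iff [OF F sy e c(3), of L] ra [OF y] y by (simp add: nonbot_def)
      moreover have "?y \<noteq> bot_state N" using e c by auto
      moreover have "atom N n g i \<sqsubseteq> ?y" using atom_le_iff [OF ni sy] e by simp
      moreover have "?y \<noteq> atom N n g i"
        using ra [OF y] restr_atom [OF ni] y by (auto simp: nonbot_def)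
      ultimately show "?y \<in> Q" using ra [OF y] y by (simp add: Q nonbot_def)
    qed
    show "restr (N - {n}) ` Q \<subseteq> ?P"
    proof (rule image_subsetI)
      fix y assume y: "y \<in> Q"
      have "restr (N - {n}) y \<in> fam (N - {n}) (L - {i}) F"
        using fam_attach_iff [OF F ar(3,2) [OF y] c(3), of L] y by (simp add: Q nonbot_def)
      moreover have "restr (N - {n}) y \<noteq> bot_state (N - {n})"
        using atom_unique [OF ni ar(3,2) [OF y]] y by (auto simp: Q)
      ultimately show "restr (N - {n}) y \<in> ?P" using y by (simp add: Q nonbot_def)
    qed
  qed
  show "attach N n g i x \<sqsubseteq> attach N n g i y \<longleftrightarrow> x \<sqsubseteq> y" if "x \<in> ?P" "y \<in> ?P" for x y
    using attach_mono [of x y N n g i] restr_mono [of "attach N n g i x" "attach N n g i y" "N - {n}"] ra that by auto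
  show "spherical k (order_complex ?P (\<sqsubseteq>))" by (rule sph)
qed

text \<open>Here \<open>paint\<close> is the isomorphism; a colour outside \<open>F\<close> on
  \<open>n\<close> has no effect on the fibres over \<open>F\<close>, so the other points keep their
  lightness.\<close>

lemma spherical_above_painted:
  assumes t: "t \<in> S" "t \<notin> F"
    and sph: "spherical k (order_complex (nonbot (N - {n}) L F) (\<sqsubseteq>))"
    and c: "c = paint n t (bot_state (N - {n}))"
    and Q: "Q = {y \<in> nonbot N L F. c \<sqsubseteq> y \<and> y \<noteq> c}"
  shows "spherical k (order_complex Q (\<sqsubseteq>))"
proof (rule spherical_order_iso [where h = "paint n t" and r = "(\<sqsubseteq>)"])
  let ?P = "nonbot (N - {n}) L F"
  have st: "state (N - {n}) y" if "y \<in> ?P" for y using that by (auto simp: nonbot_def fam_def)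
  have rp: "restr (N - {n}) (paint n t y) = y" if "y \<in> ?P" for y
    by (rule restr_paint [OF st [OF that]])
  have rc: "restr (N - {n}) c = bot_state (N - {n})" unfolding c by (rule restr_paint [OF state_bot])
  have cn: "snd c n = Some t" by (simp add: c snd_paint)
  have pr: "paint n t (restr (N - {n}) y) = y" "snd y n = Some t" "state N y" if "y \<in> Q" for y
  proof -
    show y: "state N y" using that by (auto simp: Q nonbot_def fam_def)
    show e: "snd y n = Some t" by (rule state_leD(2) [OF _ cn]) (use that in \<open>simp add: Q\<close>)
    show "paint n t (restr (N - {n}) y) = y" by (rule paint_restr [OF y e])
  qed
  show "bij_betw (paint n t) ?P Q"
  proof (rule bij_betw_byWitness [where f' = "restr (N - {n})"])
    show "\<forall>y\<in>?P. restr (N - {n}) (paint n t y) = y" using rp by blast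
    show "\<forall>y\<in>Q. paint n t (restr (N - {n}) y) = y" using pr by blast
    show "paint n t ` ?P \<subseteq> Q"
    proof (rule image_subsetI)
      fix y assume y: "y \<in> ?P"
      let ?y = "paint n t y"
      have sy: "state N ?y" by (rule state_paint [OF st [OF y] n t(1)])
      have e: "snd ?y n = Some t" by (simp add: snd_paint)
      have "?y \<in> fam N L F"
        using fam_paint_iff [OF sy e t(2), of L] rp [OF y] y by (simp add: nonbot_def)
      moreover have "?y \<noteq> bot_state N" using e by auto
      moreover have "c \<sqsubseteq> ?y" unfolding c by (rule paint_mono [OF state_bot bot_le [OF st [OF y]]])
      moreover have "?y \<noteq> c" using rp [OF y] rc y by (auto simp: nonbot_def)
      ultimately show "?y \<in> Q" by (simp add: Q nonbot_def)
    qed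
    show "restr (N - {n}) ` Q \<subseteq> ?P"
    proof (rule image_subsetI)
      fix y assume y: "y \<in> Q"
      have "restr (N - {n}) y \<in> fam (N - {n}) L F"
        using fam_paint_iff [OF pr(3,2) [OF y] t(2), of L] y by (simp add: Q nonbot_def)
      moreover have "restr (N - {n}) y \<noteq> bot_state (N - {n})"
        using pr(1) [OF y] y by (auto simp: Q c)
      ultimately show "restr (N - {n}) y \<in> ?P" by (simp add: nonbot_def)
    qed
  qed
  show "paint n t x \<sqsubseteq> paint n t y \<longleftrightarrow> x \<sqsubseteq> y" if "x \<in> ?P" "y \<in> ?P" for x y
    using paint_mono [OF st [OF that(1)], of y t] restr_mono [of "paint n t x" "paint n t y" "N - {n}"] rp that by auto
  show "spherical k (order_complex ?P (\<sqsubseteq>))" by (rule sph)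
qed

text \<open>The elements of \<open>\<A>\<close> strictly above such an atom colour just the pair
  \<open>{i, n}\<close>. On \<open>N - {n}\<close> they colour only \<open>i\<close>, by
  \<open>F\<close>, so they are what \<open>pruned\<close> removes from the smaller poset at
  \<open>i\<close>. This is how pruned posets recur in the induction.\<close>

lemma above_unit_atom_in_A_iff:
  assumes i: "i \<in> N" "i \<noteq> n" and y: "y \<in> \<P>" and le: "atom N n \<one> i \<sqsubseteq> y" and ne: "y \<noteq> atom N n \<one> i"
  shows "y \<in> \<A> \<longleftrightarrow> i \<in> L \<and> restr (N - {n} - {i}) (restr (N - {n}) y) = bot_state (N - {n} - {i}) \<and>
      (\<exists>s\<in>F. snd (restr (N - {n}) y) i = Some s)"
proof -
  note ni = n i one_closed
  have f: "y \<in> fam N L F" using y prunedD by blast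
  have st: "state N y" by (rule famD(1) [OF f])
  have e: "(n, \<one>, i) \<in> fst y" using le atom_le_iff [OF ni st] by simp
  have sr: "state (N - {n}) (restr (N - {n}) y)" by (rule state_restr [OF st]) blast
  have iN: "i \<in> N - {n}" using i by simp
  note iso = isolate_bot_iff_restr [OF sr iN]
  show ?thesis
  proof
    assume yA: "y \<in> \<A>"
    consider "snd y n = None" | t where "snd y n = Some t" "t \<notin> F" | t where "snd y n = Some t" "t \<in> F"
      by (cases "snd y n") auto
    then show "i \<in> L \<and> restr (N - {n} - {i}) (restr (N - {n}) y) = bot_state (N - {n} - {i}) \<and>
      (\<exists>s\<in>F. snd (restr (N - {n}) y) i = Some s)"
    proof cases
      case 1
      obtain h j where j: "h \<in> carrier G" "j \<in> N" "j \<noteq> n" "y = atom N n h j" by (rule in_A_uncoloured [OF yA 1])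
      then have "i = j" "h = \<one>" using in_atomD [OF n j(2,3,1)] e i by blast+
      then show ?thesis using ne j by simp
    next
      case (2 t)
      have "snd y i \<noteq> None" using state_act' [OF st e 2(1)] by simp
      then show ?thesis using in_A_painted [OF yA 2] i by (simp add: snd_paint)
    next
      case (3 t)
      obtain j where j: "j \<in> L" "fib y t = {j, n}" "lonely L F n y = {j, n}"
        by (rule in_A_F [OF yA 3(2,1)])
      have yi: "snd y i = Some t" using fixed_act [OF F st e 3(2)] 3(1) by simp
      then have ij: "i = j" using j(2) i by (auto simp: fib_def)
      have "isolate N {i, n} y = bot_state N" using yA j ij by (simp add: detach_def)
      then have b: "\<And>a h b. \<lbrakk>(a, h, b) \<in> fst y; a \<notin> {i, n}; b \<notin> {i, n}\<rbrakk> \<Longrightarrow> b = a \<and> h = \<one>" "dom (snd y) \<subseteq> {i, n}"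
        using isolate_eq_bot_iff [OF st, of "{i, n}"] by blast+
      have "a = i" if "snd (restr (N - {n}) y) a = Some u" for a u
      proof -
        have "a \<noteq> n" "a \<in> dom (snd y)" using that by (auto simp: snd_restr split: if_splits)
        then show ?thesis using b(2) by blast
      qed
      then have "dom (snd (restr (N - {n}) y)) \<subseteq> {i}" by auto
      then have "isolate (N - {n}) {i} (restr (N - {n}) y) = bot_state (N - {n})"
        unfolding isolate_eq_bot_iff [OF sr] using b(1) by (auto simp: in_restr)
      then show ?thesis using iso ij j(1) yi 3(2) iN by (auto simp: snd_restr)
    qed
  next
    assume r: "i \<in> L \<and> restr (N - {n} - {i}) (restr (N - {n}) y) = bot_state (N - {n} - {i}) \<and>
      (\<exists>s\<in>F. snd (restr (N - {n}) y) i = Some s)"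
    then obtain s where s: "s \<in> F" "snd y i = Some s" using iN by (auto simp: snd_restr)
    have "isolate (N - {n}) {i} (restr (N - {n}) y) = bot_state (N - {n})" using iso r by blast
    then have b: "\<And>a h b. \<lbrakk>(a, h, b) \<in> fst (restr (N - {n}) y); a \<noteq> i; b \<noteq> i\<rbrakk> \<Longrightarrow> b = a \<and> h = \<one>"
        "dom (snd (restr (N - {n}) y)) \<subseteq> {i}"
      using isolate_eq_bot_iff [OF sr, of "{i}"] by blast+
    have d: "dom (snd y) \<subseteq> {i, n}"
    proof
      fix a assume "a \<in> dom (snd y)"
      then obtain t where t: "snd y a = Some t" by blast
      then have "a \<noteq> n \<Longrightarrow> a \<in> dom (snd (restr (N - {n}) y))"
        using state_colour [OF st t] by (simp add: snd_restr dom_def)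
      then show "a \<in> {i, n}" using b(2) by blast
    qed
    then have "fib y s \<subseteq> {i, n}" by (auto simp: fib_def)
    then have il: "i \<in> lonely L F n y" using r s by (auto simp: lonely_def)
    have "isolate N (lonely L F n y) y = bot_state N"
      unfolding isolate_eq_bot_iff [OF st]
    proof (intro conjI allI impI)
      fix a h b' assume a: "(a, h, b') \<in> fst y" "a \<notin> lonely L F n y" "b' \<notin> lonely L F n y"
      then have "a \<noteq> i" "b' \<noteq> i" "a \<noteq> n" "b' \<noteq> n" using il n_lonely [of y] by metis+
      moreover have "(a, h, b') \<in> fst (restr (N - {n}) y)"
        using a(1) state_rel [OF st a(1)] calculation by (simp add: in_restr)
      ultimately show "b' = a" "h = \<one>" using b(1) by blast+
    next
      show "dom (snd y) \<subseteq> lonely L F n y" using d il n_lonely [of y] by blast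
    qed
    then show "y \<in> \<A>" using y by (simp add: detach_def)
  qed
qed

subsection \<open>The contractible part\<close>

text \<open>Here \<open>x \<ge> detach x \<le> a \<squnion> detach x \<ge> a\<close> for the atom \<open>a\<close>, and \<open>attach\<close> computes the join with \<open>a\<close>.\<close>

lemma collapses_detachable:
  assumes p: "p \<in> N" "p \<noteq> n" and fin: "finite \<P>"
  shows "collapses (order_complex (insert (atom N n \<one> p) (\<P> - \<A>)) (\<sqsubseteq>)) {{atom N n \<one> p}}"
proof -
  let ?a = "atom N n \<one> p"
  note np = n p one_closed
  let ?R = "insert ?a (\<P> - \<A>)"
  define J where "J = {x \<in> \<P>. single n x}"
  define U where "U = {x \<in> ?R. ?a \<sqsubseteq> x}"
  have aP: "?a \<in> \<P>" using atom_in_A [OF one_closed p] by blast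
  have RP: "x \<in> \<P>" if "x \<in> ?R" for x using that aP by blast
  have finR: "finite ?R" using fin by simp
  have rel: "(n, \<one>, p) \<in> fst x" if "x \<in> U" for x
    using that RP [of x] atom_le_iff [OF np, of x] prunedD famD unfolding U_def by blast
  have J: "y \<in> fam N L F" "y \<noteq> bot_state N" "single n y" if "y \<in> J" for y
  proof -
    have "y \<in> \<P>" "single n y" using that by (simp_all add: J_def)
    then show "y \<in> fam N L F" "y \<noteq> bot_state N" "single n y" using prunedD by blast+
  qed
  \<comment> \<open>A state with \<open>n\<close> single below \<open>x\<close> lies below
    \<open>detach x\<close>, so a nonbottom one keeps \<open>x\<close> out of \<open>\<A>\<close>.
    This applies to the elements of \<open>J\<close> and to their joins with the atom.\<close>
  have not_bot: "detach N L F n x \<noteq> bot_state N" if "y \<in> J" "x \<in> fam N L F" "y \<sqsubseteq> x" for x y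
  proof
    assume "detach N L F n x = bot_state N"
    moreover note y = J [OF that(1)]
    ultimately have "y \<sqsubseteq> bot_state N" using detach_greatest [OF that(2) y(1,3) that(3)] by simp
    then show False using y bot_le [OF famD(1)] state_le_antisym by blast
  qed
  have JR: "J \<subseteq> ?R" using not_bot prunedD unfolding J_def by fastforce
  have "collapses (order_complex ?R (\<sqsubseteq>)) (order_complex (J \<union> U) (\<sqsubseteq>))"
  proof (rule collapses_coreflection [where f = "detach N L F n"])
    show "J \<union> U \<subseteq> ?R" using JR by (auto simp: U_def)
    fix x assume x: "x \<in> ?R - (J \<union> U)"
    then have xP: "x \<in> \<P>" "detach N L F n x \<noteq> bot_state N" by (auto simp: U_def)
    have xf: "x \<in> fam N L F" by (rule prunedD(1) [OF xP(1)])
    have "snd (detach N L F n x) n = None" using single_detach by (auto simp: single_def)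
    then have "detach N L F n x \<in> \<P>" using detach_fam [OF xf] xP by (auto simp: pruned_def nonbot_def)
    then show "detach N L F n x \<in> J \<union> U \<and> detach N L F n x \<sqsubseteq> x"
      using single_detach detach_le [OF xf] by (simp add: J_def)
    fix y assume y: "y \<in> J \<union> U" "y \<sqsubseteq> x"
    \<comment> \<open>\<open>U\<close> is an upper set, so only elements of \<open>J\<close> lie
      below \<open>x\<close>.\<close>
    have "y \<notin> U" using x y state_le_trans unfolding U_def by blast
    then have "y \<in> J" using y by blast
    then show "y \<sqsubseteq> detach N L F n x"
      using detach_greatest [OF xf _ _ y(2)] prunedD(1) [of y N L F n] by (simp add: J_def)
  next
    show "x = y" if "x \<sqsubseteq> y" "y \<sqsubseteq> x" for x y :: "('a, 's) state" by (rule state_le_antisym [OF that])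
    show "x \<sqsubseteq> z" if "x \<sqsubseteq> y" "y \<sqsubseteq> z" for x y z :: "('a, 's) state" by (rule state_le_trans [OF that])
  qed (use finR in auto)
  \<comment> \<open>Joining with the atom moves upwards, hence the converse order.\<close>
  moreover have "collapses (order_complex (J \<union> U) (\<lambda>x y. y \<sqsubseteq> x)) (order_complex U (\<lambda>x y. y \<sqsubseteq> x))"
  proof (rule collapses_coreflection [where f = "attach N n \<one> p"])
    show "finite (J \<union> U)" by (rule finite_subset [OF _ finR]) (use JR in \<open>auto simp: U_def\<close>)
    fix x assume "x \<in> J \<union> U - U"
    then have x: "x \<in> J" by blast
    note xf = J [OF x]
    have st: "state N x" by (rule famD(1) [OF xf(1)])
    let ?x = "attach N n \<one> p x"
    have sx: "state N ?x" by (rule state_attach [OF st]) (use p in auto)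
    have e: "(n, \<one>, p) \<in> fst ?x" by (rule attach_rel [OF st]) (use p n in auto)
    have le: "x \<sqsubseteq> ?x" by (rule le_attach [OF st xf(3) p n one_closed])
    have rs: "state (N - {n}) (restr (N - {n}) x)" by (rule state_restr [OF st]) blast
    have "restr (N - {n}) ?x = restr (N - {n}) x"
      using restr_attach [OF rs p, of \<one>] attach_restr_eq [OF p, of \<one> x] by simp
    moreover have "fib (restr (N - {n}) x) s = fib x s" for s
      using xf(3) state_colour [OF st] by (auto simp: fib_def snd_restr single_def split: if_splits)
    then have "restr (N - {n}) x \<in> fam (N - {n}) (L - {p}) F"
      using xf(1) rs by (simp add: fam_def)
    ultimately have f: "?x \<in> fam N L F" using fam_attach_iff [OF F sx e p(2)] by simp
    moreover have "?x \<noteq> bot_state N" using e p by auto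
    ultimately have xP: "?x \<in> \<P>" using above_atom_pruned [OF _ e p(2)] by (simp add: nonbot_def)
    have "detach N L F n ?x \<noteq> bot_state N" by (rule not_bot [OF x f le])
    then show "?x \<in> U \<and> x \<sqsubseteq> ?x"
      using xP le atom_le_iff [OF np sx] e by (simp add: U_def)
    fix y assume y: "y \<in> U" "x \<sqsubseteq> y"
    have "y \<in> ?R" using y(1) by (simp add: U_def)
    then have "state N y" by (rule famD(1) [OF prunedD(1) [OF RP]])
    then have "attach N n \<one> p y = y" by (rule attach_id [OF _ rel [OF y(1)] p(2)])
    then show "?x \<sqsubseteq> y" using attach_mono [OF y(2), of N n \<one> p] by simp
  next
    show "x = y" if "y \<sqsubseteq> x" "x \<sqsubseteq> y" for x y :: "('a, 's) state" by (rule state_le_antisym [OF that(2,1)])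
    show "z \<sqsubseteq> x" if "y \<sqsubseteq> x" "z \<sqsubseteq> y" for x y z :: "('a, 's) state" by (rule state_le_trans [OF that(2,1)])
  qed auto
  then have "collapses (order_complex (J \<union> U) (\<sqsubseteq>)) (order_complex U (\<sqsubseteq>))"
    by (simp only: order_complex_converse [of _ "(\<sqsubseteq>)"])
  moreover have "collapses (order_complex U (\<sqsubseteq>)) {{?a}}"
  proof (rule collapses_order_complex_cone)
    show "finite U" by (rule finite_subset [OF _ finR]) (auto simp: U_def)
    show "?a \<in> U" by (simp add: U_def)
    show "?a \<sqsubseteq> y \<or> y \<sqsubseteq> ?a" if "y \<in> U" for y using that by (simp add: U_def)
  qed
  ultimately show ?thesis using collapses_trans by blast
qed

text \<open>
  The order in which vertices are added to the contractible part \<open>R0\<close> matters. First comes one atom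
  for each other point (\<open>B1\<close>); then the link of a state in \<open>B2\<close> is a cone whose apex is such an atom;
  the minimal states in \<open>B3\<close> come last, so that their links are full intervals.
\<close>

lemma spherical_pruned_step:
  assumes p: "p \<in> N" "p \<noteq> n" and finN: "finite N" and fin: "finite \<P>"
    and k: "Suc k = card N - (if S = {} then 1 else 0)"
    and full: "\<And>i. \<lbrakk>i \<in> N; i \<noteq> n\<rbrakk> \<Longrightarrow> spherical k (order_complex (nonbot (N - {n}) (L - {i}) F) (\<sqsubseteq>))"
    and part: "\<And>i. \<lbrakk>i \<in> N; i \<noteq> n; i \<noteq> p\<rbrakk> \<Longrightarrow> spherical k (order_complex (pruned (N - {n}) (L - {i}) F i) (\<sqsubseteq>))"
    and painted: "\<And>t. \<lbrakk>t \<in> S; t \<notin> F\<rbrakk> \<Longrightarrow> spherical k (order_complex (nonbot (N - {n}) L F) (\<sqsubseteq>))"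
  shows "spherical (Suc k) (order_complex \<P> (\<sqsubseteq>))"
proof -
  let ?a = "atom N n \<one>"
  have bound: "card C \<le> Suc k" if "C \<in> order_complex Q (\<sqsubseteq>)" "Q \<subseteq> \<P>" for C Q
    unfolding k by (rule card_chain_le [OF finN _ that(1)]) (use n that(2) prunedD famD in blast)+
  have aA: "?a i \<in> \<A>" and an: "snd (?a i) n = None" if "i \<in> N" "i \<noteq> n" for i
    using atom_in_A [OF one_closed that] snd_atom [OF n that one_closed] by auto
  have a_inj: "i = j" if "i \<in> N" "i \<noteq> n" "j \<in> N" "j \<noteq> n" "?a i = ?a j" for i j
    using in_atomD(1) [OF n that(3,4) one_closed, of \<one> i] atom_rel [OF n that(1,2) one_closed] that by simp
  define R0 where "R0 = insert (?a p) (\<P> - \<A>)"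
  define B1 where "B1 = ?a ` (N - {n, p})"
  define B2 where "B2 = {x \<in> \<A>. \<exists>s\<in>F. snd x n = Some s}"
  define B3 where "B3 = \<P> - (R0 \<union> B1 \<union> B2)"
  have sub: "R0 \<subseteq> \<P>" "B1 \<subseteq> \<P>" "B2 \<subseteq> \<P>" "B3 \<subseteq> \<P>" using aA p by (auto simp: R0_def B1_def B2_def B3_def)
  have finB: "finite R0" "finite B1" "finite B2" "finite B3" using sub fin finite_subset by blast+
  have "spherical (Suc k) (order_complex R0 (\<sqsubseteq>))"
    by (rule spherical_if_collapses [OF collapses_detachable [OF p fin, folded R0_def] bound [OF _ sub(1)]])
  then have 1: "spherical (Suc k) (order_complex (R0 \<union> B1) (\<sqsubseteq>))"
  proof (rule spherical_add_vertices [rotated 3])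
    have "B1 \<subseteq> \<A>" using aA by (auto simp: B1_def)
    moreover have "?a p \<notin> B1" using a_inj [OF p] by (auto simp: B1_def)
    ultimately show "R0 \<inter> B1 = {}" by (auto simp: R0_def)
    fix x Q assume x: "x \<in> B1" and Q: "R0 \<subseteq> Q" "Q \<subseteq> R0 \<union> B1 - {x}"
    obtain i where i: "i \<in> N" "i \<noteq> n" "i \<noteq> p" and xi: "x = ?a i" using x by (auto simp: B1_def)
    note ni = n i(1,2) one_closed
    have low: "w = ?a j" if "w \<in> \<P>" "w \<sqsubseteq> ?a j" "j \<in> N" "j \<noteq> n" for w j
      by (rule A_minimal [OF that(1) aA [OF that(3,4)] that(2)]) (simp add: an [OF that(3,4)])
    have xP: "x \<in> \<P>" using sub x by blast
    let ?l = "{y \<in> Q. x \<sqsubseteq> y \<or> y \<sqsubseteq> x}"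
    \<comment> \<open>No two of these atoms are comparable, so the atoms added before do not occur
      in the link; it consists of the elements outside \<open>\<A>\<close> above
      \<open>?a i\<close>.\<close>
    have l: "?l = {y \<in> \<P> - \<A>. ?a i \<sqsubseteq> y}"
    proof (intro equalityI subsetI)
      fix y assume y: "y \<in> ?l"
      then have yP: "y \<in> \<P>" "y \<noteq> x" using Q sub by blast+
      have "\<not> y \<sqsubseteq> x" using low [OF yP(1), of i] i xi yP(2) by blast
      then have le: "x \<sqsubseteq> y" using y by blast
      have "y \<noteq> ?a j" if "j \<in> N" "j \<noteq> n" for j
        using low [OF xP, of j] le that yP(2) by blast
      then have "y \<in> \<P> - \<A>" using y Q(2) p unfolding R0_def B1_def by blast
      then show "y \<in> {y \<in> \<P> - \<A>. ?a i \<sqsubseteq> y}" using le xi by simp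
    next
      fix y assume "y \<in> {y \<in> \<P> - \<A>. ?a i \<sqsubseteq> y}"
      then show "y \<in> ?l" using Q(1) xi by (auto simp: R0_def)
    qed
    have ra: "y \<in> nonbot N L F \<Longrightarrow> ?a i \<sqsubseteq> y \<Longrightarrow> y \<in> \<P>" for y
      using above_atom_pruned [of y \<one> i] atom_le_iff [OF ni, of y] i by (auto simp: nonbot_def fam_def)
    \<comment> \<open>For light \<open>i\<close> the states colouring just \<open>{i, n}\<close> by
      \<open>F\<close> are not there yet, and the link is a pruned poset; otherwise such states do
      not belong to \<open>\<A>\<close>, and the link is a full interval.\<close>
    show "spherical k (order_complex ?l (\<sqsubseteq>))"
    proof (cases "i \<in> L")
      case True
      let ?R = "\<lambda>y. \<not> (restr (N - {n} - {i}) y = bot_state (N - {n} - {i}) \<and> (\<exists>s\<in>F. snd y i = Some s))"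
      have "spherical k (order_complex {y \<in> nonbot (N - {n}) (L - {i}) F. ?R y} (\<sqsubseteq>))"
        using part [OF i] by (simp only: pruned_def)
      moreover have "?l = {y \<in> nonbot N L F. ?a i \<sqsubseteq> y \<and> y \<noteq> ?a i \<and> ?R (restr (N - {n}) y)}"
        unfolding l
      proof (intro equalityI subsetI)
        fix y assume y: "y \<in> {y \<in> \<P> - \<A>. ?a i \<sqsubseteq> y}"
        then have "y \<noteq> ?a i" using aA [OF i(1,2)] by blast
        then show "y \<in> {y \<in> nonbot N L F. ?a i \<sqsubseteq> y \<and> y \<noteq> ?a i \<and> ?R (restr (N - {n}) y)}"
          using above_unit_atom_in_A_iff [OF i(1,2), of y] y True by (auto simp: pruned_def)
      next
        fix y assume y: "y \<in> {y \<in> nonbot N L F. ?a i \<sqsubseteq> y \<and> y \<noteq> ?a i \<and> ?R (restr (N - {n}) y)}"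
        then show "y \<in> {y \<in> \<P> - \<A>. ?a i \<sqsubseteq> y}"
          using above_unit_atom_in_A_iff [OF i(1,2), of y] ra [of y] by blast
      qed
      ultimately show ?thesis by (rule spherical_above_atom [OF one_closed i(1,2)])
    next
      case False
      have "spherical k (order_complex {y \<in> nonbot (N - {n}) (L - {i}) F. True} (\<sqsubseteq>))"
        using full [OF i(1,2)] by simp
      moreover have "?l = {y \<in> nonbot N L F. ?a i \<sqsubseteq> y \<and> y \<noteq> ?a i \<and> True}"
        unfolding l
      proof (intro equalityI subsetI)
        fix y assume y: "y \<in> {y \<in> \<P> - \<A>. ?a i \<sqsubseteq> y}"
        then have "y \<noteq> ?a i" using aA [OF i(1,2)] by blast
        then show "y \<in> {y \<in> nonbot N L F. ?a i \<sqsubseteq> y \<and> y \<noteq> ?a i \<and> True}"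
          using y by (auto simp: pruned_def)
      next
        fix y assume y: "y \<in> {y \<in> nonbot N L F. ?a i \<sqsubseteq> y \<and> y \<noteq> ?a i \<and> True}"
        then show "y \<in> {y \<in> \<P> - \<A>. ?a i \<sqsubseteq> y}"
          using above_unit_atom_in_A_iff [OF i(1,2), of y] ra [of y] False by blast
      qed
      ultimately show ?thesis by (rule spherical_above_atom [OF one_closed i(1,2)])
    qed
  qed (use finB in auto)
  have 2: "spherical (Suc k) (order_complex (R0 \<union> B1 \<union> B2) (\<sqsubseteq>))"
  proof (rule spherical_add_cone_vertices [OF finB(3)])
    show "spherical (Suc k) (order_complex (R0 \<union> B1) (\<sqsubseteq>))" by (rule 1)
    show "(R0 \<union> B1) \<inter> B2 = {}" using an p by (auto simp: R0_def B1_def B2_def)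
    show "card C \<le> Suc k" if "C \<in> order_complex (R0 \<union> B1 \<union> B2) (\<sqsubseteq>)" for C
      by (rule bound [OF that]) (use sub in blast)
    fix x assume "x \<in> B2"
    then obtain s where xA: "x \<in> \<A>" and s: "s \<in> F" "snd x n = Some s" by (auto simp: B2_def)
    have xf: "x \<in> fam N L F" using xA prunedD by blast
    obtain i where i: "i \<in> L" "i \<in> N" "i \<noteq> n" "fib x s = {i, n}" "(n, \<one>, i) \<in> fst x" by (rule in_A_F [OF xA s])
    note ni = n i(2,3) one_closed
    have ax: "?a i \<sqsubseteq> x" using atom_le_iff [OF ni famD(1) [OF xf]] i by simp
    have eq_i: "j = i" if "j \<noteq> n" "snd x j = Some s" for j using that i(4) by (auto simp: fib_def)
    \<comment> \<open>An element below \<open>x\<close> that is present by now relates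
      \<open>n\<close> by the identity to some other point \<open>j\<close>. Then \<open>j\<close>
      has the colour of \<open>n\<close> in \<open>x\<close>, and \<open>i\<close> is the only such
      point.\<close>
    have cone: "?a i \<sqsubseteq> y" if y: "y \<in> R0 \<union> B1 \<union> B2" and c: "x \<sqsubseteq> y \<or> y \<sqsubseteq> x" for y
    proof (cases "x \<sqsubseteq> y")
      case False
      then have le: "y \<sqsubseteq> x" using c by blast
      have yP: "y \<in> \<P>" using y sub by blast
      have yf: "y \<in> fam N L F" by (rule prunedD(1) [OF yP])
      have "detach N L F n y \<sqsubseteq> bot_state N" using detach_mono [OF xf yf le] xA by simp
      then have yA: "y \<in> \<A>" using yP bot_le [OF famD(1) [OF detach_fam [OF yf]]] state_le_antisym by blast
      have "(\<exists>j\<in>N - {n}. y = ?a j) \<or> y \<in> B2" using y yA p unfolding R0_def B1_def by blast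
      then have "\<exists>j\<in>N - {n}. (n, \<one>, j) \<in> fst y"
      proof
        assume "y \<in> B2"
        then obtain t where t: "t \<in> F" "snd y n = Some t" by (auto simp: B2_def)
        obtain j where "j \<in> N" "j \<noteq> n" "(n, \<one>, j) \<in> fst y" by (rule in_A_F [OF yA t])
        then show ?thesis by blast
      qed (use atom_rel [OF n _ _ one_closed] in auto)
      then obtain j where j: "j \<in> N" "j \<noteq> n" "(n, \<one>, j) \<in> fst y" by blast
      have "snd x j = Some s" using fixed_act [OF F famD(1) [OF xf] state_leD(1) [OF le j(3)] s(1)] s(2) by simp
      then have "j = i" using eq_i j by blast
      then show ?thesis using atom_le_iff [OF ni famD(1) [OF yf]] j by simp
    qed (use ax state_le_trans in blast)
    have "?a i \<in> R0 \<union> B1" using i by (auto simp: R0_def B1_def)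
    then show "\<exists>a\<in>R0 \<union> B1. (x \<sqsubseteq> a \<or> a \<sqsubseteq> x) \<and> (\<forall>y\<in>R0 \<union> B1 \<union> B2. x \<sqsubseteq> y \<or> y \<sqsubseteq> x \<longrightarrow> a \<sqsubseteq> y \<or> y \<sqsubseteq> a)"
      using ax cone by blast
  qed (use finB in auto)
  have "spherical (Suc k) (order_complex (R0 \<union> B1 \<union> B2 \<union> B3) (\<sqsubseteq>))"
  proof (rule spherical_add_vertices [OF finB(4) _ _ 2])
    show "(R0 \<union> B1 \<union> B2) \<inter> B3 = {}" by (auto simp: B3_def)
    have B3: "x \<in> \<A>" "\<And>s. s \<in> F \<Longrightarrow> snd x n \<noteq> Some s" if "x \<in> B3" for x
      using that by (auto simp: B3_def B2_def R0_def)
    fix x Q assume x: "x \<in> B3" and Q: "R0 \<union> B1 \<union> B2 \<subseteq> Q" "Q \<subseteq> R0 \<union> B1 \<union> B2 \<union> B3 - {x}"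
    have QP: "Q \<subseteq> \<P>" using Q(2) sub by blast
    have xP: "x \<in> \<P>" using x sub by blast
    \<comment> \<open>\<open>x\<close> is minimal and no other element of \<open>B3\<close> lies
      above it, so the link is the whole interval above \<open>x\<close>, whatever part of
      \<open>B3\<close> has been added.\<close>
    have l: "{y \<in> Q. x \<sqsubseteq> y \<or> y \<sqsubseteq> x} = {y \<in> \<P>. x \<sqsubseteq> y \<and> y \<noteq> x}"
    proof (intro equalityI subsetI)
      fix y assume y: "y \<in> {y \<in> Q. x \<sqsubseteq> y \<or> y \<sqsubseteq> x}"
      then have "y \<noteq> x" "y \<in> \<P>" using Q(2) QP by blast+
      then have "\<not> y \<sqsubseteq> x" using A_minimal [OF _ B3(1) [OF x]] B3(2) [OF x] by blast
      then show "y \<in> {y \<in> \<P>. x \<sqsubseteq> y \<and> y \<noteq> x}" using y \<open>y \<noteq> x\<close> \<open>y \<in> \<P>\<close> by blast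
    next
      fix y assume y: "y \<in> {y \<in> \<P>. x \<sqsubseteq> y \<and> y \<noteq> x}"
      then have "y \<notin> B3" using A_minimal [OF xP B3(1), of y] B3(2) by blast
      then show "y \<in> {y \<in> Q. x \<sqsubseteq> y \<or> y \<sqsubseteq> x}" using y Q(1) by (auto simp: B3_def)
    qed
    show "spherical k (order_complex {y \<in> Q. x \<sqsubseteq> y \<or> y \<sqsubseteq> x} (\<sqsubseteq>))"
    proof (cases "snd x n")
      case None
      obtain g i where i: "g \<in> carrier G" "i \<in> N" "i \<noteq> n" "x = atom N n g i"
        by (rule in_A_uncoloured [OF B3(1) [OF x] None])
      have "y \<in> \<P>" if "y \<in> nonbot N L F" "x \<sqsubseteq> y" for y
        using above_atom_pruned [OF that(1), of g i] atom_le_iff [OF n i(2,3,1), of y] i that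
        by (auto simp: nonbot_def fam_def)
      then have "{y \<in> \<P>. x \<sqsubseteq> y \<and> y \<noteq> x} = {y \<in> nonbot N L F. x \<sqsubseteq> y \<and> y \<noteq> x \<and> True}"
        by (auto simp: pruned_def)
      then have "{y \<in> Q. x \<sqsubseteq> y \<or> y \<sqsubseteq> x} = {y \<in> nonbot N L F. atom N n g i \<sqsubseteq> y \<and> y \<noteq> atom N n g i \<and> True}"
        unfolding l i(4) [symmetric] by simp
      then show ?thesis
        by (rule spherical_above_atom [OF i(1-3), where R = "\<lambda>_. True", rotated]) (use full i in simp)
    next
      case (Some t)
      then have t: "t \<in> S" "t \<notin> F"
        using B3(2) [OF x] state_colour [OF famD(1) [OF prunedD(1) [OF xP]]] by blast+
      have "y \<in> \<P>" if "y \<in> nonbot N L F" "x \<sqsubseteq> y" for y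
        using that state_leD(2) [OF that(2) Some] t by (auto simp: pruned_def)
      then have "{y \<in> \<P>. x \<sqsubseteq> y \<and> y \<noteq> x} = {y \<in> nonbot N L F. x \<sqsubseteq> y \<and> y \<noteq> x}"
        by (auto simp: pruned_def)
      then show ?thesis
        unfolding l by (rule spherical_above_painted [OF t painted [OF t] in_A_painted [OF B3(1) [OF x] Some t(2)]])
    qed
  qed auto
  moreover have "R0 \<union> B1 \<union> B2 \<union> B3 = \<P>" using sub by (auto simp: B3_def)
  ultimately show ?thesis by simp
qed

end

section \<open>Induction on the number of points\<close>

lemma nonbot_eq_pruned:
  assumes "n \<in> L"
  shows "nonbot N L F = pruned N L F n"
proof -
  have False if x: "x \<in> fam N L F" and r: "restr (N - {n}) x = bot_state (N - {n})"
    and s: "s \<in> F" "snd x n = Some s" for x s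
  proof -
    have n: "n \<in> N" by (rule state_colour(1) [OF famD(1) [OF x] s(2)])
    have "dom (snd x) \<subseteq> {n}"
      using isolate_eq_bot_iff [OF famD(1) [OF x], of "{n}"] isolate_bot_iff_restr [OF famD(1) [OF x] n] r by blast
    \<comment> \<open>\<open>n\<close> would be a light point alone with a colour in
      \<open>F\<close>, which \<open>fam\<close> excludes; so pruning at a light point removes
      nothing.\<close>
    then have "fib x s = {n}" using s by (auto simp: fib_def)
    then show False using famD(2) [OF x s(1) assms] by blast
  qed
  then show ?thesis by (auto simp: pruned_def nonbot_def)
qed

lemma fam_cong: "L \<inter> N = L' \<inter> N \<Longrightarrow> fam N L F = fam N L' F"
proof -
  have "i \<in> N" if "state N x" "fib x s = {i}" for x s i
    using that state_colour [OF that(1)] by (auto simp: fib_def)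
  then show "L \<inter> N = L' \<inter> N \<Longrightarrow> fam N L F = fam N L' F" unfolding fam_def by blast
qed

text \<open>Pruning at a light point removes nothing. If there is no light point, \<open>F\<close>
  imposes no condition and may be replaced by the empty set; then pruning is void, and the side
  condition on \<open>S - F\<close> is trivially true.\<close>

lemma spherical_nonbot_if_pruned:
  assumes N: "N \<noteq> {}" and F: "fixed_points F"
    and IH: "\<And>L F n. \<lbrakk>n \<in> N; fixed_points F; 2 \<le> card N \<or> S - F \<noteq> {} \<or> S = {}\<rbrakk> \<Longrightarrow>
        spherical k (order_complex (pruned N L F n) (\<sqsubseteq>))"
    and c: "2 \<le> card N \<or> S - F \<noteq> {} \<or> S = {} \<or> L \<inter> N = {}"
  shows "spherical k (order_complex (nonbot N L F) (\<sqsubseteq>))"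
proof (cases "L \<inter> N = {}")
  case True
  obtain n where n: "n \<in> N" using N by blast
  have "fam N L F = fam N {} {}" using fam_cong [of L N "{}" F] True by (simp add: fam_def)
  then have "nonbot N L F = pruned N {} {} n" by (auto simp: nonbot_def pruned_def)
  then show ?thesis using IH [OF n, of "{}" "{}"] by (auto simp: fixed_points_def)
next
  case False
  then obtain n where "n \<in> L" "n \<in> N" by blast
  then show ?thesis using nonbot_eq_pruned [of n L N F] IH [of n F L] F c False by simp
qed

text \<open>The last hypothesis excludes a single point all of whose colours lie in
  \<open>F\<close>: its pruned poset is empty, while the index would be 1.\<close>

theorem spherical_pruned:
  assumes "finite S" "finite (carrier G)" "finite N"
    and "n \<in> N" "fixed_points F" "2 \<le> card N \<or> S - F \<noteq> {} \<or> S = {}"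
  shows "spherical (card N - (if S = {} then 1 else 0)) (order_complex (pruned N L F n) (\<sqsubseteq>))"
  using assms(3-6)
proof (induction "card N" arbitrary: N L F n)
  case 0
  then show ?case by auto
next
  case (Suc m)
  have finp: "finite (pruned N L F n)"
    by (rule finite_subset [OF _ finite_states [OF Suc.prems(1) assms(1,2)]]) (auto simp: pruned_def nonbot_def fam_def)
  show ?case
  proof (cases "N = {n}")
    case True
    \<comment> \<open>On a single point a nonbottom state is just a colour, and the colours in
      \<open>F\<close> are pruned; so the poset is an antichain.\<close>
    have fix_x: "\<exists>t\<in>S - F. snd x n = Some t \<and> x = paint n t (bot_state {})" if x: "x \<in> pruned N L F n" for x
    proof -
      have st: "state {n} x" using x True by (auto simp: pruned_def nonbot_def fam_def)
      have r: "restr (N - {n}) x = bot_state (N - {n})"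
        using True by (intro state_eqI) (auto simp: in_restr snd_restr)
      have "snd x n \<noteq> None"
      proof
        assume none: "snd x n = None"
        have "x = bot_state {n}"
        proof (rule state_eqI)
          show "(i, g, j) \<in> fst x \<longleftrightarrow> (i, g, j) \<in> fst (bot_state {n})" for i g j
            using state_rel [OF st, of i g j] state_free [OF st, of n g] state_one [OF st, of n] none by auto
          show "snd x i = snd (bot_state {n}) i" for i
            using state_colour [OF st, of i] none by (cases "snd x i") auto
        qed
        then show False using x True by (auto simp: pruned_def nonbot_def)
      qed
      then obtain t where t: "snd x n = Some t" by blast
      then have "t \<in> S - F" using state_colour [OF st t] x r by (auto simp: pruned_def)
      then show ?thesis using paint_restr [OF st t] t r True by (metis Diff_cancel)
    qed
    show ?thesis
    proof (cases "S = {}")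
      case True
      then have "pruned N L F n = {}" using fix_x by auto
      then show ?thesis using True \<open>N = {n}\<close> by (auto simp: spherical_def in_order_complex)
    next
      case False
      then obtain t where t: "t \<in> S" "t \<notin> F" using Suc.prems(4) True by auto
      let ?c = "\<lambda>t. paint n t (bot_state {})"
      have c: "?c t \<in> pruned N L F n" if "t \<in> S" "t \<notin> F" for t
      proof -
        have "state N (?c t)" by (rule state_paint) (use True that state_bot in auto)
        then have "?c t \<in> fam N L F" using that True by (auto simp: fam_def fib_def snd_paint)
        moreover have "snd (?c t) n = Some t" by (simp add: snd_paint)
        moreover have "?c t \<noteq> bot_state N" using calculation(2) by auto
        ultimately show ?thesis using that by (auto simp: pruned_def nonbot_def)
      qed
      have eq: "x = y" if "x \<in> pruned N L F n" "y \<in> pruned N L F n" "x \<sqsubseteq> y" for x y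
        using fix_x [OF that(1)] fix_x [OF that(2)] state_leD(2) [OF that(3), of n] by fastforce
      let ?B = "pruned N L F n - {?c t}"
      \<comment> \<open>All points but \<open>?c t\<close> are added with empty link, that is, as
        top-dimensional cells.\<close>
      have "spherical (Suc 0) (order_complex ({?c t} \<union> ?B) (\<sqsubseteq>))"
      proof (rule spherical_add_vertices)
        show "spherical (Suc 0) (order_complex {?c t} (\<sqsubseteq>))"
        proof (rule spherical_if_collapses)
          show "collapses (order_complex {?c t} (\<sqsubseteq>)) {{?c t}}"
            by (rule collapses_order_complex_cone) auto
          fix C assume "C \<in> order_complex {?c t} (\<sqsubseteq>)"
          then have "C \<subseteq> {?c t}" by (simp add: in_order_complex)
          then show "card C \<le> Suc 0" using card_mono [of "{?c t}" C] by simp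
        qed
        fix x P assume x: "x \<in> ?B" and P: "{?c t} \<subseteq> P" "P \<subseteq> {?c t} \<union> ?B - {x}"
        then have "{y \<in> P. x \<sqsubseteq> y \<or> y \<sqsubseteq> x} = {}" using eq c [OF t] by blast
        then have "order_complex {y \<in> P. x \<sqsubseteq> y \<or> y \<sqsubseteq> x} (\<sqsubseteq>) = {}" unfolding order_complex_def by auto
        then show "spherical 0 (order_complex {y \<in> P. x \<sqsubseteq> y \<or> y \<sqsubseteq> x} (\<sqsubseteq>))" by (simp add: spherical_def)
      qed (use finp in auto)
      moreover have "{?c t} \<union> ?B = pruned N L F n" using c [OF t] by blast
      ultimately show ?thesis using False \<open>N = {n}\<close> by simp
    qed
  next
    case False
    then obtain p where p: "p \<in> N" "p \<noteq> n" using Suc.prems(2) by blast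
    let ?N = "N - {n}" and ?\<delta> = "if S = {} then 1 else 0 :: nat"
    have cN: "m = card ?N" using Suc.hyps(2) Suc.prems(1,2) by simp
    have finN: "finite ?N" "?N \<noteq> {}" using Suc.prems(1) p by auto
    have "1 \<le> card ?N" using finN by (simp add: Suc_le_eq card_gt_0_iff)
    \<comment> \<open>The truncated subtraction is harmless because a point other than
      \<open>n\<close> remains.\<close>
    then have k: "Suc (card ?N - ?\<delta>) = card N - ?\<delta>" using Suc.hyps(2) cN by auto
    have IH: "spherical (card ?N - ?\<delta>) (order_complex (pruned ?N L F i) (\<sqsubseteq>))"
      if "i \<in> ?N" "fixed_points F" "2 \<le> card ?N \<or> S - F \<noteq> {} \<or> S = {}" for L F i
      by (rule Suc.hyps(1) [OF cN finN(1) that])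
    have "spherical (Suc (card ?N - ?\<delta>)) (order_complex (pruned N L F n) (\<sqsubseteq>))"
    proof (rule spherical_pruned_step [OF Suc.prems(3,2) p Suc.prems(1) finp k])
      fix i assume i: "i \<in> N" "i \<noteq> n"
      \<comment> \<open>If \<open>i\<close> is the only remaining point, it is no longer light, so
        its colours in \<open>F\<close> are allowed.\<close>
      have "2 \<le> card ?N \<or> (L - {i}) \<inter> ?N = {}"
      proof (cases "?N = {i}")
        case False
        then have "{i} \<subset> ?N" using i by blast
        then have "card {i} < card ?N" by (rule psubset_card_mono [OF finN(1)])
        then show ?thesis by simp
      qed auto
      then show "spherical (card ?N - ?\<delta>) (order_complex (nonbot ?N (L - {i}) F) (\<sqsubseteq>))"
        by (intro spherical_nonbot_if_pruned [OF finN(2) Suc.prems(3) IH]) blast+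
    next
      fix i assume i: "i \<in> N" "i \<noteq> n" "i \<noteq> p"
      \<comment> \<open>The second point \<open>p\<close> keeps the side condition true; this uses
        that the atom at \<open>p\<close> is not among those of \<open>B1\<close>.\<close>
      have "card {i, p} \<le> card ?N" by (rule card_mono [OF finN(1)]) (use i p in auto)
      then show "spherical (card ?N - ?\<delta>) (order_complex (pruned ?N (L - {i}) F i) (\<sqsubseteq>))"
        by (intro IH Suc.prems(3)) (use i in auto)
    next
      fix t assume "t \<in> S" "t \<notin> F"
      then show "spherical (card ?N - ?\<delta>) (order_complex (nonbot ?N L F) (\<sqsubseteq>))"
        by (intro spherical_nonbot_if_pruned [OF finN(2) Suc.prems(3) IH]) blast+
    qed
    then show ?thesis unfolding k .
  qed
qed

end

section \<open>Encoding the Dowling poset\<close>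

context dowling_action
begin

lemma rtranslate_Some: "rtranslate G b g i = Some k \<longleftrightarrow> (\<exists>h. b i = Some h \<and> k = h \<otimes> g)"
  by (auto simp: rtranslate_def)

lemma dom_rtranslate [simp]: "dom (rtranslate G b g) = dom b"
  by (auto simp: rtranslate_def dom_def)

lemma ran_rtranslate: "ran b \<subseteq> carrier G \<Longrightarrow> g \<in> carrier G \<Longrightarrow> ran (rtranslate G b g) \<subseteq> carrier G"
  by (auto simp: ran_def rtranslate_def)

lemma rtranslate_one: "ran b \<subseteq> carrier G \<Longrightarrow> rtranslate G b \<one> = b"
proof
  fix i assume "ran b \<subseteq> carrier G"
  then show "rtranslate G b \<one> i = b i" by (cases "b i") (auto simp: rtranslate_def ran_def)
qed

lemma rtranslate_rtranslate:
  assumes "ran b \<subseteq> carrier G" "g \<in> carrier G" "h \<in> carrier G"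
  shows "rtranslate G (rtranslate G b g) h = rtranslate G b (g \<otimes> h)"
proof
  fix i
  show "rtranslate G (rtranslate G b g) h i = rtranslate G b (g \<otimes> h) i"
    using assms by (cases "b i") (auto simp: rtranslate_def ran_def m_assoc)
qed

lemma gclassE:
  assumes "b' \<in> gclass G b"
  obtains g where "g \<in> carrier G" "b' = rtranslate G b g"
  using assms by (auto simp: gclass_def)

lemma gclass_self: "ran b \<subseteq> carrier G \<Longrightarrow> b \<in> gclass G b"
  unfolding gclass_def using rtranslate_one by force

lemma gclass_eq:
  assumes b: "ran b \<subseteq> carrier G" and b': "b' \<in> gclass G b"
  shows "gclass G b' = gclass G b"
proof -
  obtain g where g: "g \<in> carrier G" "b' = rtranslate G b g" using b' by (rule gclassE)
  show ?thesis
  proof (intro equalityI subsetI)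
    fix c assume "c \<in> gclass G b'"
    then obtain h where "h \<in> carrier G" "c = rtranslate G b' h" by (rule gclassE)
    then show "c \<in> gclass G b" using rtranslate_rtranslate [OF b g(1)] g by (auto simp: gclass_def)
  next
    fix c assume "c \<in> gclass G b"
    then obtain h where h: "h \<in> carrier G" "c = rtranslate G b h" by (rule gclassE)
    then have "c = rtranslate G b' (inv g \<otimes> h)"
      using rtranslate_rtranslate [OF b g(1), of "inv g \<otimes> h"] g by (simp add: m_assoc [symmetric])
    then show "c \<in> gclass G b'" using g h by (auto simp: gclass_def)
  qed
qed

lemma underlying_gclass: "underlying (gclass G b) = dom b"
proof -
  have "gclass G b = rtranslate G b ` carrier G" by (auto simp: gclass_def)
  then show ?thesis using one_closed by (auto simp: underlying_def simp del: domIff)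
qed

lemma gblocksD:
  assumes "B \<in> gblocks n G" "b \<in> B"
  shows "B = gclass G b" "dom b = underlying B" "dom b \<noteq> {}" "dom b \<subseteq> {1..n}" "ran b \<subseteq> carrier G"
proof -
  obtain b0 where b0: "B = gclass G b0" "dom b0 \<noteq> {}" "dom b0 \<subseteq> {1..n}" "ran b0 \<subseteq> carrier G"
    using assms(1) by (auto simp: gblocks_def)
  obtain g where g: "g \<in> carrier G" "b = rtranslate G b0 g" using assms(2) b0(1) by (auto elim: gclassE)
  show "B = gclass G b" using gclass_eq [OF b0(4), of b] assms(2) b0(1) by simp
  show "dom b = underlying B" using b0(1) g by (simp add: underlying_gclass)
  show "dom b \<noteq> {}" "dom b \<subseteq> {1..n}" "ran b \<subseteq> carrier G" using b0 g ran_rtranslate by auto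
qed

lemma gclass_in_gblocks: "\<lbrakk>dom b \<noteq> {}; dom b \<subseteq> {1..n}; ran b \<subseteq> carrier G\<rbrakk> \<Longrightarrow> gclass G b \<in> gblocks n G"
  by (auto simp: gblocks_def)

text \<open>The quotient of \<open>b i\<close> by \<open>b j\<close> does not change under right
  translation, so it depends only on the block.\<close>

definition block_rel :: "(nat \<rightharpoonup> 'a) set set \<Rightarrow> (nat \<times> 'a \<times> nat) set" where
  "block_rel \<beta> = {(i, g, j). g \<in> carrier G \<and> (\<exists>B\<in>\<beta>. \<exists>b\<in>B. \<exists>h. b j = Some h \<and> b i = Some (g \<otimes> h))}"

definition encode :: "(nat \<rightharpoonup> 'a) set set \<times> (nat \<rightharpoonup> 's) \<Rightarrow> ('a, 's) state" where
  "encode x = (block_rel (fst x) \<union> coloured (snd x), snd x)"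

lemma snd_encode [simp]: "snd (encode x) = snd x"
  by (simp add: encode_def)

lemma in_encode: "(i, g, j) \<in> fst (encode (\<beta>, z)) \<longleftrightarrow> (i, g, j) \<in> block_rel \<beta> \<or> (i, g, j) \<in> coloured z"
  by (simp add: encode_def)

lemma block_relI:
  "\<lbrakk>B \<in> \<beta>; b \<in> B; b j = Some h; b i = Some (g \<otimes> h); g \<in> carrier G\<rbrakk> \<Longrightarrow> (i, g, j) \<in> block_rel \<beta>"
  by (auto simp: block_rel_def)

lemma block_relE:
  assumes "(i, g, j) \<in> block_rel \<beta>"
  obtains B b h where "B \<in> \<beta>" "b \<in> B" "b j = Some h" "b i = Some (g \<otimes> h)" "g \<in> carrier G"
  using assms by (auto simp: block_rel_def)

lemma dowling_iff:
  "(\<beta>, z) \<in> dowling n G S \<longleftrightarrow> \<beta> \<subseteq> gblocks n G \<and>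
     (\<forall>A\<in>\<beta>. \<forall>B\<in>\<beta>. A \<noteq> B \<longrightarrow> underlying A \<inter> underlying B = {}) \<and>
     dom z = {1..n} - (\<Union>B\<in>\<beta>. underlying B) \<and> ran z \<subseteq> S"
  by (simp add: dowling_def partial_G_partitions_def zero_block_def)

context
  fixes n \<beta> z
  assumes dow: "(\<beta>, z) \<in> dowling n G S"
begin

lemma dowlingD:
  shows "\<beta> \<subseteq> gblocks n G"
    and "\<lbrakk>A \<in> \<beta>; B \<in> \<beta>; A \<noteq> B\<rbrakk> \<Longrightarrow> underlying A \<inter> underlying B = {}"
    and "dom z = {1..n} - (\<Union>B\<in>\<beta>. underlying B)"
    and "ran z \<subseteq> S"
  using dow unfolding dowling_iff by simp_all

lemma blockD:
  assumes "B \<in> \<beta>" "b \<in> B"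
  shows "B = gclass G b" "dom b = underlying B" "dom b \<noteq> {}" "dom b \<subseteq> {1..n}" "ran b \<subseteq> carrier G"
  using gblocksD [of B n b] dow assms by (auto simp: dowling_iff)

lemma block_value:
  assumes "B \<in> \<beta>" "b \<in> B" "b i = Some h"
  shows "h \<in> carrier G" "i \<in> {1..n}" "z i = None"
proof -
  show "h \<in> carrier G" using blockD(5) [OF assms(1,2)] assms(3) by (auto intro: ranI)
  show "i \<in> {1..n}" using blockD(4) [OF assms(1,2)] assms(3) by blast
  have "i \<in> underlying B" using blockD(2) [OF assms(1,2)] assms(3) by blast
  then have "i \<notin> dom z" using dow assms(1) by (auto simp: dowling_iff)
  then show "z i = None" by auto
qed

lemma block_unique:
  assumes "A \<in> \<beta>" "a \<in> A" "B \<in> \<beta>" "b \<in> B" "a i = Some h" "b i = Some k"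
  shows "A = B"
proof -
  have "i \<in> underlying A" "i \<in> underlying B"
    using blockD(2) [OF assms(1,2)] blockD(2) [OF assms(3,4)] assms(5,6) by blast+
  then show ?thesis using dowlingD(2) [OF assms(1,3)] by blast
qed

lemma block_exists:
  assumes "i \<in> {1..n}" "z i = None"
  obtains B b h where "B \<in> \<beta>" "b \<in> B" "b i = Some h"
proof -
  have "i \<notin> dom z" using assms by auto
  then obtain B where B: "B \<in> \<beta>" "i \<in> underlying B" using dow assms(1) by (auto simp: dowling_iff)
  then obtain b where "b \<in> B" "i \<in> dom b" by (auto simp: underlying_def)
  then show thesis using that B by blast
qed

lemma zero_value: "z i = Some t \<Longrightarrow> i \<in> {1..n}" "z i = Some t \<Longrightarrow> t \<in> S"
proof -
  have "dom z \<subseteq> {1..n}" "ran z \<subseteq> S" using dowlingD(3,4) by auto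
  then show "z i = Some t \<Longrightarrow> i \<in> {1..n}" "z i = Some t \<Longrightarrow> t \<in> S" by (auto intro: ranI)
qed

text \<open>By invariance under right translation, the representative witnessing a relation can be
  exchanged for any given one.\<close>

lemma block_rel_value:
  assumes e: "(i, g, j) \<in> block_rel \<beta>" and B: "B \<in> \<beta>" "b \<in> B" and v: "b i = Some k \<or> b j = Some k"
  obtains h where "b j = Some h" "b i = Some (g \<otimes> h)"
proof -
  obtain A a h where A: "A \<in> \<beta>" "a \<in> A" "a j = Some h" "a i = Some (g \<otimes> h)" "g \<in> carrier G"
    using e by (rule block_relE)
  have "A = B" using v block_unique [OF A(1,2) B] A(3,4) by blast
  then have "b \<in> gclass G a" using blockD(1) [OF A(1,2)] B by simp
  then obtain u where u: "u \<in> carrier G" "b = rtranslate G a u" by (rule gclassE)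
  have "b j = Some (h \<otimes> u)" "b i = Some (g \<otimes> (h \<otimes> u))"
    using A u block_value [OF A(1-3)] by (auto simp: rtranslate_Some m_assoc)
  then show thesis by (rule that)
qed

lemma coloured_inv:
  assumes "(i, g, j) \<in> coloured z"
  shows "(j, inv g, i) \<in> coloured z"
proof -
  obtain t where t: "g \<in> carrier G" "z j = Some t" "z i = Some (\<phi> g t)" using assms by (auto simp: coloured_def)
  then have "z j = Some (\<phi> (inv g) (\<phi> g t))" using zero_value by simp
  then show ?thesis using t unfolding coloured_def by blast
qed

lemma coloured_mult:
  assumes "(i, g, j) \<in> coloured z" "(j, h, l) \<in> coloured z"
  shows "(i, g \<otimes> h, l) \<in> coloured z"
  using assms zero_value by (auto simp: coloured_def act_mult)

lemma state_encode: "state {1..n} (encode (\<beta>, z))"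
  unfolding encode_def fst_conv snd_conv
proof (rule stateI, goal_cases)
  case (1 i t)
  then show ?case using zero_value by blast
next
  case (2 i g j)
  then show ?case
  proof
    assume "(i, g, j) \<in> block_rel \<beta>"
    then show ?thesis by (rule block_relE) (use block_value in blast)
  next
    assume "(i, g, j) \<in> coloured z"
    then obtain t where "g \<in> carrier G" "z j = Some t" "z i = Some (\<phi> g t)" by (auto simp: coloured_def)
    then show ?thesis using zero_value by blast
  qed
next
  case (3 i)
  show ?case
  proof (cases "z i")
    case None
    obtain B b h where B: "B \<in> \<beta>" "b \<in> B" "b i = Some h" by (rule block_exists [OF 3 None])
    then have "(i, \<one>, i) \<in> block_rel \<beta>" using block_value [OF B] by (intro block_relI [OF B]) auto
    then show ?thesis by blast
  next
    case (Some t)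
    then have "z i = Some (\<phi> \<one> t)" using zero_value by simp
    then show ?thesis using Some unfolding coloured_def by blast
  qed
next
  case (4 i g j)
  then show ?case
  proof
    assume "(i, g, j) \<in> block_rel \<beta>"
    then obtain B b h where B: "B \<in> \<beta>" "b \<in> B" "b j = Some h" "b i = Some (g \<otimes> h)" "g \<in> carrier G"
      by (rule block_relE)
    have h: "h \<in> carrier G" using block_value [OF B(1-3)] by blast
    have "b j = Some (inv g \<otimes> (g \<otimes> h))" using B(3,5) h by (simp flip: m_assoc)
    then have "(j, inv g, i) \<in> block_rel \<beta>" using B by (intro block_relI [OF B(1,2,4)]) auto
    then show ?thesis by blast
  qed (use coloured_inv in blast)
next
  case (5 i g j h l)
  \<comment> \<open>Relations from blocks join uncoloured points and the others join coloured ones,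
    so mixed products do not occur.\<close>
  have nz: "z u = None" "z v = None" if "(u, k, v) \<in> block_rel \<beta>" for u k v
    by (rule block_relE [OF that], use block_value in blast)+
  have z: "z u \<noteq> None" "z v \<noteq> None" if "(u, k, v) \<in> coloured z" for u k v
    using that by (auto simp: coloured_def)
  consider "(i, g, j) \<in> block_rel \<beta>" "(j, h, l) \<in> block_rel \<beta>" | "(i, g, j) \<in> coloured z" "(j, h, l) \<in> coloured z"
    using 5 nz z by blast
  then show ?case
  proof cases
    case 1
    obtain B b k where B: "B \<in> \<beta>" "b \<in> B" "b l = Some k" "b j = Some (h \<otimes> k)" "h \<in> carrier G"
      using 1(2) by (rule block_relE)
    obtain k' where k': "b j = Some k'" "b i = Some (g \<otimes> k')"
      by (rule block_rel_value [OF 1(1) B(1,2)]) (use B(4) in auto)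
    have g: "g \<in> carrier G" using 1(1) by (auto simp: block_rel_def)
    have "b i = Some (g \<otimes> h \<otimes> k)" using k' B g block_value [OF B(1-3)] by (simp add: m_assoc)
    then have "(i, g \<otimes> h, l) \<in> block_rel \<beta>" using B g by (intro block_relI [OF B(1-3)]) auto
    then show ?thesis by blast
  next
    case 2
    then show ?thesis using coloured_mult by blast
  qed
next
  case (6 i g j t)
  from 6(1) show ?case
  proof (rule UnE)
    assume "(i, g, j) \<in> block_rel \<beta>"
    then obtain B b h where "B \<in> \<beta>" "b \<in> B" "b j = Some h" by (rule block_relE)
    then show ?thesis using block_value(3) 6(2) by fastforce
  qed (use 6(2) in \<open>auto simp: coloured_def\<close>)
next
  case (7 i g j t)
  then show ?case by (auto simp: coloured_def)
next
  case (8 i g)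
  then have "(i, g, i) \<in> block_rel \<beta>" by (auto simp: coloured_def)
  then obtain B b h where B: "B \<in> \<beta>" "b \<in> B" "b i = Some h" "b i = Some (g \<otimes> h)" "g \<in> carrier G"
    by (rule block_relE)
  then have "h \<in> carrier G" "g \<otimes> h = h" using block_value [OF B(1-3)] by auto
  then show ?case using B(5) by (metis one_unique r_cancel_one)
qed

lemma dowling_merge:
  assumes A: "A \<in> \<beta>" "a \<in> A" and B: "B \<in> \<beta>" "b \<in> B" and ne: "A \<noteq> B" and g: "g \<in> carrier G"
  defines "c \<equiv> a ++ rtranslate G b g"
  shows "(insert (gclass G c) (\<beta> - {A, B}), z) \<in> dowling n G S"
    and "encode (\<beta>, z) \<sqsubseteq> encode (insert (gclass G c) (\<beta> - {A, B}), z)"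
    and "\<And>i h. a i = Some h \<Longrightarrow> c i = Some h"
    and "\<And>i h. b i = Some h \<Longrightarrow> c i = Some (h \<otimes> g)"
    and "c \<in> gclass G c"
    and "dom c = dom a \<union> dom b"
proof -
  note bA = blockD [OF A] and bB = blockD [OF B]
  have disj: "dom a \<inter> dom b = {}" unfolding bA(2) bB(2) by (rule dowlingD(2) [OF A(1) B(1) ne])
  show ca: "c i = Some h" if "a i = Some h" for i h
  proof -
    have "i \<notin> dom (rtranslate G b g)" using that disj by auto
    then show ?thesis using that unfolding c_def by (simp add: map_add_dom_app_simps)
  qed
  show cb: "c i = Some (h \<otimes> g)" if "b i = Some h" for i h
    unfolding c_def using that by (intro map_add_find_right) (simp add: rtranslate_Some)
  show dc: "dom c = dom a \<union> dom b" by (auto simp: c_def)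
  have rc: "ran c \<subseteq> carrier G"
  proof
    fix v assume "v \<in> ran c"
    then obtain i where i: "c i = Some v" by (auto simp: ran_def)
    then consider h where "a i = Some h" | h where "b i = Some h" using dc by blast
    then show "v \<in> carrier G"
    proof cases
      case 1
      then show ?thesis using ca [OF 1] i block_value(1) [OF A 1] by simp
    next
      case 2
      then show ?thesis using cb [OF 2] i g block_value(1) [OF B 2] by simp
    qed
  qed
  show cc: "c \<in> gclass G c" by (rule gclass_self [OF rc])
  have u: "underlying (gclass G c) = underlying A \<union> underlying B"
    by (simp add: underlying_gclass dc bA(2) bB(2))
  show d: "(insert (gclass G c) (\<beta> - {A, B}), z) \<in> dowling n G S"
    unfolding dowling_iff
  proof (intro conjI)
    have "gclass G c \<in> gblocks n G"
      by (rule gclass_in_gblocks [OF _ _ rc]) (use bA bB in \<open>simp_all add: dc\<close>)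
    then show "insert (gclass G c) (\<beta> - {A, B}) \<subseteq> gblocks n G" using dowlingD(1) by blast
    have dcD: "underlying (gclass G c) \<inter> underlying D = {}" if "D \<in> \<beta> - {A, B}" for D
      using dowlingD(2) [OF A(1), of D] dowlingD(2) [OF B(1), of D] that unfolding u by blast
    show "\<forall>D\<in>insert (gclass G c) (\<beta> - {A, B}). \<forall>E\<in>insert (gclass G c) (\<beta> - {A, B}).
        D \<noteq> E \<longrightarrow> underlying D \<inter> underlying E = {}"
      using dowlingD(2) dcD by (simp add: Int_commute)
    have "(\<Union>D\<in>insert (gclass G c) (\<beta> - {A, B}). underlying D) = (\<Union>D\<in>\<beta>. underlying D)"
      using A B u by auto
    then show "dom z = {1..n} - (\<Union>D\<in>insert (gclass G c) (\<beta> - {A, B}). underlying D)" "ran z \<subseteq> S"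
      using dowlingD(3,4) by simp_all
  qed
  show "encode (\<beta>, z) \<sqsubseteq> encode (insert (gclass G c) (\<beta> - {A, B}), z)"
  proof (rule state_leI)
    fix i h j assume "(i, h, j) \<in> fst (encode (\<beta>, z))"
    then consider "(i, h, j) \<in> coloured z" | "(i, h, j) \<in> block_rel \<beta>" by (auto simp: in_encode)
    then show "(i, h, j) \<in> fst (encode (insert (gclass G c) (\<beta> - {A, B}), z))"
    proof cases
      case 2
      then obtain D e k where D: "D \<in> \<beta>" "e \<in> D" "e j = Some k" "e i = Some (h \<otimes> k)" "h \<in> carrier G"
        by (rule block_relE)
      consider "D = A" | "D = B" | "D \<in> \<beta> - {A, B}" using D(1) by blast
      then have "(i, h, j) \<in> block_rel (insert (gclass G c) (\<beta> - {A, B}))"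
      proof cases
        case 1
        then have "j \<in> dom a" using D(2,3) blockD(2) [OF D(1,2)] bA(2) by blast
        then obtain k' where "a j = Some k'" by blast
        then obtain k' where k': "a j = Some k'" "a i = Some (h \<otimes> k')"
          using block_rel_value [OF 2 A] by blast
        show ?thesis by (rule block_relI [OF insertI1 cc ca [OF k'(1)] ca [OF k'(2)] D(5)])
      next
        case B2: 2
        then have "j \<in> dom b" using D(2,3) blockD(2) [OF D(1,2)] bB(2) by blast
        then obtain k' where "b j = Some k'" by blast
        then obtain k' where k': "b j = Some k'" "b i = Some (h \<otimes> k')"
          using block_rel_value [OF 2 B] by blast
        have "c i = Some (h \<otimes> (k' \<otimes> g))"
          using cb [OF k'(2)] D(5) g block_value(1) [OF B k'(1)] by (simp add: m_assoc)
        then show ?thesis by (rule block_relI [OF insertI1 cc cb [OF k'(1)] _ D(5)])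
      next
        case 3
        then show ?thesis using D by (intro block_relI [of D _ e]) auto
      qed
      then show ?thesis by (simp add: in_encode)
    qed (simp add: in_encode)
  qed simp
qed

lemma dowling_color:
  assumes B: "B \<in> \<beta>" "b \<in> B" and s: "s \<in> S"
  defines "z' \<equiv> z ++ (\<lambda>i. map_option (\<lambda>h. \<phi> h s) (b i))"
  shows "(\<beta> - {B}, z') \<in> dowling n G S"
    and "encode (\<beta>, z) \<sqsubseteq> encode (\<beta> - {B}, z')"
    and "\<And>i h. b i = Some h \<Longrightarrow> z' i = Some (\<phi> h s)"
    and "\<And>i. b i = None \<Longrightarrow> z' i = z i"
proof -
  note bB = blockD [OF B]
  show zb: "z' i = Some (\<phi> h s)" if "b i = Some h" for i h
    unfolding z'_def using that by (intro map_add_find_right) simp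
  show zn: "z' i = z i" if "b i = None" for i
    unfolding z'_def using that by (simp add: map_add_def)
  have zz: "z' i = Some t" if "z i = Some t" for i t
    using zn [of i] that block_value(3) [OF B, of i] by (cases "b i") auto
  have dz: "dom z' = dom z \<union> dom b" by (auto simp: z'_def)
  show "(\<beta> - {B}, z') \<in> dowling n G S"
    unfolding dowling_iff
  proof (intro conjI)
    show "\<beta> - {B} \<subseteq> gblocks n G" using dowlingD(1) by blast
    show "\<forall>A\<in>\<beta> - {B}. \<forall>C\<in>\<beta> - {B}. A \<noteq> C \<longrightarrow> underlying A \<inter> underlying C = {}"
      using dowlingD(2) by simp
    have d: "underlying D \<inter> underlying B = {}" if "D \<in> \<beta> - {B}" for D
      by (rule dowlingD(2)) (use that B(1) in auto)
    have "(\<Union>D\<in>\<beta>. underlying D) = underlying B \<union> (\<Union>D\<in>\<beta> - {B}. underlying D)" using B(1) by blast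
    moreover have "underlying B \<subseteq> {1..n}" using bB by simp
    ultimately show "dom z' = {1..n} - (\<Union>D\<in>\<beta> - {B}. underlying D)"
      unfolding dz bB(2) dowlingD(3) using d by blast
    show "ran z' \<subseteq> S"
    proof
      fix t assume "t \<in> ran z'"
      then obtain i where i: "z' i = Some t" by (auto simp: ran_def)
      show "t \<in> S"
      proof (cases "b i")
        case None
        then show ?thesis using zn [OF None] i zero_value by simp
      next
        case (Some h)
        then show ?thesis using zb [OF Some] i block_value(1) [OF B Some] s by auto
      qed
    qed
  qed
  show "encode (\<beta>, z) \<sqsubseteq> encode (\<beta> - {B}, z')"
  proof (rule state_leI)
    show "snd (encode (\<beta> - {B}, z')) i = Some t" if "snd (encode (\<beta>, z)) i = Some t" for i t
      using that zz by simp
    fix i g j assume "(i, g, j) \<in> fst (encode (\<beta>, z))"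
    then consider "(i, g, j) \<in> coloured z" | "(i, g, j) \<in> block_rel \<beta>" by (auto simp: in_encode)
    then show "(i, g, j) \<in> fst (encode (\<beta> - {B}, z'))"
    proof cases
      case 1
      then have "(i, g, j) \<in> coloured z'" using zz unfolding coloured_def by blast
      then show ?thesis by (simp add: in_encode)
    next
      case 2
      then obtain D e k where D: "D \<in> \<beta>" "e \<in> D" "e j = Some k" "e i = Some (g \<otimes> k)" "g \<in> carrier G"
        by (rule block_relE)
      show ?thesis
      proof (cases "D = B")
        case True
        then have "j \<in> dom b" using D(2,3) blockD(2) [OF D(1,2)] bB(2) by blast
        then obtain k' where "b j = Some k'" by blast
        then obtain h where h: "b j = Some h" "b i = Some (g \<otimes> h)"
          using block_rel_value [OF 2 B] by blast
        have "z' i = Some (\<phi> g (\<phi> h s))"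
          using zb [OF h(2)] D(5) block_value(1) [OF B h(1)] s by (simp add: act_mult)
        then have "(i, g, j) \<in> coloured z'" using zb [OF h(1)] D(5) unfolding coloured_def by blast
        then show ?thesis by (simp add: in_encode)
      next
        case False
        then have "(i, g, j) \<in> block_rel (\<beta> - {B})" using D by (intro block_relI [of D _ e]) auto
        then show ?thesis by (simp add: in_encode)
      qed
    qed
  qed
qed

end

section \<open>The order as inclusion of encoded states\<close>

lemma dowling_step_encode:
  "dowling_step n G S \<phi> x y \<Longrightarrow> x \<in> dowling n G S \<and> y \<in> dowling n G S \<and> encode x \<sqsubseteq> encode y"
proof (induction rule: dowling_step.induct)
  case (merge \<beta> z A B a b g)
  then show ?case
    using dowling_merge(1,2) [OF merge(1,2,5,3,6,4,7)] by blast
next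
  case (color \<beta> z B b s)
  then show ?case using dowling_color(1,2) [OF color(1-4)] by blast
qed

lemma encode_mono: "dowling_le n G S \<phi> x y \<Longrightarrow> encode x \<sqsubseteq> encode y"
  unfolding dowling_le_def
proof (induction rule: rtranclp_induct)
  case (step y z)
  then show ?case using dowling_step_encode state_le_trans by blast
qed simp

text \<open>The labels relating the points of a block to one of them, \<open>i\<close>, recover a
  representative up to the right translation that adjusts its value at \<open>i\<close>.\<close>

lemma encode_subset:
  assumes x: "(\<beta>, z) \<in> dowling n G S" and y: "(\<beta>', z) \<in> dowling n G S"
    and eq: "encode (\<beta>, z) = encode (\<beta>', z)"
  shows "\<beta> \<subseteq> \<beta>'"
proof
  fix B assume B: "B \<in> \<beta>"
  then have "B \<in> gblocks n G" using dowlingD(1) [OF x] by blast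
  then obtain b where b: "b \<in> B" using gclass_self by (auto simp: gblocks_def)
  note bb = blockD [OF x B b]
  obtain i h where i: "b i = Some h" using bb(3) by blast
  note iv = block_value [OF x B b i]
  obtain B' b' h' where B': "B' \<in> \<beta>'" "b' \<in> B'" "b' i = Some h'" by (rule block_exists [OF y iv(2,3)])
  note iv' = block_value [OF y B']
  have rel: "(j, g, i) \<in> block_rel \<beta> \<longleftrightarrow> (j, g, i) \<in> block_rel \<beta>'" for j g
  proof -
    have "(j, g, i) \<notin> coloured z" using iv(3) by (auto simp: coloured_def)
    moreover have "(j, g, i) \<in> fst (encode (\<beta>, z)) \<longleftrightarrow> (j, g, i) \<in> fst (encode (\<beta>', z))" using eq by simp
    ultimately show ?thesis by (simp add: in_encode)
  qed
  have "b' = rtranslate G b (inv h \<otimes> h')"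
  proof
    fix j
    show "b' j = rtranslate G b (inv h \<otimes> h') j"
    proof (cases "b j")
      case (Some k)
      have k: "k \<in> carrier G" by (rule block_value(1) [OF x B b Some])
      have "b j = Some (k \<otimes> inv h \<otimes> h)" using Some k iv by (simp add: m_assoc)
      then have "(j, k \<otimes> inv h, i) \<in> block_rel \<beta>" using k iv by (intro block_relI [OF B b i]) auto
      then have "(j, k \<otimes> inv h, i) \<in> block_rel \<beta>'" using rel by blast
      then obtain l where "b' i = Some l" "b' j = Some (k \<otimes> inv h \<otimes> l)"
        by (rule block_rel_value [OF y _ B'(1,2)]) (use B'(3) in auto)
      then have "b' j = Some (k \<otimes> (inv h \<otimes> h'))" using B'(3) k iv iv' by (simp add: m_assoc)
      then show ?thesis using Some by (simp add: rtranslate_def)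
    next
      case None
      have "b' j = None"
      proof (rule ccontr)
        assume "b' j \<noteq> None"
        then obtain k where k: "b' j = Some k" by blast
        have kG: "k \<in> carrier G" by (rule block_value(1) [OF y B'(1,2) k])
        have "b' j = Some (k \<otimes> inv h' \<otimes> h')" using k kG iv' by (simp add: m_assoc)
        then have "(j, k \<otimes> inv h', i) \<in> block_rel \<beta>'" using kG iv' by (intro block_relI [OF B']) auto
        then have "(j, k \<otimes> inv h', i) \<in> block_rel \<beta>" using rel by blast
        then obtain l where "b j = Some (k \<otimes> inv h' \<otimes> l)"
          by (rule block_rel_value [OF x _ B b]) (use i in auto)
        then show False using None by simp
      qed
      then show ?thesis using None by (simp add: rtranslate_def)
    qed
  qed
  then have "b' \<in> gclass G b" using iv iv' by (auto simp: gclass_def)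
  then have "gclass G b' = gclass G b" by (rule gclass_eq [OF bb(5)])
  then show "B \<in> \<beta>'" using bb(1) blockD(1) [OF y B'(1,2)] B'(1) by simp
qed

lemma inj_on_encode: "inj_on encode (dowling n G S)"
proof (rule inj_onI)
  fix x y assume x: "x \<in> dowling n G S" and y: "y \<in> dowling n G S" and eq: "encode x = encode y"
  obtain \<beta> z \<beta>' z' where xy: "x = (\<beta>, z)" "y = (\<beta>', z')" by (metis surj_pair)
  have "snd (encode x) = snd (encode y)" using eq by simp
  then have "z = z'" by (simp add: xy)
  moreover have "\<beta> \<subseteq> \<beta>'" "\<beta>' \<subseteq> \<beta>"
    using encode_subset x y eq \<open>z = z'\<close> unfolding xy by metis+
  ultimately show "x = y" by (simp add: xy)
qed

text \<open>If the states differ, a generating step from \<open>x\<close> that stays below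
  \<open>y\<close> exists: if a point is coloured in \<open>y\<close> only, its block is coloured as
  \<open>y\<close> prescribes; otherwise two blocks of \<open>x\<close> are joined in
  \<open>y\<close> and can be merged. The number of leaders drops with each step.\<close>

lemma dowling_le_if_encode_le:
  assumes "y \<in> dowling n G S"
  shows "\<lbrakk>x \<in> dowling n G S; encode x \<sqsubseteq> encode y\<rbrakk> \<Longrightarrow> dowling_le n G S \<phi> x y"
proof (induction "card (leaders {1..n} (encode x))" arbitrary: x rule: less_induct)
  case less
  obtain \<beta> z \<beta>' z' where xy: "x = (\<beta>, z)" "y = (\<beta>', z')" by (metis surj_pair)
  have x: "(\<beta>, z) \<in> dowling n G S" and y: "(\<beta>', z') \<in> dowling n G S" using less.prems assms xy by auto
  have sx: "state {1..n} (encode x)" and sy: "state {1..n} (encode y)"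
    unfolding xy by (rule state_encode [OF x], rule state_encode [OF y])
  note le = less.prems(2)
  have step: "dowling_le n G S \<phi> x y"
    if s: "dowling_step n G S \<phi> x w" and wy: "encode w \<sqsubseteq> encode y" and ne: "encode x \<noteq> encode w" for w
  proof -
    have w: "w \<in> dowling n G S" "encode x \<sqsubseteq> encode w" using dowling_step_encode [OF s] by auto
    have "state {1..n} (encode w)" using state_encode [of "fst w" "snd w" n] w(1) by simp
    then have "card (leaders {1..n} (encode w)) < card (leaders {1..n} (encode x))"
      by (intro card_leaders_strict [OF _ sx _ w(2) ne]) auto
    then have "dowling_le n G S \<phi> w y" using less.hyps w(1) wy by blast
    then show ?thesis using s unfolding dowling_le_def by (rule converse_rtranclp_into_rtranclp [rotated])
  qed
  show ?case
  proof (cases "encode x = encode y")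
    case True
    then have "x = y" using inj_on_encode less.prems(1) assms by (auto dest: inj_onD)
    then show ?thesis by (simp add: dowling_le_def)
  next
    case ne: False
    show ?thesis
    proof (cases "z = z'")
      case False
      then obtain i where "z i \<noteq> z' i" by blast
      moreover have "z' i = Some t" if "z i = Some t" for t
        using state_leD(2) [OF le, of i t] that by (simp add: xy)
      ultimately obtain t where i: "z i = None" "z' i = Some t" by (cases "z i"; cases "z' i") auto
      obtain B b h where B: "B \<in> \<beta>" "b \<in> B" "b i = Some h"
        by (rule block_exists [OF x zero_value(1) [OF y i(2)] i(1)])
      have h: "h \<in> carrier G" by (rule block_value(1) [OF x B])
      have t: "t \<in> S" by (rule zero_value(2) [OF y i(2)])
      \<comment> \<open>Chosen so that \<open>i\<close>, where \<open>b\<close> has the value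
        \<open>h\<close>, receives the colour \<open>t\<close>.\<close>
      define s where "s = \<phi> (inv h) t"
      have s: "s \<in> S" using h t by (simp add: s_def)
      define w where "w = (\<beta> - {B}, z ++ (\<lambda>i. map_option (\<lambda>h. \<phi> h s) (b i)))"
      note col = dowling_color [OF x B(1,2) s, folded w_def]
      have zw: "z' j = Some u" if "snd w j = Some u" for j u
      proof (cases "b j")
        case None
        then have "z j = Some u" using col(4) that by (simp add: w_def)
        then show ?thesis using state_leD(2) [OF le, of j u] by (simp add: xy)
      next
        case (Some k)
        have k: "k \<in> carrier G" by (rule block_value(1) [OF x B(1,2) Some])
        have "b j = Some (k \<otimes> inv h \<otimes> h)" using Some k h by (simp add: m_assoc)
        then have "(j, k \<otimes> inv h, i) \<in> block_rel \<beta>" using k h by (intro block_relI [OF B]) auto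
        then have "(j, k \<otimes> inv h, i) \<in> fst (encode y)"
          using state_leD(1) [OF le] by (simp add: xy in_encode)
        then have "z' j = Some (\<phi> (k \<otimes> inv h) t)"
          using state_act [OF sy] i(2) by (simp add: xy)
        also have "\<phi> (k \<otimes> inv h) t = \<phi> k s" using k h t by (simp add: act_mult s_def)
        also have "\<phi> k s = u" using col(3) [OF Some] that by (simp add: w_def)
        finally show ?thesis .
      qed
      show ?thesis
      proof (rule step)
        show "dowling_step n G S \<phi> x w"
          unfolding xy w_def by (rule dowling_step.color [OF x B(1,2) s])
        show "encode x \<noteq> encode w"
        proof
          assume "encode x = encode w"
          then have "snd (encode x) i = snd (encode w) i" by simp
          then show False using i(1) col(3) [OF B(3)] by (simp add: xy w_def)
        qed
        show "encode w \<sqsubseteq> encode y"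
        proof (rule state_leI)
          show "snd (encode y) j = Some u" if "snd (encode w) j = Some u" for j u
            using zw that by (simp add: xy)
          fix j g l assume "(j, g, l) \<in> fst (encode w)"
          then consider "(j, g, l) \<in> block_rel (\<beta> - {B})" | "(j, g, l) \<in> coloured (snd w)"
            by (auto simp: encode_def w_def)
          then show "(j, g, l) \<in> fst (encode y)"
          proof cases
            case 1
            then have "(j, g, l) \<in> block_rel \<beta>" unfolding block_rel_def by blast
            then show ?thesis using state_leD(1) [OF le] by (simp add: xy in_encode)
          next
            case 2
            then have "(j, g, l) \<in> coloured z'" using zw unfolding coloured_def by blast
            then show ?thesis by (simp add: xy in_encode)
          qed
        qed
      qed
    next
      case z: True
      have "\<not> encode y \<sqsubseteq> encode x" using ne le state_le_antisym by blast
      then obtain i g j where e: "(i, g, j) \<in> fst (encode y)" "(i, g, j) \<notin> fst (encode x)"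
        using state_leI [of "encode y" "encode x"] z by (auto simp: xy)
      have g: "g \<in> carrier G" and N: "i \<in> {1..n}" "j \<in> {1..n}" using state_rel [OF sy e(1)] by auto
      have "(i, g, j) \<notin> coloured z'" using e(2) z by (simp add: xy in_encode)
      then have zj: "z' j = None"
        using state_act [OF sy e(1)] g by (cases "z' j") (auto simp: coloured_def xy)
      then have zi: "z' i = None" using state_act' [OF sy e(1)] by (cases "z' i") (auto simp: xy)
      obtain A a h where A: "A \<in> \<beta>" "a \<in> A" "a i = Some h" by (rule block_exists [OF x N(1)]) (use zi z in simp)
      obtain B b k where B: "B \<in> \<beta>" "b \<in> B" "b j = Some k" by (rule block_exists [OF x N(2)]) (use zj z in simp)
      have hk: "h \<in> carrier G" "k \<in> carrier G" using block_value(1) [OF x A] block_value(1) [OF x B] by auto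
      have up: "(u, v \<otimes> inv w, l) \<in> fst (encode y)" if "D \<in> \<beta>" "d \<in> D" "d u = Some v" "d l = Some w" for D d u v l w
      proof -
        have vw: "v \<in> carrier G" "w \<in> carrier G"
          using block_value(1) [OF x that(1,2,3)] block_value(1) [OF x that(1,2,4)] by auto
        then have "d u = Some (v \<otimes> inv w \<otimes> w)" using that by (simp add: m_assoc)
        then have "(u, v \<otimes> inv w, l) \<in> block_rel \<beta>" using vw by (intro block_relI [OF that(1,2,4)]) auto
        then show ?thesis using state_leD(1) [OF le] by (simp add: xy in_encode)
      qed
      \<comment> \<open>Within one block the label between two points is already determined by
        \<open>x\<close>, since \<open>i\<close> is uncoloured in \<open>y\<close> and has trivial
        isotropy there.\<close>
      have AB: "A \<noteq> B"
      proof
        assume "A = B"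
        then have "j \<in> dom a" using blockD(2) [OF x A(1,2)] blockD(2) [OF x B(1,2)] B(3) by blast
        then obtain w where w: "a j = Some w" by blast
        have wG: "w \<in> carrier G" by (rule block_value(1) [OF x A(1,2) w])
        have "(i, (h \<otimes> inv w) \<otimes> inv g, i) \<in> fst (encode y)"
          by (rule state_mult [OF sy up [OF A(1,2,3) w] state_inv [OF sy e(1)]])
        then have "h \<otimes> inv w \<otimes> inv g = \<one>" using state_free [OF sy] zi by (simp add: xy)
        then have "h \<otimes> inv w = g" using hk wG g by (metis inv_closed inv_equality inv_inv m_closed)
        then have "a i = Some (g \<otimes> w)" using A(3) hk wG by (auto simp: m_assoc)
        then have "(i, g, j) \<in> block_rel \<beta>" using g by (intro block_relI [OF A(1,2) w]) auto
        then show False using e(2) by (simp add: xy in_encode)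
      qed
      \<comment> \<open>The solution of \<open>g k u = h\<close>, which makes \<open>c i\<close>
        equal to \<open>g\<close> times \<open>c j\<close> in the merged block.\<close>
      define u where "u = inv k \<otimes> inv g \<otimes> h"
      have u: "u \<in> carrier G" using hk g by (simp add: u_def)
      define c where "c = a ++ rtranslate G b u"
      define w where "w = (insert (gclass G c) (\<beta> - {A, B}), z)"
      note mer = dowling_merge [OF x A(1,2) B(1,2) AB u, folded c_def, folded w_def]
      \<comment> \<open>Relations inside the merged block factor through the point \<open>i\<close>,
        so only those with \<open>i\<close> have to be found in \<open>y\<close>.\<close>
      have to_i: "(l, v \<otimes> inv h, i) \<in> fst (encode y)" "v \<in> carrier G" if "c l = Some v" for l v
      proof -
        have "l \<in> dom a \<union> dom b" using that mer(6) by blast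
        then consider v' where "a l = Some v'" | v' where "b l = Some v'" by blast
        then have "(l, v \<otimes> inv h, i) \<in> fst (encode y) \<and> v \<in> carrier G"
        proof cases
          case 1
          then have "v = v'" using mer(3) that by fastforce
          then show ?thesis using up [OF A(1,2) _ A(3)] 1 block_value(1) [OF x A(1,2) 1] by blast
        next
          case 2
          have v': "v' \<in> carrier G" by (rule block_value(1) [OF x B(1,2) 2])
          have v: "v = v' \<otimes> u" using mer(4) [OF 2] that by simp
          have "(l, (v' \<otimes> inv k) \<otimes> inv g, i) \<in> fst (encode y)"
            by (rule state_mult [OF sy up [OF B(1,2) 2 B(3)] state_inv [OF sy e(1)]])
          moreover have "(v' \<otimes> inv k) \<otimes> inv g = v \<otimes> inv h"
            using v v' hk g by (simp add: u_def m_assoc)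
          ultimately show ?thesis using v v' u by simp
        qed
        then show "(l, v \<otimes> inv h, i) \<in> fst (encode y)" "v \<in> carrier G" by auto
      qed
      show ?thesis
      proof (rule step)
        show "dowling_step n G S \<phi> x w"
          unfolding xy w_def c_def by (rule dowling_step.merge [OF x A(1) B(1) AB A(2) B(2) u])
        have "g \<otimes> (k \<otimes> u) = h" using hk g by (simp add: u_def m_assoc [symmetric])
        then have "c i = Some (g \<otimes> (k \<otimes> u))" using mer(3) [OF A(3)] by simp
        then have "(i, g, j) \<in> block_rel (fst w)"
          unfolding w_def fst_conv by (rule block_relI [OF insertI1 mer(5) mer(4) [OF B(3)] _ g])
        then show "encode x \<noteq> encode w" using e(2) by (auto simp: encode_def)
        show "encode w \<sqsubseteq> encode y"
        proof (rule state_leI)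
          show "snd (encode y) l = Some t" if "snd (encode w) l = Some t" for l t
            using that z by (simp add: xy w_def)
          fix l p m assume "(l, p, m) \<in> fst (encode w)"
          then consider "(l, p, m) \<in> coloured z" | "(l, p, m) \<in> block_rel (insert (gclass G c) (\<beta> - {A, B}))"
            by (auto simp: encode_def w_def)
          then show "(l, p, m) \<in> fst (encode y)"
          proof cases
            case 1
            then show ?thesis using z by (simp add: xy in_encode)
          next
            case 2
            then obtain D d v where D: "D \<in> insert (gclass G c) (\<beta> - {A, B})" "d \<in> D" "d m = Some v"
                "d l = Some (p \<otimes> v)" "p \<in> carrier G"
              by (rule block_relE)
            show ?thesis
            proof (cases "D \<in> \<beta>")
              case True
              then have "(l, p, m) \<in> block_rel \<beta>" using D by (intro block_relI [of D _ d]) auto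
              then show ?thesis using state_leD(1) [OF le] by (simp add: xy in_encode)
            next
              case False
              then have dc: "D = gclass G c" using D(1) by blast
              have w_dow: "(insert (gclass G c) (\<beta> - {A, B}), z) \<in> dowling n G S"
                using mer(1) by (simp add: w_def)
              have "m \<in> dom c" using D(2,3) unfolding dc by (auto elim!: gclassE simp: rtranslate_Some)
              then obtain v0 where "c m = Some v0" by blast
              then obtain v' where v': "c m = Some v'" "c l = Some (p \<otimes> v')"
                using block_rel_value [OF w_dow 2 insertI1 mer(5)] by blast
              have vG: "v' \<in> carrier G" by (rule to_i(2) [OF v'(1)])
              have "(l, (p \<otimes> v' \<otimes> inv h) \<otimes> inv (v' \<otimes> inv h), m) \<in> fst (encode y)"
                by (rule state_mult [OF sy to_i(1) [OF v'(2)] state_inv [OF sy to_i(1) [OF v'(1)]]])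
              moreover have "(p \<otimes> v' \<otimes> inv h) \<otimes> inv (v' \<otimes> inv h) = p"
                using vG hk D(5) by (simp add: m_assoc)
              ultimately show ?thesis by simp
            qed
          qed
        qed
      qed
    qed
  qed
qed

text \<open>The representative with value 1 at \<open>i\<close>. Labels are unique only if the
  isotropy at \<open>i\<close> is trivial, so this is meant for uncoloured \<open>i\<close>.\<close>

definition block_of :: "('a, 's) state \<Rightarrow> nat \<Rightarrow> (nat \<rightharpoonup> 'a)" where
  "block_of x i = (\<lambda>j. if \<exists>g. (j, g, i) \<in> fst x then Some (THE g. (j, g, i) \<in> fst x) else None)"

lemma block_of_Some:
  assumes x: "state N x" and i: "snd x i = None"
  shows "block_of x i j = Some g \<longleftrightarrow> (j, g, i) \<in> fst x"
proof -
  have unique: "g = h" if "(j, g, i) \<in> fst x" "(j, h, i) \<in> fst x" for g h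
  proof -
    have c: "g \<in> carrier G" "h \<in> carrier G" using that state_rel [OF x] by auto
    have "inv g \<otimes> h = \<one>"
      by (rule state_free [OF x state_mult [OF x state_inv [OF x that(1)] that(2)] i])
    then show ?thesis using c by (metis inv_closed inv_equality inv_inv)
  qed
  show ?thesis
  proof
    assume "block_of x i j = Some g"
    then obtain h where "(j, h, i) \<in> fst x" "g = (THE g. (j, g, i) \<in> fst x)"
      by (auto simp: block_of_def split: if_splits)
    then show "(j, g, i) \<in> fst x" using unique by (metis the_equality)
  next
    assume "(j, g, i) \<in> fst x"
    moreover from this have "(THE g. (j, g, i) \<in> fst x) = g" using unique by blast
    ultimately show "block_of x i j = Some g" by (auto simp: block_of_def)
  qed
qed

lemma encode_surj:
  assumes x: "state {1..n} x"
  shows "\<exists>w\<in>dowling n G S. encode w = x"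
proof -
  define \<beta> where "\<beta> = {gclass G (block_of x i) | i. i \<in> {1..n} \<and> snd x i = None}"
  note b = block_of_Some [OF x]
  have ran: "ran (block_of x i) \<subseteq> carrier G" if "snd x i = None" for i
    using b [OF that] state_rel [OF x] by (auto simp: ran_def)
  have dom: "j \<in> dom (block_of x i) \<longleftrightarrow> (\<exists>g. (j, g, i) \<in> fst x)" if "snd x i = None" for i j
    using b [OF that, of j] by blast
  have un: "snd x j = None" if "snd x i = None" "(j, g, i) \<in> fst x" for i j g
    using state_act' [OF x that(2)] that(1) by (cases "snd x j") auto
  \<comment> \<open>Related points produce the same block: their representatives differ by right
    translation by the label \<open>k\<close>.\<close>
  have eq: "gclass G (block_of x i') = gclass G (block_of x i)"
    if i: "snd x i = None" "snd x i' = None" and k: "(i, k, i') \<in> fst x" for i i' k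
  proof -
    have kG: "k \<in> carrier G" by (rule state_rel(2) [OF x k])
    have "block_of x i' = rtranslate G (block_of x i) k"
    proof
      fix l
      show "block_of x i' l = rtranslate G (block_of x i) k l"
      proof (cases "block_of x i l")
        case (Some h)
        then have "(l, h, i) \<in> fst x" using b [OF i(1)] by simp
        then have "(l, h \<otimes> k, i') \<in> fst x" by (rule state_mult [OF x _ k])
        then have "block_of x i' l = Some (h \<otimes> k)" using b [OF i(2)] by simp
        then show ?thesis using Some by (simp add: rtranslate_def)
      next
        case None
        have "block_of x i' l = None"
        proof (rule ccontr)
          assume "block_of x i' l \<noteq> None"
          then obtain h where "block_of x i' l = Some h" by blast
          then have "(l, h, i') \<in> fst x" using b [OF i(2)] by simp
          then have "(l, h \<otimes> inv k, i) \<in> fst x" by (rule state_mult [OF x _ state_inv [OF x k]])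
          then have "block_of x i l = Some (h \<otimes> inv k)" using b [OF i(1)] by simp
          then show False using None by simp
        qed
        then show ?thesis using None by (simp add: rtranslate_def)
      qed
    qed
    then have "block_of x i' \<in> gclass G (block_of x i)" using kG by (auto simp: gclass_def)
    then show ?thesis by (rule gclass_eq [OF ran [OF i(1)]])
  qed
  have U: "(\<Union>B\<in>\<beta>. underlying B) = {j \<in> {1..n}. snd x j = None}"
  proof (intro equalityI subsetI)
    fix j assume "j \<in> (\<Union>B\<in>\<beta>. underlying B)"
    then obtain i where i: "snd x i = None" "j \<in> dom (block_of x i)"
      by (auto simp: \<beta>_def underlying_gclass)
    then obtain g where "(j, g, i) \<in> fst x" using dom by blast
    then show "j \<in> {j \<in> {1..n}. snd x j = None}" using un [OF i(1)] state_rel [OF x] by blast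
  next
    fix j assume j: "j \<in> {j \<in> {1..n}. snd x j = None}"
    then have "j \<in> dom (block_of x j)" using dom state_one [OF x] by blast
    then have "j \<in> underlying (gclass G (block_of x j))" by (simp add: underlying_gclass)
    then show "j \<in> (\<Union>B\<in>\<beta>. underlying B)" using j unfolding \<beta>_def by blast
  qed
  have dow: "(\<beta>, snd x) \<in> dowling n G S"
    unfolding dowling_iff
  proof (intro conjI ballI impI)
    show "\<beta> \<subseteq> gblocks n G"
    proof
      fix B assume "B \<in> \<beta>"
      then obtain i where i: "B = gclass G (block_of x i)" "i \<in> {1..n}" "snd x i = None" by (auto simp: \<beta>_def)
      have "i \<in> dom (block_of x i)" using dom [OF i(3)] state_one [OF x i(2)] by blast
      moreover have "dom (block_of x i) \<subseteq> {1..n}" using dom [OF i(3)] state_rel [OF x] by blast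
      ultimately show "B \<in> gblocks n G" unfolding i(1) by (intro gclass_in_gblocks ran i(3)) auto
    qed
    show "underlying A \<inter> underlying B = {}" if AB: "A \<in> \<beta>" "B \<in> \<beta>" "A \<noteq> B" for A B
    proof (rule ccontr)
      obtain i where i: "A = gclass G (block_of x i)" "snd x i = None" using AB by (auto simp: \<beta>_def)
      obtain i' where i': "B = gclass G (block_of x i')" "snd x i' = None" using AB by (auto simp: \<beta>_def)
      assume "underlying A \<inter> underlying B \<noteq> {}"
      then obtain j where "j \<in> dom (block_of x i)" "j \<in> dom (block_of x i')"
        by (auto simp: i i' underlying_gclass)
      then obtain g g' where "(j, g, i) \<in> fst x" "(j, g', i') \<in> fst x" using dom i(2) i'(2) by blast
      then have "(i, inv g \<otimes> g', i') \<in> fst x" using state_mult [OF x state_inv [OF x]] by blast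
      then show False using eq [OF i(2) i'(2)] AB(3) i(1) i'(1) by simp
    qed
    show "dom (snd x) = {1..n} - (\<Union>B\<in>\<beta>. underlying B)" unfolding U using state_colour [OF x] by auto
    show "ran (snd x) \<subseteq> S" using state_colour [OF x] by (auto simp: ran_def)
  qed
  have "(i, g, j) \<in> fst (encode (\<beta>, snd x)) \<longleftrightarrow> (i, g, j) \<in> fst x" for i g j
  proof
    assume "(i, g, j) \<in> fst (encode (\<beta>, snd x))"
    then consider "(i, g, j) \<in> coloured (snd x)" | "(i, g, j) \<in> block_rel \<beta>" by (auto simp: in_encode)
    then show "(i, g, j) \<in> fst x"
    proof cases
      case 1
      then show ?thesis using state_coloured [OF x] by (auto simp: coloured_def)
    next
      case 2
      then obtain B where B: "B \<in> \<beta>" "\<exists>b\<in>B. \<exists>h. b j = Some h \<and> b i = Some (g \<otimes> h)" and g: "g \<in> carrier G"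
        by (auto simp: block_rel_def)
      obtain k where k: "B = gclass G (block_of x k)" "snd x k = None" using B(1) by (auto simp: \<beta>_def)
      have kB: "block_of x k \<in> B" unfolding k(1) by (rule gclass_self [OF ran [OF k(2)]])
      have "j \<in> dom (block_of x k)" using B(2) unfolding k(1) by (auto elim!: gclassE simp: rtranslate_Some)
      then obtain h where "block_of x k j = Some h" by blast
      then obtain h where h: "block_of x k j = Some h" "block_of x k i = Some (g \<otimes> h)"
        using block_rel_value [OF dow 2 B(1) kB] by blast
      then have e: "(j, h, k) \<in> fst x" "(i, g \<otimes> h, k) \<in> fst x" using b [OF k(2)] by auto
      have "(i, (g \<otimes> h) \<otimes> inv h, j) \<in> fst x" by (rule state_mult [OF x e(2) state_inv [OF x e(1)]])
      then show ?thesis using g state_rel(2) [OF x e(1)] by (simp add: m_assoc)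
    qed
  next
    assume e: "(i, g, j) \<in> fst x"
    note r = state_rel [OF x e]
    show "(i, g, j) \<in> fst (encode (\<beta>, snd x))"
    proof (cases "snd x j")
      case None
      have "gclass G (block_of x j) \<in> \<beta>" using None r by (auto simp: \<beta>_def)
      moreover have "block_of x j j = Some \<one>" "block_of x j i = Some (g \<otimes> \<one>)"
        using b [OF None] e state_one [OF x r(3)] r by auto
      ultimately have "(i, g, j) \<in> block_rel \<beta>"
        using r gclass_self [OF ran [OF None]] block_relI [of "gclass G (block_of x j)" \<beta> "block_of x j" j \<one> i g]
        by blast
      then show ?thesis by (simp add: in_encode)
    next
      case (Some t)
      then have "(i, g, j) \<in> coloured (snd x)" using state_act [OF x e] r by (auto simp: coloured_def)
      then show ?thesis by (simp add: in_encode)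
    qed
  qed
  then have "encode (\<beta>, snd x) = x" by (intro state_eqI) auto
  then show ?thesis using dow by blast
qed

lemma encode_le_iff:
  "\<lbrakk>x \<in> dowling n G S; y \<in> dowling n G S\<rbrakk> \<Longrightarrow> dowling_le n G S \<phi> x y \<longleftrightarrow> encode x \<sqsubseteq> encode y"
  using encode_mono dowling_le_if_encode_le by blast

lemma dowling_bot_in: "dowling_bot n G \<in> dowling n G S"
  and encode_bot: "encode (dowling_bot n G) = bot_state {1..n}"
proof -
  have blk: "gclass G [i \<mapsto> \<one>] \<in> gblocks n G" if "i \<in> {1..n}" for i
    by (rule gclass_in_gblocks) (use that in auto)
  have u: "underlying (gclass G [i \<mapsto> \<one>]) = {i}" for i by (simp add: underlying_gclass)
  show d: "dowling_bot n G \<in> dowling n G S"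
    unfolding dowling_bot_def dowling_iff using blk u by auto
  show "encode (dowling_bot n G) = bot_state {1..n}"
  proof (rule state_le_antisym)
    show "encode (dowling_bot n G) \<sqsubseteq> bot_state {1..n}"
    proof (rule state_leI)
      fix i g j assume "(i, g, j) \<in> fst (encode (dowling_bot n G))"
      then have "(i, g, j) \<in> block_rel ((\<lambda>i. gclass G [i \<mapsto> \<one>]) ` {1..n})"
        by (auto simp: dowling_bot_def in_encode coloured_def)
      then obtain k b h where k: "k \<in> {1..n}" "b \<in> gclass G [k \<mapsto> \<one>]" "b j = Some h" "b i = Some (g \<otimes> h)" "g \<in> carrier G"
        by (auto simp: block_rel_def)
      then have "j = k" "i = k" "h \<in> carrier G" "g \<otimes> h = h" by (auto elim!: gclassE simp: rtranslate_Some split: if_splits)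
      moreover from this have "g = \<one>" using k(5) by simp
      ultimately show "(i, g, j) \<in> fst (bot_state {1..n})" using k(1) by simp
    qed (simp add: dowling_bot_def)
    show "bot_state {1..n} \<sqsubseteq> encode (dowling_bot n G)"
      by (rule bot_le) (metis d prod.collapse state_encode)
  qed
qed

end

section \<open>Removing the free orbits\<close>

locale dowling_setup = group_action G S \<phi> for G :: "('g, 'm) monoid_scheme" (structure) and S :: "'s set" and \<phi> +
  fixes T :: "'s set"
  assumes T_subset: "T \<subseteq> S"
    and T_invariant: "\<lbrakk>g \<in> carrier G; t \<in> T\<rbrakk> \<Longrightarrow> \<phi> g t \<in> T"
    and fixed_or_free: "\<lbrakk>Q \<in> orbits G S \<phi>; Q \<subseteq> S - T\<rbrakk> \<Longrightarrow>
           (\<exists>s. Q = {s}) \<or> (\<forall>s\<in>Q. stabilizer G \<phi> s = {\<one>})"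
begin

definition Fix :: "'s set" where
  "Fix = {s \<in> S - T. \<forall>g\<in>carrier G. \<phi> g s = s}"

abbreviation "S\<^sub>1 \<equiv> T \<union> Fix"

sublocale full: dowling_action G S \<phi>
proof -
  interpret group G using group_hom group_hom.axioms(1) by blast
  show "dowling_action G S \<phi>"
    by unfold_locales (use action_laws in auto)
qed

lemma S1_subset: "S\<^sub>1 \<subseteq> S"
  using T_subset by (auto simp: Fix_def)

lemma S1_invariant: "\<lbrakk>g \<in> carrier G; s \<in> S\<^sub>1\<rbrakk> \<Longrightarrow> \<phi> g s \<in> S\<^sub>1"
  using T_invariant by (auto simp: Fix_def)

sublocale core: dowling_action G "S\<^sub>1" \<phi>
proof unfold_locales
  show "\<phi> g s \<in> S\<^sub>1" if "g \<in> carrier G" "s \<in> S\<^sub>1" for g s by (rule S1_invariant [OF that])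
  show "\<phi> \<one> s = s" if "s \<in> S\<^sub>1" for s using full.act_one S1_subset that by blast
  show "\<phi> (g \<otimes> h) s = \<phi> g (\<phi> h s)" if "g \<in> carrier G" "h \<in> carrier G" "s \<in> S\<^sub>1" for g h s
    using full.act_mult S1_subset that by blast
qed

lemma orbit_in_orbits: "s \<in> S \<Longrightarrow> orbit G \<phi> s \<in> orbits G S \<phi>"
  by (auto simp: orbits_def)

lemma orbit_disjoint_T:
  assumes "s \<in> S" "s \<notin> T"
  shows "orbit G \<phi> s \<subseteq> S - T"
proof
  fix t assume "t \<in> orbit G \<phi> s"
  then obtain g where g: "g \<in> carrier G" "t = \<phi> g s" by (auto simp: orbit_def)
  then have "s = \<phi> (inv g) t" using assms(1) by simp
  then show "t \<in> S - T" using g assms T_invariant [of "inv g" t] by auto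
qed

lemma orbit_Fix: "s \<in> Fix \<Longrightarrow> orbit G \<phi> s = {s}"
  using orbit_refl [of s] by (auto simp: orbit_def Fix_def)

lemma singleton_orbit_Fix:
  assumes "{s} \<in> orbits G S \<phi>" "s \<in> S - T"
  shows "s \<in> Fix"
proof -
  obtain t where "t \<in> S" "{s} = orbit G \<phi> t" using assms(1) by (auto simp: orbits_def)
  moreover from this have "t = s" using orbit_refl by auto
  ultimately have "\<phi> g s = s" if "g \<in> carrier G" for g using that by (auto simp: orbit_def)
  then show ?thesis using assms(2) by (simp add: Fix_def)
qed

text \<open>This is where the assumption on the orbits enters: a colour outside
  \<open>S\<^sub>1\<close> lies in an orbit disjoint from \<open>T\<close> with more than one
  element, so its stabilizer is trivial.\<close>

lemma free_outside:
  assumes s: "s \<in> S" "s \<notin> S\<^sub>1" and g: "g \<in> carrier G" "\<phi> g s = s"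
  shows "g = \<one>"
proof -
  have Q: "orbit G \<phi> s \<in> orbits G S \<phi>" "orbit G \<phi> s \<subseteq> S - T" "s \<in> orbit G \<phi> s"
    using orbit_in_orbits orbit_disjoint_T orbit_refl s by auto
  have "orbit G \<phi> s \<noteq> {t}" for t
  proof
    assume "orbit G \<phi> s = {t}"
    then have "s \<in> Fix" using Q singleton_orbit_Fix [of s] s by auto
    then show False using s by blast
  qed
  then have "stabilizer G \<phi> s = {\<one>}" using fixed_or_free [OF Q(1,2)] Q(3) by blast
  moreover have "g \<in> stabilizer G \<phi> s" using g by (simp add: stabilizer_def)
  ultimately show ?thesis by simp
qed

definition restricted_states :: "nat set \<Rightarrow> ('g, 's) state set" where
  "restricted_states N = {x. full.state N x \<and>
     (\<forall>Q\<in>orbits G S \<phi>. Q \<subseteq> S - T \<longrightarrow> card {i. \<exists>s\<in>Q. snd x i = Some s} \<noteq> 1)}"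

text \<open>
  A free orbit can be forgotten: the points of the zero block coloured by it are merged into a
  block, which is the greatest state below without these colours.
\<close>

definition uncolour :: "('g, 's) state \<Rightarrow> ('g, 's) state" where
  "uncolour x = (fst x, \<lambda>i. case snd x i of None \<Rightarrow> None | Some t \<Rightarrow> if t \<in> S\<^sub>1 then Some t else None)"

lemma snd_uncolour: "snd (uncolour x) i = Some t \<longleftrightarrow> snd x i = Some t \<and> t \<in> S\<^sub>1"
  by (auto simp: uncolour_def split: option.splits)

lemma core_state_iff: "core.state N x \<longleftrightarrow> full.state N x \<and> ran (snd x) \<subseteq> S\<^sub>1"
proof -
  have "ran (snd x) \<subseteq> S\<^sub>1 \<longleftrightarrow> ran (snd x) \<subseteq> S \<and> ran (snd x) \<subseteq> S\<^sub>1" using S1_subset by blast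
  then show ?thesis unfolding core.state_def full.state_def by argo
qed

text \<open>The points that lose their colour must have trivial isotropy; this is the triviality of
  the stabilizers of the forgotten colours.\<close>

lemma state_uncolour:
  assumes x: "full.state N x"
  shows "core.state N (uncolour x)"
proof -
  have "core.state N (fst x, snd (uncolour x))"
  proof (rule core.stateI, goal_cases)
    case (1 i t) then show ?case using full.state_colour [OF x] by (simp add: snd_uncolour)
  next
    case (2 i g j) then show ?case using full.state_rel [OF x] by blast
  next
    case (3 i) then show ?case by (rule full.state_one [OF x])
  next
    case (4 i g j) then show ?case by (rule full.state_inv [OF x])
  next
    case (5 i g j h l) then show ?case by (rule full.state_mult [OF x])
  next
    case (6 i g j t)
    then show ?case
      using full.state_act [OF x] full.state_rel [OF x] S1_invariant by (simp add: snd_uncolour)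
  next
    case (7 i g j t) then show ?case using full.state_coloured [OF x] by (simp add: snd_uncolour)
  next
    case (8 i g)
    show ?case
    proof (cases "snd x i")
      case None then show ?thesis using full.state_free [OF x 8(1)] by blast
    next
      case (Some t)
      then have "t \<notin> S\<^sub>1" using 8(2) snd_uncolour [of x i t] by auto
      moreover have "\<phi> g t = t" using full.state_act [OF x 8(1) Some] Some by simp
      ultimately show ?thesis
        using free_outside full.state_colour [OF x Some] full.state_rel [OF x 8(1)] by blast
    qed
  qed
  then show ?thesis by (simp add: uncolour_def)
qed

lemma uncolour_le: "uncolour x \<sqsubseteq> x"
  by (rule state_leI) (auto simp: snd_uncolour, simp add: uncolour_def)

text \<open>A state coloured by \<open>S\<^sub>1\<close> meets an orbit outside \<open>T\<close>
  only if this orbit is a fixed point; so the condition on orbits reduces to one on fibres.\<close>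

lemma nonbot_subset: "core.nonbot N N Fix \<subseteq> restricted_states N - {full.bot_state N}"
proof
  fix x assume x: "x \<in> core.nonbot N N Fix"
  then have f: "x \<in> core.fam N N Fix" "x \<noteq> full.bot_state N" by (auto simp: core.nonbot_def)
  have st: "full.state N x" "ran (snd x) \<subseteq> S\<^sub>1" using core.famD(1) [OF f(1)] core_state_iff by auto
  have "card {i. \<exists>s\<in>Q. snd x i = Some s} \<noteq> 1" if Q: "Q \<in> orbits G S \<phi>" "Q \<subseteq> S - T" for Q
  proof
    assume "card {i. \<exists>s\<in>Q. snd x i = Some s} = 1"
    then obtain i where i: "{i. \<exists>s\<in>Q. snd x i = Some s} = {i}" by (auto simp: card_1_singleton_iff)
    then obtain s where s: "s \<in> Q" "snd x i = Some s" by blast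
    then have sF: "s \<in> Fix" using st(2) Q(2) by (auto intro: ranI)
    have "Q = {s}"
    proof -
      have "s \<in> orbit G \<phi> s" "orbit G \<phi> s \<in> orbits G S \<phi>"
        using s(1) Q(2) orbit_refl orbit_in_orbits by auto
      then have "Q = orbit G \<phi> s" using disjoint_union [OF Q(1), of "orbit G \<phi> s"] s(1) by blast
      then show ?thesis using orbit_Fix [OF sF] by simp
    qed
    then have "fib x s = {i}" using i by (simp add: fib_def)
    moreover have "i \<in> N" by (rule full.state_colour(1) [OF st(1) s(2)])
    ultimately show False using core.famD(2) [OF f(1) sF] by blast
  qed
  then show "x \<in> restricted_states N - {full.bot_state N}"
    using st(1) f(2) by (simp add: restricted_states_def)
qed

text \<open>If forgetting led to the bottom, all colours of \<open>x\<close> would be free ones. But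
  by the condition on orbits, a free colour at \<open>i\<close> comes with a second point
  \<open>j\<close> coloured in the same orbit, and the relation between \<open>i\<close> and
  \<open>j\<close> survives.\<close>

lemma uncolour_in_nonbot:
  assumes fin: "finite N" and x: "x \<in> restricted_states N - {full.bot_state N}"
  shows "uncolour x \<in> core.nonbot N N Fix"
proof -
  have st: "full.state N x" using x by (simp add: restricted_states_def)
  have c: "card {i. \<exists>s\<in>Q. snd x i = Some s} \<noteq> 1" if "Q \<in> orbits G S \<phi>" "Q \<subseteq> S - T" for Q
    using x that by (simp add: restricted_states_def)
  have "fib (uncolour x) s \<noteq> {i}" if s: "s \<in> Fix" for s i
  proof
    assume "fib (uncolour x) s = {i}"
    then have "{j. \<exists>t\<in>{s}. snd x j = Some t} = {i}" using s by (simp add: fib_def snd_uncolour)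
    moreover have "{s} \<in> orbits G S \<phi>" "{s} \<subseteq> S - T"
      using orbit_in_orbits [of s] orbit_Fix [OF s] s by (auto simp: Fix_def)
    ultimately show False using c by fastforce
  qed
  then have f: "uncolour x \<in> core.fam N N Fix"
    using state_uncolour [OF st] by (simp add: core.fam_def)
  have "uncolour x \<noteq> full.bot_state N"
  proof
    assume b: "uncolour x = full.bot_state N"
    have fx: "fst x = fst (full.bot_state N)" using b by (simp add: uncolour_def flip: b)
    have "\<exists>i t. snd x i = Some t"
    proof (rule ccontr)
      assume "\<nexists>i t. snd x i = Some t"
      then have "snd x = Map.empty" by auto
      then have "x = full.bot_state N" using fx by (simp add: prod_eq_iff)
      then show False using x by simp
    qed
    then obtain i t where i: "snd x i = Some t" by blast
    have t: "t \<in> S" by (rule full.state_colour(2) [OF st i])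
    have "t \<notin> S\<^sub>1" using snd_uncolour [of x i t] i b by auto
    let ?I = "{j. \<exists>s\<in>orbit G \<phi> t. snd x j = Some s}"
    have iI: "i \<in> ?I" using i orbit_refl [OF t] by blast
    have "card ?I \<noteq> 1" using c orbit_in_orbits [OF t] orbit_disjoint_T [OF t] \<open>t \<notin> S\<^sub>1\<close> by blast
    then have "?I \<noteq> {i}" by (metis card_1_singleton_iff One_nat_def)
    then obtain j where j: "j \<in> ?I" "j \<noteq> i" using iI by blast
    then obtain g where "g \<in> carrier G" "snd x j = Some (\<phi> g t)" by (auto simp: orbit_def)
    then have "(j, g, i) \<in> fst x" using full.state_coloured [OF st _ i] by blast
    then show False unfolding fx using j(2) by simp
  qed
  then show ?thesis using f by (simp add: core.nonbot_def)
qed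

lemma collapses_restricted_states:
  assumes "finite N" "finite S" "finite (carrier G)"
  shows "collapses (order_complex (restricted_states N - {full.bot_state N}) (\<sqsubseteq>))
    (order_complex (core.nonbot N N Fix) (\<sqsubseteq>))"
proof (rule collapses_coreflection [where f = uncolour])
  show "finite (restricted_states N - {full.bot_state N})"
    by (rule finite_subset [OF _ full.finite_states [OF assms]]) (auto simp: restricted_states_def)
  show "core.nonbot N N Fix \<subseteq> restricted_states N - {full.bot_state N}" by (rule nonbot_subset)
  show "uncolour x \<in> core.nonbot N N Fix \<and> uncolour x \<sqsubseteq> x"
    if "x \<in> restricted_states N - {full.bot_state N} - core.nonbot N N Fix" for x
    using that uncolour_in_nonbot [OF assms(1)] uncolour_le by blast
  show "y \<sqsubseteq> uncolour x" if y: "y \<in> core.nonbot N N Fix" "y \<sqsubseteq> x" for x y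
  proof (rule state_leI)
    show "(i, g, j) \<in> fst (uncolour x)" if "(i, g, j) \<in> fst y" for i g j
      using state_leD(1) [OF y(2) that] by (simp add: uncolour_def)
    show "snd (uncolour x) i = Some s" if "snd y i = Some s" for i s
    proof -
      have "core.state N y" using y(1) by (auto simp: core.nonbot_def core.fam_def)
      then show ?thesis using core.state_colour(2) that state_leD(2) [OF y(2) that] by (simp add: snd_uncolour)
    qed
  qed
  show "x = y" if "x \<sqsubseteq> y" "y \<sqsubseteq> x" for x y :: "('g, 's) state" by (rule state_le_antisym [OF that])
  show "x \<sqsubseteq> z" if "x \<sqsubseteq> y" "y \<sqsubseteq> z" for x y z :: "('g, 's) state" by (rule state_le_trans [OF that])
qed simp

text \<open>All points are light here, so pruning at the point 1 removes nothing.\<close>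

lemma spherical_core:
  assumes "2 \<le> n" "finite S" "finite (carrier G)"
  shows "spherical (n - (if S\<^sub>1 = {} then 1 else 0)) (order_complex (core.nonbot {1..n} {1..n} Fix) (\<sqsubseteq>))"
proof -
  have n: "1 \<in> {1..n}" using assms(1) by simp
  have "core.fixed_points Fix"
    unfolding core.fixed_points_def
  proof (intro conjI ballI)
    show "\<phi> g s = s" if "s \<in> Fix" "g \<in> carrier G" for s g using that by (simp add: Fix_def)
  qed blast
  moreover have "finite S\<^sub>1" using assms(2) S1_subset finite_subset by blast
  ultimately have "spherical (card {1..n} - (if S\<^sub>1 = {} then 1 else 0))
      (order_complex (core.pruned {1..n} {1..n} Fix 1) (\<sqsubseteq>))"
    by (intro core.spherical_pruned) (use assms n in auto)
  then show ?thesis using core.nonbot_eq_pruned [OF n, of "{1..n}" Fix] by simp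
qed

section \<open>Transfer to the Dowling poset\<close>

lemma encode_dowling_sub:
  "full.encode ` (dowling_sub n G S \<phi> T - {dowling_bot n G}) = restricted_states {1..n} - {full.bot_state {1..n}}"
proof -
  let ?D = "dowling_sub n G S \<phi> T"
  have D: "w \<in> ?D \<longleftrightarrow> w \<in> dowling n G S \<and> full.encode w \<in> restricted_states {1..n}" for w
    using full.state_encode [of "fst w" "snd w" n]
    by (auto simp: dowling_sub_def restricted_states_def split: prod.splits)
  have inj: "inj_on full.encode (dowling n G S)" by (rule full.inj_on_encode)
  show ?thesis
  proof (intro equalityI subsetI)
    fix x assume "x \<in> full.encode ` (?D - {dowling_bot n G})"
    then obtain w where w: "w \<in> ?D" "w \<noteq> dowling_bot n G" "x = full.encode w" by blast
    have "x \<noteq> full.bot_state {1..n}"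
      using inj_onD [OF inj _ _ full.dowling_bot_in, of w] w D full.encode_bot [of n] by auto
    then show "x \<in> restricted_states {1..n} - {full.bot_state {1..n}}" using w D by blast
  next
    fix x assume x: "x \<in> restricted_states {1..n} - {full.bot_state {1..n}}"
    then obtain w where w: "w \<in> dowling n G S" "x = full.encode w"
      using full.encode_surj [of n x] by (auto simp: restricted_states_def)
    have "w \<in> ?D" using w x D by blast
    moreover have "w \<noteq> dowling_bot n G" using w(2) x full.encode_bot [of n] by auto
    ultimately show "x \<in> full.encode ` (?D - {dowling_bot n G})" using w(2) by blast
  qed
qed

text \<open>Collapses and sphericity are moved along the inverse of the encoding, so that
  realizations are taken only of complexes on the Dowling poset itself.\<close>

theorem dowling_sub_wedge:
  assumes "2 \<le> n" "finite S" "finite (carrier G)" and d: "Suc d = n - (if S\<^sub>1 = {} then 1 else 0)"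
  shows "\<exists>k. geometric_realization
               (order_complex (dowling_sub n G S \<phi> T - {dowling_bot n G}) (dowling_le n G S \<phi>))
             homotopy_equivalent_space sphere_wedge d k"
proof -
  let ?D = "dowling_sub n G S \<phi> T - {dowling_bot n G}" and ?P = "restricted_states {1..n} - {full.bot_state {1..n}}"
  let ?N = "order_complex (core.nonbot {1..n} {1..n} Fix) (\<sqsubseteq>)"
  define h where "h = inv_into ?D full.encode"
  have sub: "?D \<subseteq> dowling n G S" by (auto simp: dowling_sub_def)
  have bij: "bij_betw full.encode ?D ?P"
    unfolding bij_betw_def using inj_on_subset [OF full.inj_on_encode sub] encode_dowling_sub by simp
  then have bij_h: "bij_betw h ?P ?D" unfolding h_def by (rule bij_betw_inv_into)
  have eh: "full.encode (h x) = x" "h x \<in> ?D" if "x \<in> ?P" for x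
    using bij_betw_inv_into_right [OF bij that] bij_betwE [OF bij_h] that by (auto simp: h_def)
  have "dowling_le n G S \<phi> (h x) (h y) \<longleftrightarrow> x \<sqsubseteq> y" if "x \<in> ?P" "y \<in> ?P" for x y
    using full.encode_le_iff [of "h x" n "h y"] eh [OF that(1)] eh [OF that(2)] sub by auto
  then have "order_complex (h ` ?P) (dowling_le n G S \<phi>) = (`) h ` order_complex ?P (\<sqsubseteq>)"
    by (rule order_complex_image)
  then have oc: "order_complex ?D (dowling_le n G S \<phi>) = (`) h ` order_complex ?P (\<sqsubseteq>)"
    using bij_h by (simp add: bij_betw_def)
  have inj: "inj_on h ?P" using bij_h by (simp add: bij_betw_def)
  have "collapses (order_complex ?P (\<sqsubseteq>)) ?N"
    by (rule collapses_restricted_states) (use assms in auto)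
  then have c: "collapses (order_complex ?D (dowling_le n G S \<phi>)) ((`) h ` ?N)"
    unfolding oc by (rule collapses_image) (rule inj_on_subset [OF inj Union_order_complex])
  have "spherical (Suc d) ?N" unfolding d by (rule spherical_core [OF assms(1-3)])
  then have s: "spherical (Suc d) ((`) h ` ?N)"
    by (rule spherical_image)
       (rule inj_on_subset [OF inj subset_trans [OF Union_order_complex nonbot_subset]])
  have sc: "simplicial_complex (order_complex ?D (dowling_le n G S \<phi>))"
    by (rule simplicial_complex_order_complex)
  have "finite ?P"
    by (rule finite_subset [OF _ full.finite_states [of "{1..n}"]]) (use assms in \<open>auto simp: restricted_states_def\<close>)
  then have "finite ((`) h ` ?N)"
    using finite_order_complex finite_subset [OF nonbot_subset] by blast
  then obtain k where "geometric_realization ((`) h ` ?N) homotopy_equivalent_space sphere_wedge d k"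
    using spherical_homotopy_equivalent [OF collapses_simplicial_complex [OF c sc] _ s] by blast
  then show ?thesis
    using homotopy_eqv_trans [OF collapses_realization [OF c sc]] by blast
qed

end

theorem theoremD:
  fixes G :: "('g, 'm) monoid_scheme" and S T :: "'s set" and \<phi> :: "'g \<Rightarrow> 's \<Rightarrow> 's" and n d :: nat
  assumes "n \<ge> 2"
    and "finite (carrier G)"
    and "finite S" and "card S \<ge> 1"
    and "group_action G S \<phi>"
    and "T \<subseteq> S" and "\<forall>g\<in>carrier G. \<forall>t\<in>T. \<phi> g t \<in> T"
    and "\<forall>Q\<in>orbits G S \<phi>. Q \<subseteq> S - T \<longrightarrow>
           (\<exists>s. Q = {s}) \<or> (\<forall>s\<in>Q. stabilizer G \<phi> s = {\<one>\<^bsub>G\<^esub>})"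
    and "d = (if T \<noteq> {} \<or> (\<exists>Q\<in>orbits G S \<phi>. Q \<subseteq> S - T \<and> (\<exists>s. Q = {s})) then n - 1 else n - 2)"
  shows "\<exists>k. geometric_realization
               (order_complex (dowling_sub n G S \<phi> T - {dowling_bot n G}) (dowling_le n G S \<phi>))
             homotopy_equivalent_space sphere_wedge d k"
proof -
  interpret group_action G S \<phi> by (rule assms(5))
  interpret dowling_setup G S \<phi> T by unfold_locales (use assms(6-8) in auto)
  have "(\<exists>Q\<in>orbits G S \<phi>. Q \<subseteq> S - T \<and> (\<exists>s. Q = {s})) \<longleftrightarrow> Fix \<noteq> {}"
  proof
    assume "\<exists>Q\<in>orbits G S \<phi>. Q \<subseteq> S - T \<and> (\<exists>s. Q = {s})"
    then show "Fix \<noteq> {}" using singleton_orbit_Fix by blast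
  next
    assume "Fix \<noteq> {}"
    then obtain s where s: "s \<in> Fix" by blast
    then have "{s} \<in> orbits G S \<phi>" "{s} \<subseteq> S - T"
      using orbit_in_orbits [of s] orbit_Fix [OF s] by (auto simp: Fix_def)
    then show "\<exists>Q\<in>orbits G S \<phi>. Q \<subseteq> S - T \<and> (\<exists>s. Q = {s})" by blast
  qed
  \<comment> \<open>As \<open>n\<close> is at least 2, the truncated subtractions in
    \<open>d\<close> are exact; the distinction is whether a colour remains in
    \<open>T \<union> Fix\<close>.\<close>
  then have "Suc d = n - (if T \<union> Fix = {} then 1 else 0)"
    using assms(1,9) by auto
  then show ?thesis by (rule dowling_sub_wedge [OF assms(1,3,2)])
qed

end
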